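(* Every $4$-edge-connected graph $G$ that has no edge-cut of any size in $\{6,7,\ldots,40\}$ admits a nowhere-zero $3$-flow.
   Context: Graphs are finite and loopless, but may contain parallel edges. An edge-cut of a graph is an inclusion-minimal set of edges whose removal increases the number of connected components (i.e. a bond); its size is its number of edges. For an integer $k\ge 2$, a nowhere-zero $k$-flow of $G$ is a pair $(D,f)$ where $D$ is an orientation of $G$ and $f:E(G)\to\{1,2,\ldots,k-1\}$ satisfies $\sum_{e\in E_D^+(v)}f(e)=\sum_{e\in E_D^-(v)}f(e)$ for every $v\in V(G)$, where $E_D^+(v)$ and $E_D^-(v)$ are the sets of edges directed away from and toward $v$ in $D$, respectively. *)

theory Defs
  imports "Graph_Theory.Digraph"
begin

record ('v, 'e) multigraph =
  vertices :: "'v set"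
  edges :: "'e set"
  ends :: "'e \<Rightarrow> 'v set"

(* Edges have their own identities, so distinct edges may have the same ends (parallel edges);
   the cardinality condition excludes loops. *)
locale fin_loopless_multigraph =
  fixes G :: "('v, 'e) multigraph"
  assumes finite_vertices: "finite (vertices G)"
    and finite_edges: "finite (edges G)"
    and ends_subset: "e \<in> edges G \<Longrightarrow> ends G e \<subseteq> vertices G"
    and card_ends: "e \<in> edges G \<Longrightarrow> card (ends G e) = 2"

definition delete_edges :: "('v, 'e) multigraph \<Rightarrow> 'e set \<Rightarrow> ('v, 'e) multigraph" where
  "delete_edges G F = G\<lparr>edges := edges G - F\<rparr>"

definition adj :: "('v, 'e) multigraph \<Rightarrow> 'v rel" where
  "adj G = {(u, v). \<exists>e \<in> edges G. ends G e = {u, v}}"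

definition components :: "('v, 'e) multigraph \<Rightarrow> 'v set set" where
  "components G = vertices G // {(u, v). u \<in> vertices G \<and> v \<in> vertices G \<and> (u, v) \<in> (adj G)\<^sup>*}"

definition connected_graph :: "('v, 'e) multigraph \<Rightarrow> bool" where
  "connected_graph G \<longleftrightarrow> card (components G) = 1"

(* The null graph is not k-edge-connected for any k > 0; the one-vertex graph is k-edge-connected
   for every k. *)
definition k_edge_connected :: "nat \<Rightarrow> ('v, 'e) multigraph \<Rightarrow> bool" where
  "k_edge_connected k G \<longleftrightarrow>
     (\<forall>F. F \<subseteq> edges G \<and> card F < k \<longrightarrow> connected_graph (delete_edges G F))"

definition separating :: "('v, 'e) multigraph \<Rightarrow> 'e set \<Rightarrow> bool" where
  "separating G C \<longleftrightarrow>
     C \<subseteq> edges G \<and> card (components (delete_edges G C)) > card (components G)"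

definition edge_cut :: "('v, 'e) multigraph \<Rightarrow> 'e set \<Rightarrow> bool" where
  "edge_cut G C \<longleftrightarrow> separating G C \<and> (\<forall>C'. C' \<subset> C \<longrightarrow> \<not> separating G C')"

(* An orientation of G is a digraph with the same vertices and the same edges, each edge e now being
   an arc from one of its ends to the other. *)
definition orientation :: "('v, 'e) multigraph \<Rightarrow> ('v, 'e) pre_digraph \<Rightarrow> bool" where
  "orientation G D \<longleftrightarrow>
     verts D = vertices G \<and> arcs D = edges G \<and>
     (\<forall>e \<in> edges G. {tail D e, head D e} = ends G e)"

definition nowhere_zero_flow ::
    "nat \<Rightarrow> ('v, 'e) multigraph \<Rightarrow> ('v, 'e) pre_digraph \<Rightarrow> ('e \<Rightarrow> nat) \<Rightarrow> bool" where
  "nowhere_zero_flow k G D f \<longleftrightarrow>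
     orientation G D \<and>
     (\<forall>e \<in> edges G. f e \<in> {1..k - 1}) \<and>
     (\<forall>v \<in> vertices G. (\<Sum>e \<in> out_arcs D v. f e) = (\<Sum>e \<in> in_arcs D v. f e))"

end

theory Submission
  imports Defs "HOL-Library.Disjoint_Sets"
begin

text \<open>
  It suffices to find an orientation in which the net outflow of every vertex is divisible by
  \<open>3\<close>; by an argument of Tutte (\<open>orientable_imp_flow\<close>) it can be turned into a flow with values
  \<open>1\<close> and \<open>2\<close>. More generally one prescribes the net outflow of every vertex modulo \<open>3\<close>, subject
  to the total being zero. A graph in which all such demands can be met is called freely
  orientable here; the usual term is \<open>Z\<^sub>3\<close>-connected.

  The engine is the theorem of Lovasz, Thomassen, Wu and Zhang, \<open>preoriented_orientable\<close>, which
  says that a preorientation of the edges at one vertex extends if all cuts are large enough in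
  terms of the flow demanded across them. Its consequence for six-edge-connected graphs is
  strengthened in \<open>dense_freely_orientable\<close>: a graph is freely orientable if every partition of
  its vertices into \<open>k\<close> blocks is crossed by at least \<open>4 * (k - 1)\<close> edges. Indeed, one side of a
  cut with at most five edges satisfies the same condition, and it can be contracted or, if it is
  a single vertex, removed by lifting two of its edges.

  In the given graph, cuts of size four and five remain. Suppose first that they are all stars of
  vertices. Then, apart from graphs with at most three vertices, the vertices of degree at most
  five are pairwise nonadjacent (\<open>small_independent\<close>), so each of them may be read as a hyperedge
  with at most five elements on the set of big vertices. A cut between big vertices has at least
  \<open>41\<close> edges, and a hyperedge accounts for at most two of them. Even if one small vertex \<open>z\<close> is
  discarded, at least \<open>20\<close> hyperedges are therefore split by every nonempty
  proper subset of the big vertices (\<open>big_block_cut\<close>), and every partition into \<open>k\<close> blocks splits at least \<open>20 * k / 5 = 4 * k\<close>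
  hyperedges. Each hyperedge can be trimmed to a pair without losing the partition condition
  (\<open>trim_hyperedge\<close>), and trimming is realised in the graph by lifting two edges at the small vertex
  and orienting the others. So the graph without \<open>z\<close> is freely orientable, which means that every
  admissible preorientation at \<open>z\<close> extends.

  In general a minimal set with a small cut is contracted, the smaller graph is oriented by
  induction, and the case just described, with \<open>z\<close> representing the rest of the graph, extends
  the orientation to the inside of the set (\<open>gapped_orientable\<close>).
\<close>

section \<open>Signed orientations of multigraphs\<close>

definition inc :: "('e \<Rightarrow> 'v \<times> 'v) \<Rightarrow> 'e \<Rightarrow> 'v \<Rightarrow> int" where
  "inc g e v = of_bool (fst (g e) = v) - of_bool (snd (g e) = v)"

definition net :: "'e set \<Rightarrow> ('e \<Rightarrow> 'v \<times> 'v) \<Rightarrow> ('e \<Rightarrow> int) \<Rightarrow> 'v \<Rightarrow> int" where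
  "net E g x v = (\<Sum>e\<in>E. x e * inc g e v)"

definition signs :: "('e \<Rightarrow> int) \<Rightarrow> bool" where
  "signs x \<longleftrightarrow> (\<forall>e. x e = 1 \<or> x e = -1)"

text \<open>An orientation is a sign on every edge relative to the reference direction \<open>g\<close>, so that
net outflows are linear in it. Loops contribute nothing to them and may stay in the graph.\<close>

definition orientable :: "'v set \<Rightarrow> 'e set \<Rightarrow> ('e \<Rightarrow> 'v \<times> 'v) \<Rightarrow> ('v \<Rightarrow> int) \<Rightarrow> bool" where
  "orientable V E g \<gamma> \<longleftrightarrow> (\<exists>x. signs x \<and> (\<forall>v\<in>V. 3 dvd net E g x v - \<gamma> v))"

definition ends_in :: "'v set \<Rightarrow> 'e set \<Rightarrow> ('e \<Rightarrow> 'v \<times> 'v) \<Rightarrow> bool" where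
  "ends_in V E g \<longleftrightarrow> (\<forall>e\<in>E. fst (g e) \<in> V \<and> snd (g e) \<in> V)"

definition crosses :: "('e \<Rightarrow> 'v \<times> 'v) \<Rightarrow> 'e \<Rightarrow> 'v set \<Rightarrow> bool" where
  "crosses g e A \<longleftrightarrow> (fst (g e) \<in> A) \<noteq> (snd (g e) \<in> A)"

definition deg :: "'e set \<Rightarrow> ('e \<Rightarrow> 'v \<times> 'v) \<Rightarrow> 'v set \<Rightarrow> int" where
  "deg E g A = (\<Sum>e\<in>E. of_bool (crosses g e A))"

definition links :: "('e \<Rightarrow> 'v \<times> 'v) \<Rightarrow> 'e \<Rightarrow> 'v \<Rightarrow> 'v \<Rightarrow> bool" where
  "links g e u v \<longleftrightarrow> g e = (u, v) \<or> g e = (v, u)"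

definition inside :: "'e set \<Rightarrow> ('e \<Rightarrow> 'v \<times> 'v) \<Rightarrow> 'v set \<Rightarrow> 'e set" where
  "inside E g A = {e\<in>E. fst (g e) \<in> A \<and> snd (g e) \<in> A}"

lemma signsD: "signs x \<Longrightarrow> x e = 1 \<or> x e = -1"
  by (simp add: signs_def)

lemma sum_inc:
  assumes "finite A"
  shows "(\<Sum>v\<in>A. inc g e v) = of_bool (fst (g e) \<in> A) - of_bool (snd (g e) \<in> A)"
  using assms by (simp add: inc_def sum_subtractf of_bool_def sum.delta)

lemma sum_net:
  assumes "finite A"
  shows "(\<Sum>v\<in>A. net E g x v)
    = (\<Sum>e\<in>E. x e * (of_bool (fst (g e) \<in> A) - of_bool (snd (g e) \<in> A)))"
  unfolding net_def by (subst sum.swap) (simp add: sum_inc[OF assms] flip: sum_distrib_left)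

lemma sum_net_all:
  assumes "finite V" "ends_in V E g"
  shows "(\<Sum>v\<in>V. net E g x v) = 0"
  unfolding sum_net[OF assms(1)]
  by (rule sum.neutral) (use assms(2) in \<open>auto simp: ends_in_def\<close>)

lemma net_remove:
  assumes "finite E" "e \<in> E"
  shows "net E g x v = x e * inc g e v + net (E - {e}) g x v"
  unfolding net_def using assms by (rule sum.remove)

lemma net_split:
  assumes "finite E" "F \<subseteq> E"
  shows "net E g x v = net F g x v + net (E - F) g x v"
  unfolding net_def using sum.subset_diff[OF assms(2,1)] by (simp add: add.commute)

lemma net_cong:
  assumes "\<And>e. e \<in> E \<Longrightarrow> inc g e v \<noteq> 0 \<Longrightarrow> x e = y e"
  shows "net E g x v = net E g y v"
  unfolding net_def by (rule sum.cong) (use assms in force)+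

lemma net_cong_graph:
  assumes "\<And>e. e \<in> E \<Longrightarrow> g e = h e" "\<And>e. e \<in> E \<Longrightarrow> x e = y e"
  shows "net E g x v = net E h y v"
  unfolding net_def by (rule sum.cong) (use assms in \<open>auto simp: inc_def\<close>)

lemma net_mod_subset:
  assumes "finite E" "F \<subseteq> E" "\<And>e. e \<in> E - F \<Longrightarrow> inc g e v = 0"
  shows "net E g x v = net F g x v"
  unfolding net_split[OF assms(1,2)] using assms(3) by (simp add: net_def)

lemma deg_remove:
  assumes "finite E" "e \<in> E"
  shows "deg E g A = of_bool (crosses g e A) + deg (E - {e}) g A"
  unfolding deg_def using assms by (rule sum.remove)

lemma deg_cong:
  assumes "\<And>e. e \<in> E \<Longrightarrow> crosses g e A = crosses h e B"
  shows "deg E g A = deg E h B"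
  unfolding deg_def by (rule sum.cong) (use assms in auto)

lemma deg_nonneg: "0 \<le> deg E g A"
  unfolding deg_def by (rule sum_nonneg) auto

lemma deg_card: "finite E \<Longrightarrow> deg E g A = int (card {e\<in>E. crosses g e A})"
  by (simp add: deg_def sum_of_bool_eq Int_def)

lemma deg_subset:
  assumes "finite E" "F \<subseteq> E" "\<And>e. e \<in> E - F \<Longrightarrow> \<not> crosses g e A"
  shows "deg F g A = deg E g A"
  unfolding deg_def by (rule sum.mono_neutral_left) (use assms in auto)

lemma deg_compl:
  assumes "ends_in V E g"
  shows "deg E g (V - A) = deg E g A"
  by (rule deg_cong) (use assms in \<open>auto simp: ends_in_def crosses_def\<close>)

text \<open>The reference direction of an edge is immaterial: swapping it is undone by negating the sign.\<close>

lemma orientable_swap: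
  assumes "orientable V E h \<gamma>" "\<And>e. e \<in> E \<Longrightarrow> h e = g e \<or> h e = prod.swap (g e)"
  shows "orientable V E g \<gamma>"
proof -
  obtain x where x: "signs x" "\<forall>v\<in>V. 3 dvd net E h x v - \<gamma> v"
    using assms(1) by (auto simp: orientable_def)
  define y where "y e = (if h e = g e then x e else - x e)" for e
  have "net E g y v = net E h x v" for v
    unfolding net_def
  proof (rule sum.cong)
    fix e assume "e \<in> E"
    with assms(2)[of e] show "y e * inc g e v = x e * inc h e v"
      by (auto simp: y_def inc_def)
  qed simp
  moreover have "signs y"
    using x(1) by (force simp: signs_def y_def)
  ultimately show ?thesis using x(2) by (auto simp: orientable_def)
qed

lemma orientable_cong:
  assumes "orientable V E h \<delta>" "\<And>e. e \<in> E \<Longrightarrow> h e = g e" "\<And>v. v \<in> V \<Longrightarrow> 3 dvd \<delta> v - \<gamma> v"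
  shows "orientable V E g \<gamma>"
proof -
  obtain x where x: "signs x" "\<forall>v\<in>V. 3 dvd net E h x v - \<delta> v"
    using assms(1) by (auto simp: orientable_def)
  have "3 dvd net E g x v - \<gamma> v" if "v \<in> V" for v
  proof -
    have "net E g x v = net E h x v" by (rule net_cong_graph) (use assms(2) in auto)
    moreover have "3 dvd (net E h x v - \<delta> v) + (\<delta> v - \<gamma> v)"
      using x(2) that assms(3) by (intro dvd_add) auto
    ultimately show ?thesis by simp
  qed
  with x(1) show ?thesis by (auto simp: orientable_def)
qed

lemma orientable_neg:
  assumes "orientable V E g (\<lambda>v. - \<gamma> v)"
  shows "orientable V E g \<gamma>"
proof -
  obtain x where x: "signs x" "\<forall>v\<in>V. 3 dvd net E g x v - (- \<gamma> v)"
    using assms(1) by (auto simp: orientable_def)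
  have "net E g (\<lambda>e. - x e) v = - net E g x v" for v
    by (simp add: net_def sum_negf)
  moreover have "3 dvd - a - b" if "3 dvd a - (- b)" for a b :: int
    using that by presburger
  moreover have "signs (\<lambda>e. - x e)" using x(1) by (force simp: signs_def)
  ultimately show ?thesis using x(2) unfolding orientable_def by metis
qed

text \<open>Fixing the direction of an edge and deleting it shifts the demands at its two ends.\<close>

lemma orientable_delete:
  assumes fin: "finite E" and e: "e \<in> E" "g e = (u, w)"
    and or: "orientable V (E - {e}) g (\<lambda>v. \<gamma> v - of_bool (v = u) + of_bool (v = w))"
  shows "orientable V E g \<gamma>"
proof -
  obtain x where x: "signs x"
    "\<forall>v\<in>V. 3 dvd net (E - {e}) g x v - (\<gamma> v - of_bool (v = u) + of_bool (v = w))"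
    using or by (auto simp: orientable_def)
  let ?y = "x(e := 1)"
  have "net E g ?y v = net (E - {e}) g x v + of_bool (v = u) - of_bool (v = w)" for v
  proof -
    have "net (E - {e}) g ?y v = net (E - {e}) g x v" by (rule net_cong) auto
    thus ?thesis
      using net_remove[OF fin e(1), of g ?y v] e(2) by (auto simp: inc_def)
  qed
  hence "net E g ?y v - \<gamma> v
      = net (E - {e}) g x v - (\<gamma> v - of_bool (v = u) + of_bool (v = w))" for v by simp
  hence "\<forall>v\<in>V. 3 dvd net E g ?y v - \<gamma> v"
    using x(2) by metis
  moreover have "signs ?y" using x(1) by (auto simp: signs_def)
  ultimately show ?thesis unfolding orientable_def by blast
qed

text \<open>Lifting replaces two edges at \<open>v\<close> by one edge between their other ends. Putting \<open>v\<close> back into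
the middle of that edge makes the flow pass through \<open>v\<close>, which changes no net outflow.\<close>

lemma orientable_unlift:
  assumes fin: "finite E" and e: "e1 \<in> E" "e2 \<in> E" "e1 \<noteq> e2" "g e1 = (y, v)" "g e2 = (v, z)"
    and or: "orientable V (E - {e2}) (g(e1 := (y, z))) \<gamma>"
  shows "orientable V E g \<gamma>"
proof -
  let ?h = "g(e1 := (y, z))"
  obtain x where x: "signs x" "\<forall>v\<in>V. 3 dvd net (E - {e2}) ?h x v - \<gamma> v"
    using or by (auto simp: orientable_def)
  let ?x = "x(e2 := x e1)"
  have "net E g ?x w = net (E - {e2}) ?h x w" for w
  proof -
    have e1: "e1 \<in> E - {e2}" using e by auto
    have "net E g ?x w = x e1 * inc g e2 w + (x e1 * inc g e1 w + net (E - {e2} - {e1}) g ?x w)"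
      using net_remove[OF fin e(2), of g ?x w] net_remove[OF _ e1, of g ?x w] fin e(3) by simp
    moreover have "net (E - {e2}) ?h x w = x e1 * inc ?h e1 w + net (E - {e2} - {e1}) ?h x w"
      using net_remove[OF _ e1, of ?h x w] fin by simp
    moreover have "net (E - {e2} - {e1}) ?h x w = net (E - {e2} - {e1}) g ?x w"
      by (rule net_cong_graph) auto
    moreover have "inc g e2 w + inc g e1 w = inc ?h e1 w"
      using e by (simp add: inc_def)
    ultimately show ?thesis by (metis (no_types, opaque_lifting) add.assoc distrib_left)
  qed
  moreover have "signs ?x" using x(1) by (auto simp: signs_def)
  ultimately show ?thesis using x(2) unfolding orientable_def by metis
qed

lemma orientable_delete_link:
  assumes fin: "finite E" and e: "e \<in> E" "links g e u w"
    and or: "orientable V (E - {e}) g (\<lambda>v. \<gamma> v - of_bool (v = u) + of_bool (v = w))"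
  shows "orientable V E g \<gamma>"
proof -
  let ?h = "g(e := (u, w))"
  have "orientable V (E - {e}) ?h (\<lambda>v. \<gamma> v - of_bool (v = u) + of_bool (v = w))"
    by (rule orientable_cong[OF or]) auto
  hence "orientable V E ?h \<gamma>"
    by (intro orientable_delete[OF fin e(1), of ?h u w]) auto
  thus ?thesis by (rule orientable_swap) (use e(2) in \<open>auto simp: links_def\<close>)
qed

lemma orientable_unlift_links:
  assumes fin: "finite E" and e: "e1 \<in> E" "e2 \<in> E" "e1 \<noteq> e2" "links g e1 v y" "links g e2 v z"
    and or: "orientable V (E - {e2}) (g(e1 := (y, z))) \<gamma>"
  shows "orientable V E g \<gamma>"
proof -
  let ?h = "g(e1 := (y, v), e2 := (v, z))"
  have "orientable V (E - {e2}) (?h(e1 := (y, z))) \<gamma>"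
    by (rule orientable_cong[OF or]) auto
  hence "orientable V E ?h \<gamma>"
    by (intro orientable_unlift[OF fin e(1-3), of ?h y v z]) (use e(3) in auto)
  thus ?thesis by (rule orientable_swap) (use e in \<open>auto simp: links_def\<close>)
qed

lemma crosses_links: "links g e u w \<Longrightarrow> crosses g e A \<longleftrightarrow> (u \<in> A) \<noteq> (w \<in> A)"
  by (auto simp: links_def crosses_def)

lemma crosses_singleton_links:
  assumes "crosses g e {v}"
  obtains w where "links g e v w" "w \<noteq> v"
  using assms by (cases "g e") (auto simp: links_def crosses_def)

lemma links_ends: "links g e u w \<Longrightarrow> e \<in> E \<Longrightarrow> ends_in V E g \<Longrightarrow> u \<in> V \<and> w \<in> V"
  by (auto simp: links_def ends_in_def)

lemma links_sym: "links g e u w \<longleftrightarrow> links g e w u"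
  by (auto simp: links_def)

lemma deg_delete:
  assumes "finite E" "e \<in> E" "links g e u w"
  shows "deg (E - {e}) g A = deg E g A - of_bool ((u \<in> A) \<noteq> (w \<in> A))"
  using deg_remove[OF assms(1,2), of g A] crosses_links[OF assms(3)] by simp

lemma deg_lift:
  assumes fin: "finite E" and e: "e1 \<in> E" "e2 \<in> E" "e1 \<noteq> e2" "links g e1 v y" "links g e2 v z"
  shows "deg (E - {e2}) (g(e1 := (y, z))) A = deg E g A - of_bool ((v \<in> A) \<noteq> (y \<in> A))
    - of_bool ((v \<in> A) \<noteq> (z \<in> A)) + of_bool ((y \<in> A) \<noteq> (z \<in> A))"
proof -
  let ?h = "g(e1 := (y, z))" and ?F = "E - {e2} - {e1}"
  have "deg (E - {e2}) ?h A = of_bool (crosses ?h e1 A) + deg ?F ?h A"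
    by (rule deg_remove) (use fin e in auto)
  moreover have "deg ?F ?h A = deg ?F g A" by (rule deg_cong) (auto simp: crosses_def)
  moreover have "crosses ?h e1 A \<longleftrightarrow> (y \<in> A) \<noteq> (z \<in> A)" by (simp add: crosses_def)
  moreover have "deg E g A = of_bool (crosses g e2 A) + (of_bool (crosses g e1 A) + deg ?F g A)"
    using deg_remove[OF fin e(2), of g A] deg_remove[of "E - {e2}" e1 g A] fin e by simp
  ultimately show ?thesis using crosses_links[OF e(4)] crosses_links[OF e(5)] by simp
qed

text \<open>Two edges at \<open>v\<close> suffice to reach every residue: their contributions to the net outflow
  sum to \<open>2\<close>, \<open>0\<close> or \<open>-2\<close>.\<close>

lemma orient_at_vertex:
  assumes fin: "finite E" and e: "e1 \<in> E" "e2 \<in> E" "e1 \<noteq> e2" "crosses g e1 {v}" "crosses g e2 {v}"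
  obtains x where "signs x" "3 dvd net E g x v - t"
proof -
  define r where "r = net (E - {e1} - {e2}) g (\<lambda>_. 1) v"
  have inc: "inc g e1 v = 1 \<or> inc g e1 v = -1" "inc g e2 v = 1 \<or> inc g e2 v = -1"
    using e by (auto simp: inc_def crosses_def)
  define x where "x a b e = (if e = e1 then a * inc g e1 v else if e = e2 then b * inc g e2 v else 1)"
    for a b :: int and e
  have *: "net E g (x a b) v = a + b + r" for a b
  proof -
    have "net (E - {e1} - {e2}) g (x a b) v = r"
      unfolding r_def by (rule net_cong) (auto simp: x_def)
    moreover have "x a b e1 * inc g e1 v = a" "x a b e2 * inc g e2 v = b"
      using inc e(3) by (auto simp: x_def)
    moreover have "e2 \<in> E - {e1}" using e by auto
    ultimately show ?thesis
      using net_remove[OF fin e(1), of g "x a b" v] net_remove[of "E - {e1}" e2 g "x a b" v] fin by simp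
  qed
  have s: "signs (x a b)" if "a = 1 \<or> a = -1" "b = 1 \<or> b = -1" for a b
    using inc that by (auto simp: signs_def x_def)
  have "3 dvd 2 + r - t \<or> 3 dvd r - t \<or> 3 dvd - 2 + r - t" by presburger
  thus ?thesis
    using that[OF s[of 1 1]] that[OF s[of 1 "-1"]] that[OF s[of "-1" "-1"]] by (auto simp: *)
qed

text \<open>An orientation that is right outside \<open>A\<close> may be revised on the edges inside \<open>A\<close>.\<close>

lemma orientable_glue:
  assumes fin: "finite E" and x1: "signs x1" "\<And>v. v \<in> V - A \<Longrightarrow> 3 dvd net E g x1 v - \<gamma> v"
    and or: "orientable A (inside E g A) g (\<lambda>v. \<gamma> v - net (E - inside E g A) g x1 v)"
  shows "orientable V E g \<gamma>"
proof -
  let ?I = "inside E g A"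
  obtain x2 where x2: "signs x2" "\<forall>v\<in>A. 3 dvd net ?I g x2 v - (\<gamma> v - net (E - ?I) g x1 v)"
    using or by (auto simp: orientable_def)
  define x where "x e = (if e \<in> ?I then x2 e else x1 e)" for e
  have "signs x" using x1 x2 by (auto simp: signs_def x_def)
  moreover have "3 dvd net E g x v - \<gamma> v" if "v \<in> V" for v
  proof (cases "v \<in> A")
    case True
    have "net E g x v = net ?I g x v + net (E - ?I) g x v"
      by (rule net_split[OF fin]) (auto simp: inside_def)
    also have "net ?I g x v = net ?I g x2 v" by (rule net_cong) (simp add: x_def)
    also have "net (E - ?I) g x v = net (E - ?I) g x1 v" by (rule net_cong) (simp add: x_def)
    finally show ?thesis using x2(2) True by (auto simp: algebra_simps)
  next
    case False
    have "net E g x v = net E g x1 v"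
      by (rule net_cong) (use False in \<open>auto simp: x_def inside_def inc_def of_bool_def split: if_splits\<close>)
    thus ?thesis using x1(2) that False by auto
  qed
  ultimately show ?thesis unfolding orientable_def by blast
qed

lemma sum_dvd_cong:
  assumes "\<And>v. v \<in> A \<Longrightarrow> (3::int) dvd f v - h v"
  shows "3 dvd sum f A - sum h A"
  unfolding sum_subtractf[symmetric] by (rule dvd_sum) (use assms in auto)

lemma net_of_set:
  assumes fin: "finite V" "finite E" "ends_in V E g" and A: "A \<subseteq> V"
    and x1: "\<And>v. v \<in> V - A \<Longrightarrow> 3 dvd net E g x1 v - \<gamma> v" and sum0: "3 dvd sum \<gamma> V"
  shows "3 dvd (\<Sum>v\<in>A. net E g x1 v) - sum \<gamma> A"
proof -
  have "sum (net E g x1) V = sum (net E g x1) (V - A) + sum (net E g x1) A"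
    "sum \<gamma> V = sum \<gamma> (V - A) + sum \<gamma> A"
    using sum.subset_diff[OF A fin(1)] by auto
  moreover have "sum (net E g x1) V = 0" by (rule sum_net_all[OF fin(1,3)])
  moreover have "3 dvd sum (net E g x1) (V - A) - sum \<gamma> (V - A)"
    by (rule sum_dvd_cong) (use x1 in auto)
  ultimately show ?thesis using sum0 by presburger
qed

lemma sum_net_inside:
  assumes "finite E" "finite A"
  shows "(\<Sum>v\<in>A. net (E - inside E g A) g x v) = (\<Sum>v\<in>A. net E g x v)"
  unfolding sum_net[OF assms(2)]
  by (rule sum.mono_neutral_left) (use assms in \<open>auto simp: inside_def\<close>)

text \<open>The demand that remains for the edges inside \<open>A\<close> is again zero-sum, since all net outflows
of the graph add up to zero. This is what allows the inside of \<open>A\<close> to be treated recursively.\<close>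

lemma glue_sum:
  assumes fin: "finite V" "finite E" "ends_in V E g" and A: "A \<subseteq> V"
    and x1: "\<And>v. v \<in> V - A \<Longrightarrow> 3 dvd net E g x1 v - \<gamma> v" and sum0: "3 dvd sum \<gamma> V"
  shows "3 dvd (\<Sum>v\<in>A. \<gamma> v - net (E - inside E g A) g x1 v)"
proof -
  have "finite A" using A fin(1) by (rule finite_subset)
  from sum_net_inside[OF fin(2) this, of g x1]
  have "(\<Sum>v\<in>A. net (E - inside E g A) g x1 v) = (\<Sum>v\<in>A. net E g x1 v)" .
  moreover have "3 dvd (\<Sum>v\<in>A. net E g x1 v) - sum \<gamma> A"
    by (rule net_of_set[OF fin A _ sum0]) (rule x1)
  ultimately show ?thesis unfolding sum_subtractf by presburger
qed

definition proj :: "'v set \<Rightarrow> 'v \<Rightarrow> 'v \<Rightarrow> 'v" where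
  "proj A a v = (if v \<in> A then a else v)"

definition merge :: "'v set \<Rightarrow> 'v \<Rightarrow> ('e \<Rightarrow> 'v \<times> 'v) \<Rightarrow> 'e \<Rightarrow> 'v \<times> 'v" where
  "merge A a g e = (proj A a (fst (g e)), proj A a (snd (g e)))"

definition total_at :: "'v set \<Rightarrow> 'v \<Rightarrow> ('v \<Rightarrow> int) \<Rightarrow> 'v \<Rightarrow> int" where
  "total_at A a f v = (if v = a then sum f A else f v)"

text \<open>For a set of vertices of the graph in which \<open>A\<close> is contracted to \<open>a\<close>, this is its preimage
in the original graph.\<close>

definition unmerge :: "'v set \<Rightarrow> 'v \<Rightarrow> 'v set \<Rightarrow> 'v set" where
  "unmerge A a B = (if a \<in> B then B \<union> A else B)"

text \<open>An orientation of the contracted graph is an orientation of the original one that is right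
outside \<open>A\<close>; only the edges inside \<open>A\<close>, which the contraction deletes, remain to be chosen.\<close>

lemma contract_orient:
  assumes "finite E" "a \<in> A" "orientable (insert a (V - A)) (E - inside E g A) (merge A a g) (total_at A a \<gamma>)"
  obtains x where "signs x" "\<And>v. v \<in> V - A \<Longrightarrow> 3 dvd net E g x v - \<gamma> v"
proof -
  obtain x where x: "signs x" "\<And>v. v \<in> insert a (V - A) \<Longrightarrow>
      3 dvd net (E - inside E g A) (merge A a g) x v - total_at A a \<gamma> v"
    using assms(3) by (auto simp: orientable_def)
  have "3 dvd net E g x v - \<gamma> v" if v: "v \<in> V - A" for v
  proof -
    have "net E g x v = net (E - inside E g A) g x v"
      by (rule net_mod_subset[OF assms(1)]) (use v in \<open>auto simp: inside_def inc_def\<close>)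
    also have "\<dots> = net (E - inside E g A) (merge A a g) x v"
      unfolding net_def
      by (rule sum.cong) (use v assms(2) in \<open>auto simp: inc_def merge_def proj_def\<close>)
    finally have "net E g x v = net (E - inside E g A) (merge A a g) x v" .
    moreover have "total_at A a \<gamma> v = \<gamma> v" using v assms(2) by (auto simp: total_at_def)
    ultimately show ?thesis using x(2)[of v] v by auto
  qed
  with x(1) show ?thesis using that by blast
qed

lemma sum_total_at:
  assumes "finite V" "A \<subseteq> V" "a \<in> A" "B \<subseteq> insert a (V - A)"
  shows "sum (total_at A a f) B = sum f (unmerge A a B)"
proof -
  have fin: "finite B" "finite A" using assms finite_subset by blast+
  show ?thesis
  proof (cases "a \<in> B")
    case True
    have "sum (total_at A a f) B = sum f A + sum (total_at A a f) (B - {a})"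
      using sum.remove[OF fin(1) True, of "total_at A a f"] by (simp add: total_at_def)
    also have "sum (total_at A a f) (B - {a}) = sum f (B - {a})"
      by (rule sum.cong) (auto simp: total_at_def)
    also have "sum f A + sum f (B - {a}) = sum f (A \<union> (B - {a}))"
      by (rule sum.union_disjoint[symmetric]) (use fin assms True in auto)
    also have "A \<union> (B - {a}) = unmerge A a B" using assms(3) True by (auto simp: unmerge_def)
    finally show ?thesis .
  next
    case False
    thus ?thesis unfolding unmerge_def by (auto simp: total_at_def intro!: sum.cong)
  qed
qed

lemma crosses_merge:
  assumes "a \<in> A" "B \<inter> A \<subseteq> {a}"
  shows "crosses (merge A a g) e B \<longleftrightarrow> crosses g e (unmerge A a B)"
  using assms by (auto simp: crosses_def merge_def proj_def unmerge_def)

lemma deg_merge: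
  assumes "finite E" "a \<in> A" "B \<inter> A \<subseteq> {a}"
  shows "deg (E - inside E g A) (merge A a g) B = deg E g (unmerge A a B)"
proof -
  have "deg (E - inside E g A) (merge A a g) B = deg (E - inside E g A) g (unmerge A a B)"
    by (rule deg_cong) (rule crosses_merge[OF assms(2,3)])
  also have "\<dots> = deg E g (unmerge A a B)"
    by (rule deg_subset) (use assms in \<open>auto simp: inside_def crosses_def unmerge_def\<close>)
  finally show ?thesis .
qed

lemma ends_in_merge:
  assumes "ends_in V E g"
  shows "ends_in (insert a (V - A)) (E - inside E g A) (merge A a g)"
  using assms by (auto simp: ends_in_def merge_def proj_def)

lemma unmerge_proper:
  assumes "A \<subseteq> V" "a \<in> A" "B \<subseteq> insert a (V - A)"
  shows "unmerge A a B \<subseteq> V" "unmerge A a B = {} \<longleftrightarrow> B = {}"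
    "unmerge A a B = V \<longleftrightarrow> B = insert a (V - A)" "B \<inter> A \<subseteq> {a}"
  using assms by (auto simp: unmerge_def split: if_splits)

lemma ends_in_inside: "ends_in A (inside E g A) g"
  by (auto simp: ends_in_def inside_def)

lemma orientable_two_parallel:
  assumes fin: "finite E" and uv: "u \<noteq> v" and ends: "ends_in {u, v} E g"
    and e: "e1 \<in> E" "e2 \<in> E" "e1 \<noteq> e2" "crosses g e1 {u}" "crosses g e2 {u}"
    and sum0: "3 dvd sum \<gamma> {u, v}"
  shows "orientable {u, v} E g \<gamma>"
proof -
  obtain x where x: "signs x" "3 dvd net E g x u - \<gamma> u"
    using orient_at_vertex[OF fin e] by blast
  have "net E g x u + net E g x v = 0" using sum_net_all[OF _ ends, of x] uv by simp
  moreover have "3 dvd \<gamma> u + \<gamma> v" using sum0 uv by simp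
  ultimately have "3 dvd net E g x v - \<gamma> v" using x(2) by presburger
  with x show ?thesis unfolding orientable_def by blast
qed

section \<open>Graphs with a preoriented outer vertex\<close>

text \<open>Let \<open>\<tau>\<close> be the integer of least absolute value that is congruent to \<open>r\<close> modulo \<open>3\<close> and to \<open>d\<close>
modulo \<open>2\<close>, so that \<open>\<bar>\<tau>\<bar> \<le> 3\<close>. Then \<open>ample d r\<close> says \<open>d \<ge> 4 + \<bar>\<tau>\<bar>\<close> and
\<open>capped d r\<close> says \<open>d \<le> 4 + \<bar>\<tau>\<bar>\<close>. Here \<open>d\<close> is the size of a cut and \<open>r\<close> the net outflow
that is demanded across it.\<close>

definition ample :: "int \<Rightarrow> int \<Rightarrow> bool" where
  "ample d r \<longleftrightarrow> d \<ge> 6 \<or> d = 5 \<and> \<not> 3 dvd r \<or> d = 4 \<and> 3 dvd r"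

definition capped :: "int \<Rightarrow> int \<Rightarrow> bool" where
  "capped d r \<longleftrightarrow> d \<le> 5 \<or> d = 6 \<and> \<not> 3 dvd r \<or> d = 7 \<and> 3 dvd r"

lemma capped_cong: "capped d r \<Longrightarrow> 3 dvd r - s \<Longrightarrow> capped d s"
  unfolding capped_def by presburger

lemma ample_cong: "ample d r \<Longrightarrow> 3 dvd r - s \<Longrightarrow> ample d s"
  unfolding ample_def by presburger

text \<open>By parity a cut that is not capped has at least \<open>6 + \<bar>\<tau>\<bar>\<close> edges. It stays ample when two edges
cease to cross it, or when one edge across it is oriented and deleted.\<close>

lemma uncapped_ample:
  assumes "\<not> capped d r"
  shows "ample d s" "ample (d - 2) r" "ample (d - 1) (r + 1)" "ample (d - 1) (r - 1)"
  using assms unfolding capped_def ample_def by presburger+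

text \<open>This is the setting of the extension theorem of Lovasz, Thomassen, Wu and Zhang: besides \<open>V\<close>
there is one outer vertex all of whose edges are already oriented, \<open>p v\<close> of them towards \<open>v\<close>
and \<open>n v\<close> of them away from \<open>v\<close>. The outer vertex is not represented; \<open>\<gamma>\<close> is the demand that
the edges inside \<open>V\<close> must meet, while \<open>\<gamma> v + n v - p v\<close> is the demand at \<open>v\<close> in the graph that
includes the outer vertex. The set \<open>V\<close> itself, whose cut is the star of the outer vertex, has to
be capped, and all smaller sets have to be ample.\<close>

locale preoriented =
  fixes V :: "'v set" and E :: "'e set" and g :: "'e \<Rightarrow> 'v \<times> 'v" and \<gamma> p n :: "'v \<Rightarrow> int"
  assumes finV: "finite V" and finE: "finite E" and ends: "ends_in V E g"
    and zero_sum: "3 dvd sum \<gamma> V"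
    and p_nonneg: "0 \<le> p v" and n_nonneg: "0 \<le> n v"
    and capped: "capped (sum p V + sum n V) (sum n V - sum p V)"
    and ample: "A \<subseteq> V \<Longrightarrow> A \<noteq> {} \<Longrightarrow> A \<noteq> V \<Longrightarrow>
      ample (deg E g A + sum p A + sum n A) (sum \<gamma> A + sum n A - sum p A)"
begin

text \<open>The size of the cut around \<open>A\<close> and the net outflow demanded of \<open>A\<close>, both including the edges
to the outer vertex.\<close>

definition D :: "'v set \<Rightarrow> int" where "D A = deg E g A + sum p A + sum n A"
definition R :: "'v set \<Rightarrow> int" where "R A = sum \<gamma> A + sum n A - sum p A"

definition size_measure :: nat where
  "size_measure = 8 * (card V + card E) + nat (sum p V + sum n V)"

lemma ampleD: "A \<subseteq> V \<Longrightarrow> A \<noteq> {} \<Longrightarrow> A \<noteq> V \<Longrightarrow> ample (D A) (R A)"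
  unfolding D_def R_def by (rule ample)

lemma sum_p_nonneg: "0 \<le> sum p A" and sum_n_nonneg: "0 \<le> sum n A"
  by (simp_all add: sum_nonneg p_nonneg n_nonneg)

lemma D_V_le: "sum p V + sum n V \<le> 7"
  using capped by (auto simp: capped_def)

text \<open>Reversing every edge, including those at the outer vertex, negates all demands.\<close>

lemma mirror: "preoriented V E g (\<lambda>v. - \<gamma> v) n p"
proof
  fix A assume "A \<subseteq> V" "A \<noteq> {}" "A \<noteq> V"
  from ample[OF this] show "ample (deg E g A + sum n A + sum p A) (sum (\<lambda>v. - \<gamma> v) A + sum p A - sum n A)"
    unfolding ample_def sum_negf by presburger
next
  show "capped (sum n V + sum p V) (sum p V - sum n V)"
    using capped unfolding capped_def by presburger
qed (use finV finE ends zero_sum p_nonneg n_nonneg in \<open>auto simp: sum_negf\<close>)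

lemma contraction:
  assumes A: "A \<subseteq> V" "a \<in> A"
  shows "preoriented (insert a (V - A)) (E - inside E g A) (merge A a g)
    (total_at A a \<gamma>) (total_at A a p) (total_at A a n)"
proof -
  let ?V = "insert a (V - A)"
  have all: "unmerge A a ?V = V" using unmerge_proper(3)[OF A, of ?V] by auto
  note tot = sum_total_at[OF finV A]
  show ?thesis
  proof
    show "ends_in ?V (E - inside E g A) (merge A a g)" by (rule ends_in_merge[OF ends])
    show "3 dvd sum (total_at A a \<gamma>) ?V" using tot[of ?V] all zero_sum by simp
    show "capped (sum (total_at A a p) ?V + sum (total_at A a n) ?V)
        (sum (total_at A a n) ?V - sum (total_at A a p) ?V)"
      using tot[of ?V] all capped by simp
    fix B assume B: "B \<subseteq> ?V" "B \<noteq> {}" "B \<noteq> ?V"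
    note u = unmerge_proper[OF A B(1)]
    have "ample (deg E g (unmerge A a B) + sum p (unmerge A a B) + sum n (unmerge A a B))
        (sum \<gamma> (unmerge A a B) + sum n (unmerge A a B) - sum p (unmerge A a B))"
      by (rule ample) (use u B in auto)
    thus "ample (deg (E - inside E g A) (merge A a g) B + sum (total_at A a p) B + sum (total_at A a n) B)
        (sum (total_at A a \<gamma>) B + sum (total_at A a n) B - sum (total_at A a p) B)"
      using deg_merge[OF finE A(2) u(4)] tot[OF B(1)] by simp
  qed (use finV finE p_nonneg n_nonneg in \<open>auto simp: total_at_def sum_nonneg\<close>)
qed

text \<open>The counterpart of contraction: once the edges that leave \<open>A\<close> are oriented, all vertices
outside \<open>A\<close> merge with the outer vertex. No cut inside \<open>A\<close> changes its size or its demand, and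
the new outer vertex satisfies its condition exactly when \<open>A\<close> is capped.\<close>

lemma restriction:
  fixes x :: "'e \<Rightarrow> int"
  defines "F A \<equiv> E - inside E g A"
  assumes A: "A \<subseteq> V" and cap: "capped (D A) (R A)"
    and x: "signs x" "\<And>v. v \<in> V - A \<Longrightarrow> 3 dvd net E g x v - \<gamma> v"
  shows "\<exists>p' n'. preoriented A (inside E g A) g (\<lambda>v. \<gamma> v - net (F A) g x v) p' n' \<and>
    sum p' A + sum n' A = D A"
proof -
  define p' where "p' v = p v + (\<Sum>e\<in>F A. of_bool (x e * inc g e v = -1))" for v
  define n' where "n' v = n v + (\<Sum>e\<in>F A. of_bool (x e * inc g e v = 1))" for v
  let ?\<gamma> = "\<lambda>v. \<gamma> v - net (F A) g x v" and ?I = "inside E g A"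
  have finA: "finite A" using A finV finite_subset by blast
  have xi: "x e * inc g e v \<in> {-1, 0, 1}" for e v
    using signsD[OF x(1), of e] by (auto simp: inc_def)
  have diff: "n' v - p' v = n v - p v + net (F A) g x v" for v
  proof -
    have "of_bool (x e * inc g e v = 1) - of_bool (x e * inc g e v = -1) = x e * inc g e v" for e
      using xi[of e v] by auto
    thus ?thesis by (simp add: n'_def p'_def net_def flip: sum_subtractf)
  qed
  have add: "n' v + p' v = n v + p v + (\<Sum>e\<in>F A. \<bar>inc g e v\<bar>)" for v
  proof -
    have "of_bool (x e * inc g e v = 1) + of_bool (x e * inc g e v = -1) = \<bar>inc g e v\<bar>" for e
      using signsD[OF x(1), of e] by (auto simp: inc_def)
    thus ?thesis by (simp add: n'_def p'_def flip: sum.distrib)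
  qed
  have D': "deg ?I g B + sum p' B + sum n' B = D B" if B: "B \<subseteq> A" for B
  proof -
    have finB: "finite B" using B finA finite_subset by blast
    have "sum p' B + sum n' B = (\<Sum>v\<in>B. n v + p v + (\<Sum>e\<in>F A. \<bar>inc g e v\<bar>))"
      by (simp add: add flip: sum.distrib) (metis add add.commute)
    also have "\<dots> = sum n B + sum p B + (\<Sum>e\<in>F A. \<Sum>v\<in>B. \<bar>inc g e v\<bar>)"
      by (simp add: sum.distrib) (rule sum.swap)
    also have "(\<Sum>e\<in>F A. \<Sum>v\<in>B. \<bar>inc g e v\<bar>) = deg (F A) g B"
      unfolding deg_def
    proof (rule sum.cong)
      fix e assume "e \<in> F A"
      hence "\<not> (fst (g e) \<in> A \<and> snd (g e) \<in> A)" by (auto simp: F_def inside_def)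
      hence "(\<Sum>v\<in>B. \<bar>inc g e v\<bar>) = (\<Sum>v\<in>B. of_bool (fst (g e) = v) + of_bool (snd (g e) = v))"
        using B by (intro sum.cong) (auto simp: inc_def)
      also have "\<dots> = of_bool (fst (g e) \<in> B) + of_bool (snd (g e) \<in> B)"
        using finB by (simp add: sum.distrib of_bool_def sum.delta)
      also have "\<dots> = of_bool (crosses g e B)"
        using B \<open>\<not> (fst (g e) \<in> A \<and> snd (g e) \<in> A)\<close> by (auto simp: crosses_def)
      finally show "(\<Sum>v\<in>B. \<bar>inc g e v\<bar>) = of_bool (crosses g e B)" .
    qed simp
    finally have "sum p' B + sum n' B = sum n B + sum p B + deg (F A) g B" .
    moreover have "deg E g B = deg ?I g B + deg (F A) g B"
      unfolding deg_def F_def using sum.subset_diff[of ?I E] finE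
      by (metis (no_types, lifting) add.commute inside_def mem_Collect_eq subsetI)
    ultimately show ?thesis by (simp add: D_def)
  qed
  have R': "sum ?\<gamma> B + sum n' B - sum p' B = R B" for B
  proof -
    have "sum ?\<gamma> B + sum n' B - sum p' B = (\<Sum>v\<in>B. ?\<gamma> v + (n' v - p' v))"
      by (simp add: sum.distrib sum_subtractf)
    also have "\<dots> = (\<Sum>v\<in>B. \<gamma> v + n v - p v)" by (simp add: diff algebra_simps)
    finally show ?thesis by (simp add: R_def sum.distrib sum_subtractf)
  qed
  have sum0: "3 dvd sum ?\<gamma> A"
    unfolding F_def by (rule glue_sum[OF finV finE ends A x(2) zero_sum])
  have degA: "deg ?I g A = 0"
    unfolding deg_def by (rule sum.neutral) (auto simp: inside_def crosses_def)
  have tot: "sum p' A + sum n' A = D A" using D'[of A] degA by simp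
  have "preoriented A ?I g ?\<gamma> p' n'"
  proof
    show "capped (sum p' A + sum n' A) (sum n' A - sum p' A)"
      using capped_cong[OF cap, of "sum n' A - sum p' A"] sum0 R'[of A] tot
      by (simp add: algebra_simps) (metis add_diff_cancel_left' diff_add_eq)
    fix B assume B: "B \<subseteq> A" "B \<noteq> {}" "B \<noteq> A"
    thus "ample (deg ?I g B + sum p' B + sum n' B) (sum ?\<gamma> B + sum n' B - sum p' B)"
      unfolding R' D'[OF B(1)] by (intro ampleD) (use A in auto)
  qed (use finA finE sum0 p_nonneg n_nonneg ends_in_inside in
      \<open>auto simp: p'_def n'_def inside_def sum_nonneg intro!: add_nonneg_nonneg\<close>)
  with tot show ?thesis by blast
qed

end

section \<open>A minimal counterexample to extension\<close>

lemma sum_shift: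
  fixes f :: "'v \<Rightarrow> int"
  assumes "finite A"
  shows "(\<Sum>w\<in>A. f w - of_bool (w = v) + of_bool (w = y)) = sum f A - of_bool (v \<in> A) + of_bool (y \<in> A)"
  using assms by (simp add: sum.distrib sum_subtractf of_bool_def sum.delta)

lemma two_vertices_not_ample:
  assumes "d \<le> 1" "ample (d + k) r" "ample (d + l) s" "capped (k + l) (r + s)"
  shows False
proof -
  have "4 \<le> d + k" "4 \<le> d + l" "k + l \<le> 7" using assms by (auto simp: ample_def capped_def)
  moreover from this assms(1) have "d = 1" by linarith
  ultimately have "k = 3 \<and> l = 3 \<or> k = 3 \<and> l = 4 \<or> k = 4 \<and> l = 3" by presburger
  with \<open>d = 1\<close> consider "d + k = 4" "d + l = 4" "k + l = 6" | "d + k = 4" "d + l = 5" "k + l = 7"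
    | "d + k = 5" "d + l = 4" "k + l = 7" by auto
  thus False
  proof cases
    case 1
    thus False using assms(2-4) by (simp add: ample_def capped_def)
  next
    case 2
    hence "3 dvd r" "\<not> 3 dvd s" "3 dvd r + s" using assms(2-4) by (simp_all add: ample_def capped_def)
    thus False by presburger
  next
    case 3
    hence "\<not> 3 dvd r" "3 dvd s" "3 dvd r + s" using assms(2-4) by (simp_all add: ample_def capped_def)
    thus False by presburger
  qed
qed

text \<open>Vertices and edges count eight times because being capped bounds the number of edges at the outer vertex by
seven: a step that loses a vertex or an edge may replace the outer star by any capped one.\<close>

locale minimal_counterexample = preoriented V E g \<gamma> p n
  for V :: "'v set" and E :: "'e set" and g :: "'e \<Rightarrow> 'v \<times> 'v" and \<gamma> p n :: "'v \<Rightarrow> int" +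
  assumes smaller: "preoriented (V' :: 'v set) (E' :: 'e set) g' \<gamma>' p' n' \<Longrightarrow>
      8 * (card V' + card E') + nat (sum p' V' + sum n' V')
        < 8 * (card V + card E) + nat (sum p V + sum n V) \<Longrightarrow> orientable V' E' g' \<gamma>'"
    and not_orientable: "\<not> orientable V E g \<gamma>"
begin

lemma mirror_minimal: "minimal_counterexample V E g (\<lambda>v. - \<gamma> v) n p"
proof -
  interpret m: preoriented V E g "\<lambda>v. - \<gamma> v" n p by (rule mirror)
  show ?thesis
  proof
    fix V' :: "'v set" and E' :: "'e set" and g' \<gamma>' p' n'
    assume "preoriented V' E' g' \<gamma>' p' n'"
      "8 * (card V' + card E') + nat (sum p' V' + sum n' V')
        < 8 * (card V + card E) + nat (sum n V + sum p V)"
    thus "orientable V' E' g' \<gamma>'" by (intro smaller) (auto simp: add.commute)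
  next
    show "\<not> orientable V E g (\<lambda>v. - \<gamma> v)" using orientable_neg not_orientable by blast
  qed
qed

lemma fin_sub: "A \<subseteq> V \<Longrightarrow> finite A"
  using finV finite_subset by blast

lemma card_delete: "e \<in> E \<Longrightarrow> card (E - {e}) < card E"
  by (rule card_Diff1_less[OF finE])

lemma card_ge_2: "2 \<le> card V"
proof (rule ccontr)
  assume "\<not> 2 \<le> card V"
  hence "card V = 0 \<or> card V = 1" by linarith
  hence "V = {} \<or> (\<exists>v. V = {v})" using finV by (auto simp: card_1_singleton_iff)
  hence "orientable V E g \<gamma>"
  proof
    assume "\<exists>v. V = {v}"
    then obtain v where v: "V = {v}" by blast
    have "net E g (\<lambda>_. 1) v = 0" using sum_net_all[OF finV ends] v by simp
    moreover have "signs (\<lambda>_. 1)" by (simp add: signs_def)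
    ultimately show ?thesis using zero_sum v unfolding orientable_def
      by (intro exI[of _ "\<lambda>_. 1"]) auto
  qed (auto simp: orientable_def signs_def intro: exI[of _ "\<lambda>_. 1"])
  thus False using not_orientable by blast
qed

lemma contraction_orients:
  assumes A: "A \<subseteq> V" "a \<in> A" "2 \<le> card A"
  obtains x where "signs x" "\<And>v. v \<in> V - A \<Longrightarrow> 3 dvd net E g x v - \<gamma> v"
proof -
  let ?V = "insert a (V - A)"
  have "card ?V = card V - card A + 1"
    using A(1,2) finV fin_sub[OF A(1)] by (simp add: card_Diff_subset)
  moreover have "card A \<le> card V" using A(1) finV by (rule card_mono[rotated])
  ultimately have "card ?V < card V" using A(3) by linarith
  moreover have "card (E - inside E g A) \<le> card E" using finE by (intro card_mono) auto
  moreover have "sum (total_at A a f) ?V = sum f V" for f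
    using sum_total_at[OF finV A(1,2), of ?V] unmerge_proper(3)[OF A(1,2), of ?V] by simp
  ultimately have "orientable ?V (E - inside E g A) (merge A a g) (total_at A a \<gamma>)"
    by (intro smaller[OF contraction[OF A(1,2)]]) simp
  from contract_orient[OF finE A(2) this] that show ?thesis by blast
qed

lemma not_restrictable:
  assumes A: "A \<subseteq> V" "A \<noteq> V" and cap: "capped (D A) (R A)"
    and x: "signs x" "\<And>v. v \<in> V - A \<Longrightarrow> 3 dvd net E g x v - \<gamma> v"
  shows False
proof -
  obtain p' n' where pre: "preoriented A (inside E g A) g
      (\<lambda>v. \<gamma> v - net (E - inside E g A) g x v) p' n'" "sum p' A + sum n' A = D A"
    using restriction[OF A(1) cap x] by blast
  have "D A \<le> 7" using cap by (auto simp: capped_def)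
  moreover have "card A < card V" using A finV by (intro psubset_card_mono) auto
  moreover have "card (inside E g A) \<le> card E" using finE by (intro card_mono) (auto simp: inside_def)
  ultimately have "orientable A (inside E g A) g (\<lambda>v. \<gamma> v - net (E - inside E g A) g x v)"
    by (intro smaller[OF pre(1)]) (use pre(2) in simp)
  thus False using orientable_glue[OF finE x] not_orientable by blast
qed

text \<open>A capped set with several vertices would split the problem into two smaller ones, its
contraction and its restriction.\<close>

lemma uncapped:
  assumes A: "A \<subseteq> V" "2 \<le> card A" "A \<noteq> V"
  shows "\<not> capped (D A) (R A)"
proof
  assume cap: "capped (D A) (R A)"
  have "A \<noteq> {}" using A(2) by auto
  then obtain a where "a \<in> A" by blast
  then obtain x where "signs x" "\<And>v. v \<in> V - A \<Longrightarrow> 3 dvd net E g x v - \<gamma> v"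
    using contraction_orients[OF A(1) _ A(2)] by blast
  thus False using not_restrictable[OF A(1,3) cap] by blast
qed

text \<open>Two parallel edges can be contracted, because on their own they realise every zero-sum demand
on their two ends.\<close>

lemma simple:
  assumes e: "e1 \<in> E" "e2 \<in> E" "e1 \<noteq> e2" "links g e1 u v" "links g e2 u v" and uv: "u \<noteq> v"
  shows False
proof -
  let ?A = "{u, v}"
  have A: "?A \<subseteq> V" using links_ends[OF e(4,1) ends] by auto
  obtain x where x: "signs x" "\<And>w. w \<in> V - ?A \<Longrightarrow> 3 dvd net E g x w - \<gamma> w"
    using contraction_orients[OF A, of u] uv by auto
  have "orientable ?A (inside E g ?A) g (\<lambda>w. \<gamma> w - net (E - inside E g ?A) g x w)"
  proof (rule orientable_two_parallel[OF _ uv])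
    show "e1 \<in> inside E g ?A" "e2 \<in> inside E g ?A" using e by (auto simp: inside_def links_def)
    show "crosses g e1 {u}" "crosses g e2 {u}"
      using crosses_links[OF e(4), of "{u}"] crosses_links[OF e(5), of "{u}"] uv by auto
    show "3 dvd (\<Sum>w\<in>?A. \<gamma> w - net (E - inside E g ?A) g x w)"
      by (rule glue_sum[OF finV finE ends A x(2) zero_sum])
    show "finite (inside E g ?A)" using finE by (simp add: inside_def)
  qed (use e(3) ends_in_inside in auto)
  thus False using orientable_glue[OF finE x] not_orientable by blast
qed

lemma no_loop:
  assumes "e \<in> E"
  shows "fst (g e) \<noteq> snd (g e)"
proof
  assume loop: "fst (g e) = snd (g e)"
  have "preoriented V (E - {e}) g \<gamma> p n"
  proof
    fix A assume "A \<subseteq> V" "A \<noteq> {}" "A \<noteq> V"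
    moreover have "deg (E - {e}) g A = deg E g A"
      by (rule deg_subset) (use finE loop in \<open>auto simp: crosses_def\<close>)
    ultimately show "ample (deg (E - {e}) g A + sum p A + sum n A) (sum \<gamma> A + sum n A - sum p A)"
      using ample by simp
  qed (use finV finE ends zero_sum p_nonneg n_nonneg capped in \<open>auto simp: ends_in_def\<close>)
  hence "orientable V (E - {e}) g \<gamma>"
    by (rule smaller) (use card_delete[OF assms] in simp)
  hence "orientable V E g \<gamma>"
    by (intro orientable_delete[OF finE assms, of g "fst (g e)" "fst (g e)"]) (auto simp: loop prod_eq_iff)
  thus False using not_orientable by blast
qed

lemma edges_at:
  assumes "int k \<le> deg E g {v}"
  obtains es where "length es = k" "distinct es" "set es \<subseteq> {e\<in>E. crosses g e {v}}"
proof -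
  have "k \<le> card {e\<in>E. crosses g e {v}}" using assms deg_card[OF finE, of g "{v}"] by simp
  then obtain T where T: "T \<subseteq> {e\<in>E. crosses g e {v}}" "card T = k" "finite T"
    using obtain_subset_with_card_n by blast
  from finite_distinct_list[OF T(3)] obtain es where "set es = T" "distinct es" by blast
  with T distinct_card[of es] show ?thesis by (intro that[of es]) auto
qed

lemma crossing_edge:
  assumes "e \<in> E" "crosses g e {v}"
  obtains w where "links g e v w" "w \<noteq> v" "w \<in> V" "v \<in> V"
proof -
  obtain w where w: "links g e v w" "w \<noteq> v" by (rule crosses_singleton_links[OF assms(2)])
  show ?thesis using that[OF w] links_ends[OF w(1) assms(1) ends] by blast
qed

lemma one_edge:
  assumes "1 \<le> deg E g {v}"
  obtains e w where "e \<in> E" "links g e v w" "w \<noteq> v" "w \<in> V"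
proof -
  obtain es where "length es = 1" "set es \<subseteq> {e\<in>E. crosses g e {v}}"
    by (rule edges_at[of 1 v]) (use assms in auto)
  then obtain e where e: "e \<in> E" "crosses g e {v}" by (auto simp: length_Suc_conv)
  obtain w where "links g e v w" "w \<noteq> v" "w \<in> V" by (rule crossing_edge[OF e])
  from that[OF e(1) this] show ?thesis .
qed

lemma two_edges:
  assumes "2 \<le> deg E g {v}"
  obtains e1 e2 y z where "e1 \<in> E" "e2 \<in> E" "e1 \<noteq> e2" "links g e1 v y" "links g e2 v z"
    "y \<noteq> v" "z \<noteq> v" "y \<noteq> z" "y \<in> V" "z \<in> V"
proof -
  obtain es where es: "length es = 2" "distinct es" "set es \<subseteq> {e\<in>E. crosses g e {v}}"
    by (rule edges_at[of 2 v]) (use assms in auto)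
  then obtain e1 e2 where e: "e1 \<in> E" "e2 \<in> E" "e1 \<noteq> e2" "crosses g e1 {v}" "crosses g e2 {v}"
    by (auto simp: length_Suc_conv numeral_2_eq_2)
  obtain y where "links g e1 v y" "y \<noteq> v" "y \<in> V" by (rule crossing_edge[OF e(1,4)])
  moreover obtain z where "links g e2 v z" "z \<noteq> v" "z \<in> V" by (rule crossing_edge[OF e(2,5)])
  moreover from calculation have "y \<noteq> z" using simple[OF e(1,2,3)] by metis
  ultimately show ?thesis using that e by blast
qed

lemma three_edges:
  assumes "3 \<le> deg E g {v}"
  obtains e1 e2 e3 y z w where "e1 \<in> E" "e2 \<in> E" "e3 \<in> E" "e1 \<noteq> e2" "e1 \<noteq> e3" "e2 \<noteq> e3"
    "links g e1 v y" "links g e2 v z" "links g e3 v w"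
    "y \<noteq> v" "z \<noteq> v" "w \<noteq> v" "y \<noteq> z" "y \<noteq> w" "z \<noteq> w" "y \<in> V" "z \<in> V" "w \<in> V"
proof -
  obtain es where es: "length es = 3" "distinct es" "set es \<subseteq> {e\<in>E. crosses g e {v}}"
    by (rule edges_at[of 3 v]) (use assms in auto)
  then obtain e1 e2 e3 where e: "e1 \<in> E" "e2 \<in> E" "e3 \<in> E" "e1 \<noteq> e2" "e1 \<noteq> e3" "e2 \<noteq> e3"
    "crosses g e1 {v}" "crosses g e2 {v}" "crosses g e3 {v}"
    by (auto simp: length_Suc_conv numeral_3_eq_3)
  obtain y where y: "links g e1 v y" "y \<noteq> v" "y \<in> V" by (rule crossing_edge[OF e(1,7)])
  obtain z where z: "links g e2 v z" "z \<noteq> v" "z \<in> V" by (rule crossing_edge[OF e(2,8)])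
  obtain w where w: "links g e3 v w" "w \<noteq> v" "w \<in> V" by (rule crossing_edge[OF e(3,9)])
  have "y \<noteq> z" using simple[OF e(1,2,4) y(1)] y z by metis
  moreover have "y \<noteq> w" using simple[OF e(1,3,5) y(1)] y w by metis
  moreover have "z \<noteq> w" using simple[OF e(2,3,6) z(1)] z w by metis
  ultimately show ?thesis using that[OF e(1-6) y(1) z(1) w(1)] y z w by blast
qed

lemma four_edges:
  assumes "4 \<le> deg E g {v}"
  obtains e1 e2 e3 e4 y z w u where "e1 \<in> E" "e2 \<in> E" "e3 \<in> E" "e4 \<in> E" "distinct [e1, e2, e3, e4]"
    "links g e1 v y" "links g e2 v z" "links g e3 v w" "links g e4 v u" "distinct [v, y, z, w, u]"
    "y \<in> V" "z \<in> V" "w \<in> V" "u \<in> V"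
proof -
  obtain es where es: "length es = Suc 3" "distinct es" "set es \<subseteq> {e\<in>E. crosses g e {v}}"
    by (rule edges_at[of 4 v]) (use assms in auto)
  then obtain e1 e2 e3 e4 where e: "e1 \<in> E" "e2 \<in> E" "e3 \<in> E" "e4 \<in> E" "distinct [e1, e2, e3, e4]"
    "crosses g e1 {v}" "crosses g e2 {v}" "crosses g e3 {v}" "crosses g e4 {v}"
    by (auto simp: length_Suc_conv numeral_3_eq_3)
  obtain y where y: "links g e1 v y" "y \<noteq> v" "y \<in> V" by (rule crossing_edge[OF e(1,6)])
  obtain z where z: "links g e2 v z" "z \<noteq> v" "z \<in> V" by (rule crossing_edge[OF e(2,7)])
  obtain w where w: "links g e3 v w" "w \<noteq> v" "w \<in> V" by (rule crossing_edge[OF e(3,8)])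
  obtain u where u: "links g e4 v u" "u \<noteq> v" "u \<in> V" by (rule crossing_edge[OF e(4,9)])
  have s: "a \<noteq> b" if "links g d v a" "links g d' v b" "a \<noteq> v" "d \<in> E" "d' \<in> E" "d \<noteq> d'" for a b d d'
    using simple[of d d' v a] that by auto
  have "y \<noteq> z" "y \<noteq> w" "y \<noteq> u" "z \<noteq> w" "z \<noteq> u" "w \<noteq> u"
    using s[OF y(1) z(1) y(2) e(1,2)] s[OF y(1) w(1) y(2) e(1,3)] s[OF y(1) u(1) y(2) e(1,4)]
      s[OF z(1) w(1) z(2) e(2,3)] s[OF z(1) u(1) z(2) e(2,4)] s[OF w(1) u(1) w(2) e(3,4)] e(5) by auto
  hence "distinct [v, y, z, w, u]" using y z w u by auto
  from that[OF e(1-5) y(1) z(1) w(1) u(1) this y(3) z(3) w(3) u(3)] show ?thesis .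
qed

lemma D_single: "D {v} = deg E g {v} + p v + n v"
  by (simp add: D_def)

lemma R_single: "R {v} = \<gamma> v + n v - p v"
  by (simp add: R_def)

lemma D_compl:
  assumes "v \<in> V"
  shows "D (V - {v}) = sum p V + sum n V + D {v} - 2 * (p v + n v)"
  using deg_compl[OF ends, of "{v}"] assms sum.remove[OF finV assms, of p] sum.remove[OF finV assms, of n]
  by (simp add: D_def)

lemma R_compl:
  assumes "v \<in> V"
  shows "R (V - {v}) = R V - R {v}"
  using assms sum.remove[OF finV assms, of p] sum.remove[OF finV assms, of n] sum.remove[OF finV assms, of \<gamma>]
  by (simp add: R_def)

lemma R_V: "3 dvd R V - (sum n V - sum p V)"
  using zero_sum by (simp add: R_def)

lemma compl_proper:
  assumes "v \<in> V"
  shows "V - {v} \<subseteq> V" "V - {v} \<noteq> {}" "V - {v} \<noteq> V" "{v} \<noteq> V" "card (V - {v}) = card V - 1"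
proof -
  show c: "card (V - {v}) = card V - 1" using assms finV by (simp add: card_Diff_singleton)
  show "V - {v} \<noteq> {}"
  proof
    assume "V - {v} = {}"
    hence "card V - 1 = 0" using c by (metis card.empty)
    thus False using card_ge_2 by linarith
  qed
  thus "{v} \<noteq> V" by auto
qed (use assms in auto)

lemma has_edge:
  assumes "v \<in> V"
  shows "1 \<le> deg E g {v}"
proof -
  have "4 \<le> D (V - {v})" "4 \<le> D {v}"
    using ampleD[of "V - {v}"] ampleD[of "{v}"] compl_proper[OF assms] assms by (auto simp: ample_def)
  thus ?thesis using D_compl[OF assms] D_single[of v] D_V_le by simp
qed

lemma card_ge_3: "3 \<le> card V"
proof (rule ccontr)
  assume "\<not> 3 \<le> card V"
  hence "card V = 2" using card_ge_2 by linarith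
  then obtain u v where V: "V = {u, v}" "u \<noteq> v" by (auto simp: card_2_iff)
  have "\<not> 2 \<le> deg E g {u}"
  proof
    assume "2 \<le> deg E g {u}"
    then show False by (rule two_edges) (use V in auto)
  qed
  moreover have "deg E g {u} = deg E g {v}"
    using deg_compl[OF ends, of "{v}"] V by (simp add: insert_Diff_if)
  moreover have "ample (D {u}) (R {u})" "ample (D {v}) (R {v})"
    using ampleD[of "{u}"] ampleD[of "{v}"] V by auto
  moreover have "R V = R {u} + R {v}" "sum p V = p u + p v" "sum n V = n u + n v"
    using V by (auto simp: R_def)
  moreover have "capped (sum p V + sum n V) (R V)"
    by (rule capped_cong[OF capped]) (use R_V in presburger)
  ultimately show False
    using two_vertices_not_ample[of "deg E g {u}" "p u + n u" "R {u}" "p v + n v" "R {v}"]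
      D_single[of u] D_single[of v] by (simp add: algebra_simps)
qed

text \<open>The complement of a vertex has at least two elements, so it cannot be capped. Its cut consists
of the star of \<open>v\<close> with the edges to the outer vertex exchanged for those of the other vertices,
which makes this a bound on the number of edges between \<open>v\<close> and the outer vertex.\<close>

lemma compl_uncapped:
  assumes "v \<in> V"
  shows "\<not> capped (D (V - {v})) (R (V - {v}))"
  using uncapped[of "V - {v}"] compl_proper[OF assms] card_ge_3 by auto

lemma uncapped_big:
  assumes "A \<subseteq> V" "A \<noteq> V" "u \<in> A" "A = {u} \<Longrightarrow> \<not> capped (D {u}) (R {u})"
  shows "\<not> capped (D A) (R A)"
proof (cases "A = {u}")
  case False
  hence "{u} \<subset> A" using assms by auto
  hence "1 < card A" using psubset_card_mono[of A "{u}"] fin_sub[OF assms(1)] by simp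
  thus ?thesis using uncapped[of A] assms by simp
qed (use assms in simp)

text \<open>A lift at \<open>v\<close> costs two edges of the star of \<open>v\<close> and of some cuts of sets with at least two
elements. All these are uncapped and can spare two edges; the stars of other vertices keep
their sizes because \<open>y \<noteq> z\<close>.\<close>

lemma not_lift:
  assumes e: "e1 \<in> E" "e2 \<in> E" "e1 \<noteq> e2" "links g e1 v y" "links g e2 v z"
    and yz: "y \<noteq> v" "z \<noteq> v" "y \<noteq> z" and unc: "\<not> capped (D {v}) (R {v})"
  shows False
proof -
  let ?h = "g(e1 := (y, z))"
  have V: "y \<in> V" "z \<in> V" using links_ends[OF e(4,1) ends] links_ends[OF e(5,2) ends] by auto
  have "preoriented V (E - {e2}) ?h \<gamma> p n"
  proof
    fix A assume A: "A \<subseteq> V" "A \<noteq> {}" "A \<noteq> V"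
    let ?D = "deg (E - {e2}) ?h A + sum p A + sum n A"
    have d: "?D = D A - of_bool ((v \<in> A) \<noteq> (y \<in> A))
        - of_bool ((v \<in> A) \<noteq> (z \<in> A)) + of_bool ((y \<in> A) \<noteq> (z \<in> A))"
      using deg_lift[OF finE e] by (simp add: D_def)
    have "ample ?D (R A)"
    proof (cases "?D = D A")
      case True
      thus ?thesis using ampleD[OF A] by simp
    next
      case False
      hence "?D = D A - 2 \<and> (v \<in> A \<or> y \<in> A \<and> z \<in> A)"
        using d by (cases "v \<in> A"; cases "y \<in> A"; cases "z \<in> A"; simp)
      hence D2: "?D = D A - 2" and c: "v \<in> A \<or> y \<in> A \<and> z \<in> A" by auto
      have "\<not> capped (D A) (R A)"
      proof (cases "v \<in> A")
        case True
        thus ?thesis by (rule uncapped_big[OF A(1,3)]) (rule unc)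
      next
        case False
        thus ?thesis using uncapped_big[OF A(1,3), of y] c yz by auto
      qed
      thus ?thesis using uncapped_ample(2) D2 by simp
    qed
    thus "ample ?D (sum \<gamma> A + sum n A - sum p A)" by (simp add: R_def)
  qed (use finV finE ends zero_sum p_nonneg n_nonneg capped V in \<open>auto simp: ends_in_def\<close>)
  hence "orientable V (E - {e2}) ?h \<gamma>"
    by (rule smaller) (use card_delete[OF e(2)] in simp)
  thus False using orientable_unlift_links[OF finE e] not_orientable by blast
qed

text \<open>The same lift with one of its two edges coming from the outer vertex. The lifted edge is then
an edge from the outer vertex to \<open>y\<close>, so its direction is known and it leaves the graph.\<close>

lemma not_lift_outer:
  assumes e: "e \<in> E" "links g e v y" and y: "y \<noteq> v" and p: "0 < p v"
    and unc: "\<not> capped (D {v}) (R {v})"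
  shows False
proof -
  let ?shift = "\<lambda>f w. f w - of_bool (w = v) + of_bool (w = y) :: int"
  have V: "v \<in> V" "y \<in> V" using links_ends[OF e(2,1) ends] by auto
  have tot: "sum (?shift f) V = sum f V" for f
    using sum_shift[OF finV, of f v y] V by simp
  have "preoriented V (E - {e}) g (?shift \<gamma>) (?shift p) n"
  proof
    fix A assume A: "A \<subseteq> V" "A \<noteq> {}" "A \<noteq> V"
    have sh: "sum (?shift f) A = sum f A - of_bool (v \<in> A) + of_bool (y \<in> A)" for f
      by (rule sum_shift[OF fin_sub[OF A(1)]])
    let ?D = "deg (E - {e}) g A + sum (?shift p) A + sum n A"
    have d: "?D = D A - of_bool ((v \<in> A) \<noteq> (y \<in> A)) - of_bool (v \<in> A) + of_bool (y \<in> A)"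
      using deg_delete[OF finE e] sh by (simp add: D_def)
    have "ample ?D (R A)"
    proof (cases "v \<in> A \<and> y \<notin> A")
      case True
      hence "\<not> capped (D A) (R A)" using uncapped_big[OF A(1,3), of v] unc by auto
      thus ?thesis using uncapped_ample(2) d True by simp
    next
      case False
      hence "?D = D A" using d by auto
      thus ?thesis using ampleD[OF A] by simp
    qed
    moreover have "R A = sum (?shift \<gamma>) A + sum n A - sum (?shift p) A"
      unfolding R_def sh by simp
    ultimately show "ample ?D (sum (?shift \<gamma>) A + sum n A - sum (?shift p) A)" by simp
  next
    show "0 \<le> ?shift p w" for w using p p_nonneg[of w] by auto
    show "capped (sum (?shift p) V + sum n V) (sum n V - sum (?shift p) V)" using tot capped by simp
    show "3 dvd sum (?shift \<gamma>) V" using tot zero_sum by simp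
  qed (use finV finE ends n_nonneg in \<open>auto simp: ends_in_def\<close>)
  hence "orientable V (E - {e}) g (?shift \<gamma>)"
    by (rule smaller) (use card_delete[OF e(1)] tot in simp)
  thus False using orientable_delete_link[OF finE e] not_orientable by blast
qed

lemma not_lift_outer':
  assumes e: "e \<in> E" "links g e v y" and y: "y \<noteq> v" and n: "0 < n v"
    and unc: "\<not> capped (D {v}) (R {v})"
  shows False
proof -
  interpret m: minimal_counterexample V E g "\<lambda>v. - \<gamma> v" n p by (rule mirror_minimal)
  have "\<not> capped (m.D {v}) (m.R {v})"
    using unc unfolding D_single R_single m.D_single m.R_single capped_def by presburger
  thus False using m.not_lift_outer[OF e y n] by blast
qed

lemma vertex_capped:
  assumes v: "v \<in> V"
  shows "capped (D {v}) (R {v})"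
proof (rule ccontr)
  assume unc: "\<not> capped (D {v}) (R {v})"
  hence D: "D {v} \<ge> 6" by (auto simp: capped_def)
  obtain e y where e: "e \<in> E" "links g e v y" "y \<noteq> v" using one_edge[OF has_edge[OF v]] by metis
  show False
  proof (cases "2 \<le> deg E g {v}")
    case True
    then obtain e1 e2 y z where "e1 \<in> E" "e2 \<in> E" "e1 \<noteq> e2" "links g e1 v y" "links g e2 v z"
      "y \<noteq> v" "z \<noteq> v" "y \<noteq> z" by (rule two_edges)
    from not_lift[OF this unc] show False .
  next
    case False
    hence "0 < p v \<or> 0 < n v" using D D_single[of v] by linarith
    thus False using not_lift_outer[OF e] not_lift_outer'[OF e] unc by blast
  qed
qed

end

lemma capped_decr: "capped d r \<Longrightarrow> capped (d - 1) (r - 1)"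
  unfolding capped_def by presburger

lemma capped_neg: "capped d r \<Longrightarrow> 3 dvd s + r \<Longrightarrow> capped d s"
  unfolding capped_def by presburger

lemma ample_turn: "ample (d - 1) (r - 1) \<Longrightarrow> 5 \<le> d \<Longrightarrow> ample d (r + 4)"
  unfolding ample_def by presburger

context minimal_counterexample
begin

text \<open>The four edges at such a vertex demand net outflow zero, so they can be lifted in two pairs,
after which the vertex is isolated and disappears. A set that contains all four neighbours
inherits ampleness from its union with \<open>v\<close>; any other set loses at most two edges, and then
only if it has at least two elements.\<close>

lemma D_ne_4_inner:
  assumes v: "v \<in> V" and D4: "D {v} = 4" and d: "deg E g {v} = 4"
  shows False
proof -
  obtain e1 e2 e3 e4 y z w u where e: "e1 \<in> E" "e2 \<in> E" "e3 \<in> E" "e4 \<in> E" "distinct [e1, e2, e3, e4]"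
    and l: "links g e1 v y" "links g e2 v z" "links g e3 v w" "links g e4 v u"
    and ne: "distinct [v, y, z, w, u]" and V: "y \<in> V" "z \<in> V" "w \<in> V" "u \<in> V"
    by (rule four_edges[of v]) (use d in auto)
  let ?g1 = "g(e1 := (y, z))" and ?E1 = "E - {e2}"
  let ?h = "?g1(e3 := (w, u))" and ?F = "?E1 - {e4}"
  have l': "links ?g1 e3 v w" "links ?g1 e4 v u" using l e(5) by (auto simp: links_def)
  have dg: "deg ?F ?h A = deg E g A
      - of_bool ((v \<in> A) \<noteq> (y \<in> A)) - of_bool ((v \<in> A) \<noteq> (z \<in> A)) + of_bool ((y \<in> A) \<noteq> (z \<in> A))
      - of_bool ((v \<in> A) \<noteq> (w \<in> A)) - of_bool ((v \<in> A) \<noteq> (u \<in> A)) + of_bool ((w \<in> A) \<noteq> (u \<in> A))" for A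
  proof -
    have "e1 \<noteq> e2" "e3 \<noteq> e4" "e3 \<in> ?E1" "e4 \<in> ?E1" "finite ?E1" using e finE by auto
    from deg_lift[OF this(5,3,4,2) l', of A] deg_lift[OF finE e(1,2) this(1) l(1,2), of A]
    show ?thesis by linarith
  qed
  have pn: "p v = 0" "n v = 0"
    using D4 d D_single[of v] p_nonneg[of v] n_nonneg[of v] by linarith+
  have Rv: "3 dvd \<gamma> v"
    using ampleD[of "{v}"] v D4 compl_proper[OF v] R_single[of v] pn by (auto simp: ample_def)
  have sumV: "sum f V = f v + sum f (V - {v})" for f :: "'v \<Rightarrow> int"
    using finV v by (rule sum.remove)
  have "deg ?F ?h {v} = 0" using dg[of "{v}"] d ne by auto
  hence "card {e\<in>?F. crosses ?h e {v}} = 0" using deg_card[of ?F ?h "{v}"] finE by simp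
  hence iso: "\<not> crosses ?h e {v}" if "e \<in> ?F" for e
    using that finE by auto
  have not_v: "fst (?h e) \<noteq> v \<and> snd (?h e) \<noteq> v" if "e \<in> ?F" for e
  proof -
    have "fst (?h e) \<noteq> snd (?h e)" using no_loop[of e] that ne by auto
    thus ?thesis using iso[OF that] by (auto simp: crosses_def)
  qed
  have pre: "preoriented (V - {v}) ?F ?h \<gamma> p n"
  proof
    have "ends_in V ?F ?h" using ends V by (auto simp: ends_in_def)
    thus "ends_in (V - {v}) ?F ?h" using not_v by (auto simp: ends_in_def)
    show "3 dvd sum \<gamma> (V - {v})" using zero_sum Rv sumV[of \<gamma>] by presburger
    show "capped (sum p (V - {v}) + sum n (V - {v})) (sum n (V - {v}) - sum p (V - {v}))"
      using capped sumV[of p] sumV[of n] pn by simp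
    fix A assume A: "A \<subseteq> V - {v}" "A \<noteq> {}" "A \<noteq> V - {v}"
    hence vA: "v \<notin> A" and AV: "A \<subseteq> V" "A \<noteq> V" using v by auto
    let ?D = "deg ?F ?h A + sum p A + sum n A"
    have D: "?D = D A - of_bool (y \<in> A) - of_bool (z \<in> A) + of_bool ((y \<in> A) \<noteq> (z \<in> A))
        - of_bool (w \<in> A) - of_bool (u \<in> A) + of_bool ((w \<in> A) \<noteq> (u \<in> A))"
      using dg[of A] vA by (simp add: D_def)
    consider "y \<in> A" "z \<in> A" "w \<in> A" "u \<in> A" | "?D = D A" | "?D = D A - 2" "y \<in> A \<and> z \<in> A \<or> w \<in> A \<and> u \<in> A"
      using D by (cases "y \<in> A"; cases "z \<in> A"; cases "w \<in> A"; cases "u \<in> A"; simp)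
    hence "ample ?D (R A)"
    proof cases
      case 1
      let ?B = "insert v A"
      have B: "?B \<subseteq> V" "?B \<noteq> {}" "?B \<noteq> V" using A v by auto
      have finA: "finite A" using AV(1) by (rule fin_sub)
      have "deg ?F ?h ?B = deg ?F ?h A"
        by (rule deg_cong) (use not_v in \<open>auto simp: crosses_def\<close>)
      moreover have "deg ?F ?h ?B = deg E g ?B" using dg[of ?B] 1 by simp
      moreover have "sum p ?B = sum p A" "sum n ?B = sum n A" "sum \<gamma> ?B = \<gamma> v + sum \<gamma> A"
        using finA vA pn by auto
      ultimately have "?D = D ?B" "R ?B = \<gamma> v + R A" by (simp_all add: D_def R_def)
      thus ?thesis using ample_cong[OF ampleD[OF B], of "R A"] Rv by simp
    next
      case 2
      thus ?thesis using ampleD[OF AV(1) A(2) AV(2)] by simp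
    next
      case 3
      have "\<not> capped (D A) (R A)"
      proof (cases "y \<in> A \<and> z \<in> A")
        case True
        thus ?thesis using uncapped_big[OF AV, of y] ne by auto
      next
        case False
        thus ?thesis using 3 uncapped_big[OF AV, of w] ne by auto
      qed
      thus ?thesis using uncapped_ample(2) 3 by simp
    qed
    thus "ample ?D (sum \<gamma> A + sum n A - sum p A)" by (simp add: R_def)
  qed (use finV finE p_nonneg n_nonneg in auto)
  have "card ?F \<le> card E" using finE by (intro card_mono) auto
  moreover have "card (V - {v}) < card V" using finV v by (rule card_Diff1_less)
  ultimately have "orientable (V - {v}) ?F ?h \<gamma>"
    by (intro smaller[OF pre]) (use pn sumV[of p] sumV[of n] in simp)
  then obtain x where x: "signs x" "\<And>t. t \<in> V - {v} \<Longrightarrow> 3 dvd net ?F ?h x t - \<gamma> t"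
    by (auto simp: orientable_def)
  have "net ?F ?h x v = 0"
    unfolding net_def by (rule sum.neutral) (use not_v in \<open>auto simp: inc_def\<close>)
  hence "orientable V ?F ?h \<gamma>"
    using x Rv unfolding orientable_def by (intro exI[of _ x]) (metis DiffI diff_0 dvd_minus_iff empty_iff insert_iff)
  hence "orientable V ?E1 ?g1 \<gamma>"
    by (rule orientable_unlift_links[OF _ _ _ _ l', rotated -1]) (use finE e in auto)
  hence "orientable V E g \<gamma>"
    by (rule orientable_unlift_links[OF finE _ _ _ l(1,2), rotated -1]) (use e in auto)
  thus False using not_orientable by blast
qed

lemma D_ne_4_outer:
  assumes v: "v \<in> V" and D4: "D {v} = 4" and pn: "p v = 1" "n v = 0"
  shows False
proof -
  have d: "deg E g {v} = 3" using D_single[of v] D4 pn by simp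
  obtain e1 e2 e3 y z w where e: "e1 \<in> E" "e2 \<in> E" "e3 \<in> E" "e1 \<noteq> e2" "e1 \<noteq> e3" "e2 \<noteq> e3"
    and l: "links g e1 v y" "links g e2 v z" "links g e3 v w"
    and ne: "y \<noteq> v" "z \<noteq> v" "w \<noteq> v" "y \<noteq> z" "y \<noteq> w" "z \<noteq> w" and V: "y \<in> V" "z \<in> V" "w \<in> V"
    by (rule three_edges[of v]) (use d in auto)
  let ?h = "g(e1 := (y, z))" and ?E1 = "E - {e2}"
  let ?F = "?E1 - {e3}"
  let ?shift = "\<lambda>f t. f t - of_bool (t = v) + of_bool (t = w) :: int"
  have l': "links ?h e3 v w" using l e by (auto simp: links_def)
  have dg: "deg ?F ?h A = deg E g A
      - of_bool ((v \<in> A) \<noteq> (y \<in> A)) - of_bool ((v \<in> A) \<noteq> (z \<in> A)) + of_bool ((y \<in> A) \<noteq> (z \<in> A))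
      - of_bool ((v \<in> A) \<noteq> (w \<in> A))" for A
  proof -
    have "e3 \<in> ?E1" "finite ?E1" using e finE by auto
    from deg_delete[OF this(2,1) l', of A] deg_lift[OF finE e(1,2,4) l(1,2), of A]
    show ?thesis by linarith
  qed
  have Rv: "3 dvd \<gamma> v - 1"
    using ampleD[of "{v}"] v D4 compl_proper[OF v] R_single[of v] pn by (auto simp: ample_def)
  have sumV: "sum f V = f v + sum f (V - {v})" for f :: "'v \<Rightarrow> int"
    using finV v by (rule sum.remove)
  have sh: "sum (?shift f) A = sum f A - of_bool (v \<in> A) + of_bool (w \<in> A)" if "A \<subseteq> V" for f A
    by (rule sum_shift[OF fin_sub[OF that]])
  have shV: "sum (?shift f) (V - {v}) = sum f (V - {v}) + 1" for f
    using sh[of "V - {v}" f] V ne by auto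
  have "deg ?F ?h {v} = 0" using dg[of "{v}"] d ne by auto
  hence "card {e\<in>?F. crosses ?h e {v}} = 0" using deg_card[of ?F ?h "{v}"] finE by simp
  hence iso: "\<not> crosses ?h e {v}" if "e \<in> ?F" for e
    using that finE by auto
  have not_v: "fst (?h e) \<noteq> v \<and> snd (?h e) \<noteq> v" if "e \<in> ?F" for e
  proof -
    have "fst (?h e) \<noteq> snd (?h e)" using no_loop[of e] that ne by auto
    thus ?thesis using iso[OF that] by (auto simp: crosses_def)
  qed
  have pre: "preoriented (V - {v}) ?F ?h (?shift \<gamma>) (?shift p) n"
  proof
    have "ends_in V ?F ?h" using ends V by (auto simp: ends_in_def)
    thus "ends_in (V - {v}) ?F ?h" using not_v by (auto simp: ends_in_def)
    show "3 dvd sum (?shift \<gamma>) (V - {v})" using zero_sum Rv sumV[of \<gamma>] shV[of \<gamma>] by presburger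
    show "capped (sum (?shift p) (V - {v}) + sum n (V - {v})) (sum n (V - {v}) - sum (?shift p) (V - {v}))"
      using capped sumV[of p] sumV[of n] pn unfolding shV[of p] by (simp add: ac_simps)
    fix A assume A: "A \<subseteq> V - {v}" "A \<noteq> {}" "A \<noteq> V - {v}"
    hence vA: "v \<notin> A" and AV: "A \<subseteq> V" "A \<noteq> V" using v by auto
    let ?D = "deg ?F ?h A + sum (?shift p) A + sum n A"
    have D: "?D = D A - of_bool (y \<in> A) - of_bool (z \<in> A) + of_bool ((y \<in> A) \<noteq> (z \<in> A))"
      using dg[of A] vA sh[OF AV(1), of p] by (simp add: D_def)
    consider "?D = D A" | "?D = D A - 2" "y \<in> A" "z \<in> A"
      using D by (cases "y \<in> A"; cases "z \<in> A"; simp)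
    hence "ample ?D (R A)"
    proof cases
      case 1
      thus ?thesis using ampleD[OF AV(1) A(2) AV(2)] by simp
    next
      case 2
      have "\<not> capped (D A) (R A)" using uncapped_big[OF AV, of y] 2 ne by auto
      thus ?thesis using uncapped_ample(2) 2 by simp
    qed
    moreover have "R A = sum (?shift \<gamma>) A + sum n A - sum (?shift p) A"
      unfolding R_def sh[OF AV(1)] by simp
    ultimately show "ample ?D (sum (?shift \<gamma>) A + sum n A - sum (?shift p) A)" by simp
  next
    show "0 \<le> ?shift p t" for t using pn p_nonneg[of t] by auto
  qed (use finV finE n_nonneg in auto)
  have "card ?F \<le> card E" using finE by (intro card_mono) auto
  moreover have "card (V - {v}) < card V" using finV v by (rule card_Diff1_less)
  ultimately have "orientable (V - {v}) ?F ?h (?shift \<gamma>)"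
    by (intro smaller[OF pre]) (use pn sumV[of p] sumV[of n] shV[of p] in simp)
  then obtain x where x: "signs x" "\<And>t. t \<in> V - {v} \<Longrightarrow> 3 dvd net ?F ?h x t - ?shift \<gamma> t"
    by (auto simp: orientable_def)
  have "net ?F ?h x v = 0"
    unfolding net_def by (rule sum.neutral) (use not_v in \<open>auto simp: inc_def\<close>)
  hence "3 dvd net ?F ?h x v - ?shift \<gamma> v" using Rv ne by simp presburger
  hence "orientable V ?F ?h (?shift \<gamma>)"
    using x unfolding orientable_def by (intro exI[of _ x]) (metis DiffI empty_iff insert_iff)
  hence "orientable V ?E1 ?h \<gamma>"
    by (rule orientable_delete_link[OF _ _ l', rotated -1]) (use finE e in auto)
  hence "orientable V E g \<gamma>"
    by (rule orientable_unlift_links[OF finE _ _ _ l(1,2), rotated -1]) (use e in auto)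
  thus False using not_orientable by blast
qed

lemma D_ne_4:
  assumes v: "v \<in> V"
  shows "D {v} \<noteq> 4"
proof
  assume D4: "D {v} = 4"
  interpret m: minimal_counterexample V E g "\<lambda>v. - \<gamma> v" n p by (rule mirror_minimal)
  have Rv: "3 dvd R {v}"
    using ampleD[of "{v}"] v D4 compl_proper[OF v] by (auto simp: ample_def)
  have "p v + n v \<le> 1"
  proof (rule ccontr)
    assume "\<not> p v + n v \<le> 1"
    hence "p v + n v = 2 \<or> 3 \<le> p v + n v" by linarith
    then consider "D (V - {v}) = sum p V + sum n V" | "D (V - {v}) \<le> 5"
      using D_compl[OF v] D4 D_V_le by (elim disjE) auto
    moreover have "3 dvd (sum n V - sum p V) - R (V - {v})"
      using R_compl[OF v] R_V Rv by presburger
    ultimately have "capped (D (V - {v})) (R (V - {v}))"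
      by cases (use capped_cong[OF capped] in \<open>auto simp: capped_def\<close>)
    thus False using compl_uncapped[OF v] by blast
  qed
  then consider "p v = 0" "n v = 0" | "p v = 1" "n v = 0" | "p v = 0" "n v = 1"
    using p_nonneg[of v] n_nonneg[of v] by linarith
  thus False
  proof cases
    case 1
    thus False using D_ne_4_inner[OF v D4] D_single[of v] D4 by simp
  next
    case 2
    thus False using D_ne_4_outer[OF v D4] by blast
  next
    case 3
    have "m.D {v} = 4" using D4 by (simp add: D_def m.D_def)
    thus False using m.D_ne_4_outer[OF v] 3 by blast
  qed
qed

text \<open>An edge at \<open>v\<close> directed away from \<open>v\<close>, respectively towards \<open>v\<close>, may be deleted without
harm to the star of \<open>v\<close>.\<close>

definition can_out :: "'v \<Rightarrow> bool" where "can_out v \<longleftrightarrow> ample (D {v} - 1) (R {v} - 1)"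
definition can_in :: "'v \<Rightarrow> bool" where "can_in v \<longleftrightarrow> ample (D {v} - 1) (R {v} + 1)"

lemma not_out_in:
  assumes e: "e \<in> E" "links g e u w" and c: "can_out u" "can_in w"
  shows False
proof -
  let ?shift = "\<lambda>f t. f t - of_bool (t = u) + of_bool (t = w) :: int"
  have V: "u \<in> V" "w \<in> V" using links_ends[OF e(2,1) ends] by auto
  have uw: "u \<noteq> w" using no_loop[OF e(1)] e(2) by (auto simp: links_def)
  have tot: "sum (?shift f) V = sum f V" for f
    using sum_shift[OF finV, of f u w] V by simp
  have "preoriented V (E - {e}) g (?shift \<gamma>) p n"
  proof
    fix A assume A: "A \<subseteq> V" "A \<noteq> {}" "A \<noteq> V"
    have sh: "sum (?shift f) A = sum f A - of_bool (u \<in> A) + of_bool (w \<in> A)" for f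
      by (rule sum_shift[OF fin_sub[OF A(1)]])
    let ?D = "deg (E - {e}) g A + sum p A + sum n A" and ?R = "sum (?shift \<gamma>) A + sum n A - sum p A"
    have d: "?D = D A - of_bool ((u \<in> A) \<noteq> (w \<in> A))"
      using deg_delete[OF finE e] by (simp add: D_def)
    have r: "?R = R A - of_bool (u \<in> A) + of_bool (w \<in> A)" by (simp add: R_def sh)
    show "ample ?D ?R"
    proof (cases "(u \<in> A) = (w \<in> A)")
      case True
      thus ?thesis using d r ampleD[OF A] by auto
    next
      case False
      then consider "u \<in> A" "w \<notin> A" | "w \<in> A" "u \<notin> A" by auto
      thus ?thesis
      proof cases
        case 1
        have "ample (D A - 1) (R A - 1)"
        proof (cases "A = {u}")
          case True
          thus ?thesis using c(1) by (simp add: can_out_def)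
        next
          case False
          thus ?thesis using uncapped_ample(4) uncapped_big[OF A(1,3) 1(1)] by blast
        qed
        thus ?thesis using d r 1 by simp
      next
        case 2
        have "ample (D A - 1) (R A + 1)"
        proof (cases "A = {w}")
          case True
          thus ?thesis using c(2) by (simp add: can_in_def)
        next
          case False
          thus ?thesis using uncapped_ample(3) uncapped_big[OF A(1,3) 2(1)] by blast
        qed
        thus ?thesis using d r 2 by simp
      qed
    qed
  next
    show "3 dvd sum (?shift \<gamma>) V" using tot zero_sum by simp
  qed (use finV finE ends p_nonneg n_nonneg capped in \<open>auto simp: ends_in_def\<close>)
  hence "orientable V (E - {e}) g (?shift \<gamma>)"
    by (rule smaller) (use card_delete[OF e(1)] in simp)
  thus False using orientable_delete_link[OF finE e] not_orientable by blast
qed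

lemma vertex_types:
  assumes v: "v \<in> V"
  shows "can_out v \<or> can_in v" "5 \<le> D {v}"
proof -
  have a: "ample (D {v}) (R {v})" using ampleD[of "{v}"] v compl_proper[OF v] by auto
  have c: "capped (D {v}) (R {v})" by (rule vertex_capped[OF v])
  have D: "D {v} \<in> {5, 6, 7}" using a c D_ne_4[OF v] by (auto simp: ample_def capped_def)
  thus "5 \<le> D {v}" by auto
  have "D {v} = 7 \<Longrightarrow> can_out v" by (auto simp: can_out_def ample_def)
  moreover have "D {v} = 5 \<or> D {v} = 6 \<Longrightarrow> \<not> 3 dvd R {v}" using a c by (auto simp: ample_def capped_def)
  moreover have "\<not> 3 dvd r \<Longrightarrow> 3 dvd r - 1 \<and> \<not> 3 dvd r + 1 \<or> 3 dvd r + 1 \<and> \<not> 3 dvd r - 1" for r :: int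
    by presburger
  ultimately show "can_out v \<or> can_in v"
    using D unfolding can_out_def can_in_def ample_def by fastforce
qed

text \<open>If all vertices can lose outgoing edges, then no edge leads from \<open>V\<close> to the outer vertex, as it
could be deleted. If the outer vertex has no edge at all, any vertex \<open>v\<close> may take its place.
Otherwise there is an outer edge into some \<open>x\<close>. Modulo \<open>3\<close> it can be traded for two edges out
of \<open>x\<close>; this gives \<open>x\<close> one more edge, so that it can afford to lose an edge directed into
\<open>x\<close> from a neighbour.\<close>

lemma not_all_out:
  assumes all: "\<And>v. v \<in> V \<Longrightarrow> can_out v"
  shows False
proof -
  have n0: "n v = 0" if v: "v \<in> V" for v
  proof (rule ccontr)
    assume "n v \<noteq> 0"
    hence nv: "1 \<le> n v" using n_nonneg[of v] by linarith
    let ?n = "\<lambda>t. n t - of_bool (t = v)"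
    have s: "sum ?n A = sum n A - of_bool (v \<in> A)" if "A \<subseteq> V" for A
      using fin_sub[OF that] by (simp add: sum_subtractf of_bool_def sum.delta)
    have "preoriented V E g \<gamma> p ?n"
    proof
      fix A assume A: "A \<subseteq> V" "A \<noteq> {}" "A \<noteq> V"
      have "deg E g A + sum p A + sum ?n A = D A - of_bool (v \<in> A)"
        "sum \<gamma> A + sum ?n A - sum p A = R A - of_bool (v \<in> A)"
        by (simp_all add: D_def R_def s[OF A(1)])
      moreover have "ample (D A - 1) (R A - 1)" if "v \<in> A"
      proof (cases "A = {v}")
        case True
        thus ?thesis using all[OF v] by (simp add: can_out_def)
      next
        case False
        thus ?thesis using uncapped_ample(4) uncapped_big[OF A(1,3) that] by blast
      qed
      ultimately show "ample (deg E g A + sum p A + sum ?n A) (sum \<gamma> A + sum ?n A - sum p A)"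
        using ampleD[OF A] by (cases "v \<in> A") auto
    next
      show "0 \<le> ?n t" for t using nv n_nonneg[of t] by auto
      show "capped (sum p V + sum ?n V) (sum ?n V - sum p V)"
      proof -
        have "sum ?n V = sum n V - 1" using s[of V] v by simp
        moreover have "sum p V + (sum n V - 1) = sum p V + sum n V - 1"
          "(sum n V - 1) - sum p V = (sum n V - sum p V) - 1" by simp_all
        ultimately show ?thesis using capped_decr[OF capped] by presburger
      qed
    qed (use finV finE ends p_nonneg zero_sum in auto)
    moreover have "1 \<le> sum n V"
      using sum.remove[OF finV v, of n] sum_n_nonneg[of "V - {v}"] nv by linarith
    ultimately have "orientable V E g \<gamma>"
      by (intro smaller) (use s[of V] v sum_p_nonneg[of V] in auto)
    thus False using not_orientable by blast
  qed
  hence nA: "sum n A = 0" if "A \<subseteq> V" for A using that by (intro sum.neutral) auto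
  obtain v where v: "v \<in> V" using card_ge_2 by fastforce
  have "sum p V \<noteq> 0"
  proof
    assume p0: "sum p V = 0"
    hence pv: "p v = 0" using v p_nonneg finV by (simp add: sum_nonneg_eq_0_iff)
    hence "D {v} = deg E g {v}" using D_single[of v] n0[OF v] by simp
    moreover have "4 \<le> D {v}" using ampleD[of "{v}"] v compl_proper[OF v] by (auto simp: ample_def)
    ultimately have "2 \<le> deg E g {v}" by simp
    then obtain e1 e2 y z where e: "e1 \<in> E" "e2 \<in> E" "e1 \<noteq> e2" "links g e1 v y" "links g e2 v z"
      "y \<noteq> v" "z \<noteq> v" by (rule two_edges)
    obtain x where x: "signs x" "3 dvd net E g x v - \<gamma> v"
      by (rule orient_at_vertex[OF finE e(1-3), of g v "\<gamma> v"])
        (use e crosses_links[OF e(4)] crosses_links[OF e(5)] in auto)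
    have "D (V - {v}) = D {v}" "R (V - {v}) = R V - R {v}" "3 dvd R V"
      using D_compl[OF v] R_compl[OF v] R_V p0 pv n0[OF v] nA[of V] by auto
    hence "capped (D (V - {v})) (R (V - {v}))"
      using capped_neg[OF vertex_capped[OF v], of "R V - R {v}"] by simp
    thus False
      using not_restrictable[of "V - {v}" x] compl_proper[OF v] x by auto
  qed
  then obtain x where x: "x \<in> V" "p x \<noteq> 0" by (meson sum.neutral)
  hence px: "1 \<le> p x" using p_nonneg[of x] by linarith
  obtain e y where e: "e \<in> E" "links g e x y" "y \<noteq> x" "y \<in> V" using one_edge[OF has_edge[OF x(1)]] by metis
  have e': "links g e y x" using e(2) by (simp add: links_sym)
  let ?\<gamma> = "\<lambda>t. \<gamma> t - of_bool (t = y) + of_bool (t = x)"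
  let ?p = "\<lambda>t. p t - of_bool (t = x)" and ?n = "\<lambda>t. n t + 2 * of_bool (t = x)"
  have sg: "sum ?\<gamma> A = sum \<gamma> A - of_bool (y \<in> A) + of_bool (x \<in> A)" if "A \<subseteq> V" for A
    by (rule sum_shift[OF fin_sub[OF that]])
  have sp: "sum ?p A = sum p A - of_bool (x \<in> A)" if "A \<subseteq> V" for A
    using fin_sub[OF that] by (simp add: sum_subtractf of_bool_def sum.delta)
  have sn: "sum ?n A = sum n A + 2 * of_bool (x \<in> A)" if "A \<subseteq> V" for A
    using fin_sub[OF that] by (simp add: sum.distrib of_bool_def sum.delta flip: sum_distrib_left)
  have "preoriented V (E - {e}) g ?\<gamma> ?p ?n"
  proof
    show "3 dvd sum ?\<gamma> V" using sg[of V] x e zero_sum by simp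
    \<comment> \<open>When all \<open>k\<close> outer edges point into \<open>V\<close>, the star of the outer vertex is capped only for
      \<open>k \<le> 5\<close>, and then one more edge is affordable.\<close>
    have "capped (sum p V) (- sum p V)" using capped nA[of V] by simp
    hence "capped (sum p V + 1) (3 - sum p V)" unfolding capped_def by presburger
    thus "capped (sum ?p V + sum ?n V) (sum ?n V - sum ?p V)"
    proof -
      have "sum ?p V = sum p V - 1" "sum ?n V = 2" using sp[of V] sn[of V] nA[of V] x(1) by auto
      moreover have "sum p V - 1 + 2 = sum p V + 1" "2 - (sum p V - 1) = 3 - sum p V" by simp_all
      ultimately show ?thesis using \<open>capped (sum p V + 1) (3 - sum p V)\<close> by presburger
    qed
    fix A assume A: "A \<subseteq> V" "A \<noteq> {}" "A \<noteq> V"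
    let ?D = "deg (E - {e}) g A + sum ?p A + sum ?n A" and ?R = "sum ?\<gamma> A + sum ?n A - sum ?p A"
    have d: "?D = D A - of_bool ((y \<in> A) \<noteq> (x \<in> A)) + of_bool (x \<in> A)"
      using deg_delete[OF finE e(1) e', of A] by (simp add: D_def sp[OF A(1)] sn[OF A(1)])
    have r: "?R = R A - of_bool (y \<in> A) + of_bool (x \<in> A) + 3 * of_bool (x \<in> A)"
      by (simp add: R_def sp[OF A(1)] sn[OF A(1)] sg[OF A(1)])
    consider "x \<in> A" "A = {x}" | "x \<in> A" "A \<noteq> {x}" | "x \<notin> A" "y \<in> A" | "x \<notin> A" "y \<notin> A" by blast
    thus "ample ?D ?R"
    proof cases
      case 1
      hence "?D = D {x}" "?R = R {x} + 4" using d r e(3) by auto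
      moreover have "ample (D {x}) (R {x} + 4)"
        using all[OF x(1)] vertex_types(2)[OF x(1)] by (intro ample_turn) (auto simp: can_out_def)
      ultimately show ?thesis by simp
    next
      case 2
      hence "\<not> capped (D A) (R A)" using uncapped_big[OF A(1,3)] by blast
      hence "6 \<le> D A" by (auto simp: capped_def)
      thus ?thesis using d 2 by (auto simp: ample_def)
    next
      case 3
      have "ample (D A - 1) (R A - 1)"
      proof (cases "A = {y}")
        case True
        thus ?thesis using all[OF e(4)] by (simp add: can_out_def)
      next
        case False
        thus ?thesis using uncapped_ample(4) uncapped_big[OF A(1,3) 3(2)] by blast
      qed
      thus ?thesis using d r 3 by simp
    next
      case 4
      thus ?thesis using d r ampleD[OF A] by simp
    qed
  next
    show "0 \<le> ?p t" for t using px p_nonneg[of t] by auto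
  qed (use finV finE ends n_nonneg in \<open>auto simp: ends_in_def\<close>)
  hence "orientable V (E - {e}) g ?\<gamma>"
    by (rule smaller) (use card_delete[OF e(1)] sp[of V] sn[of V] x(1) sum_p_nonneg[of V] sum_n_nonneg[of V] in auto)
  thus False using orientable_delete_link[OF finE e(1) e'] not_orientable by blast
qed

text \<open>No edge joins a vertex that can lose outgoing edges to one that cannot, since otherwise it could
be deleted in the suitable direction. Two parts without edges between them would each need
four edges to the outer vertex, which has at most seven. So all vertices are of the same kind,
and by symmetry they can all lose outgoing edges.\<close>

lemma contradiction: False
proof -
  interpret m: minimal_counterexample V E g "\<lambda>v. - \<gamma> v" n p by (rule mirror_minimal)
  define U where "U = {v\<in>V. can_out v}"
  have U: "U \<subseteq> V" by (auto simp: U_def)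
  have "deg E g U = 0"
    unfolding deg_def
  proof (rule sum.neutral, rule ballI)
    fix e assume e: "e \<in> E"
    have "\<not> crosses g e U"
    proof
      assume "crosses g e U"
      then obtain u w where l: "links g e u w" and uw: "u \<in> U" "w \<notin> U"
        by (cases "g e") (auto simp: crosses_def links_def)
      have "w \<in> V" using links_ends[OF l e ends] by blast
      thus False using not_out_in[OF e l] uw vertex_types(1) by (auto simp: U_def)
    qed
    thus "of_bool (crosses g e U) = (0::int)" by simp
  qed
  hence "D U = sum p U + sum n U" "D (V - U) = sum p (V - U) + sum n (V - U)"
    using deg_compl[OF ends, of U] by (simp_all add: D_def)
  moreover have "sum p V = sum p (V - U) + sum p U" "sum n V = sum n (V - U) + sum n U"
    by (rule sum.subset_diff[OF U finV])+
  ultimately have "D U + D (V - U) \<le> 7" using D_V_le by simp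
  hence "U = {} \<or> U = V"
    using ampleD[of U] ampleD[of "V - U"] U by (fastforce simp: ample_def)
  thus False
  proof
    assume "U = V"
    thus False using not_all_out by (auto simp: U_def)
  next
    assume "U = {}"
    hence "m.can_out v" if "v \<in> V" for v
    proof -
      have "can_in v" using vertex_types(1)[OF that] \<open>U = {}\<close> that by (auto simp: U_def)
      moreover have "m.D {v} - 1 = D {v} - 1" "m.R {v} - 1 = - (R {v} + 1)"
        by (simp_all add: m.D_def D_def m.R_def R_def)
      ultimately show ?thesis unfolding can_in_def m.can_out_def ample_def by presburger
    qed
    thus False using m.not_all_out by blast
  qed
qed

end

theorem preoriented_orientable:
  assumes "preoriented V E g \<gamma> p n"
  shows "orientable V E g \<gamma>"
  using assms
proof (induction "8 * (card V + card E) + nat (sum p V + sum n V)" arbitrary: V E g \<gamma> p n rule: less_induct)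
  case less
  show ?case
  proof (rule ccontr)
    assume not: "\<not> orientable V E g \<gamma>"
    interpret preoriented V E g \<gamma> p n by (rule less.prems)
    have "minimal_counterexample V E g \<gamma> p n"
      by unfold_locales (use less.hyps not in blast)+
    thus False by (rule minimal_counterexample.contradiction)
  qed
qed

text \<open>With no edges at the outer vertex every cut of size at least six is ample, whatever its demand.\<close>

corollary six_edge_connected_orientable:
  assumes "finite V" "finite E" "ends_in V E g" "3 dvd sum \<gamma> V"
    and "\<And>A. A \<subseteq> V \<Longrightarrow> A \<noteq> {} \<Longrightarrow> A \<noteq> V \<Longrightarrow> 6 \<le> deg E g A"
  shows "orientable V E g \<gamma>"
proof (rule preoriented_orientable)
  show "preoriented V E g \<gamma> (\<lambda>_. 0) (\<lambda>_. 0)"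
    by unfold_locales (use assms in \<open>auto simp: ample_def capped_def\<close>)
qed

section \<open>Trimming hyperedges\<close>

definition split_by :: "'v set \<Rightarrow> 'v set set \<Rightarrow> bool" where
  "split_by S P \<longleftrightarrow> (\<forall>B\<in>P. \<not> S \<subseteq> B)"

text \<open>Uncrossing of two partitions at one block \<open>C\<close> of \<open>Q\<close>: the blocks of \<open>P\<close> that meet \<open>C\<close> are
merged, and in exchange \<open>C\<close> is cut along them. A set that is split by the new \<open>Q\<close> only lies
inside \<open>C\<close>, hence inside the merged block.\<close>

lemma split_by_merge_blocks:
  assumes P: "P' = insert (\<Union>M) (P - M)" "M = {B\<in>P. B \<inter> C \<noteq> {}}" "M \<noteq> {}"
    and Q: "Q' = Q - {C} \<union> (\<lambda>B. B \<inter> C) ` M" and C: "C \<subseteq> \<Union>M"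
  shows "of_bool (split_by S P') + of_bool (split_by S Q')
    \<le> (of_bool (split_by S P) + of_bool (split_by S Q) :: int)"
proof -
  have 1: "split_by S P" if "split_by S P'"
    unfolding split_by_def
  proof (intro ballI notI)
    fix B assume B: "B \<in> P" "S \<subseteq> B"
    show False
    proof (cases "B \<in> M")
      case True
      hence "S \<subseteq> \<Union>M" using B by blast
      thus False using that P(1) by (auto simp: split_by_def)
    next
      case False
      thus False using that P(1) B by (auto simp: split_by_def)
    qed
  qed
  have 2: "split_by S P \<and> \<not> split_by S P'" if s: "split_by S Q'" "\<not> split_by S Q"
  proof
    obtain D where D: "D \<in> Q" "S \<subseteq> D" using s(2) by (auto simp: split_by_def)
    have "D = C"
    proof (rule ccontr)
      assume "D \<noteq> C"
      hence "D \<in> Q'" using D Q by auto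
      thus False using s(1) D by (auto simp: split_by_def)
    qed
    hence SC: "S \<subseteq> C" using D by simp
    have no: "\<not> S \<subseteq> B \<inter> C" if "B \<in> M" for B
      using s(1) that Q unfolding split_by_def by blast
    show "split_by S P"
      unfolding split_by_def
    proof (intro ballI notI)
      fix B assume B: "B \<in> P" "S \<subseteq> B"
      have "B \<notin> M" using no[of B] B SC by blast
      hence "B \<inter> C = {}" using B P(2) by blast
      hence "S = {}" using B SC by blast
      thus False using no P(3) by blast
    qed
    have "S \<subseteq> \<Union>M" using SC C by (rule order_trans)
    thus "\<not> split_by S P'" using P(1) by (auto simp: split_by_def)
  qed
  show ?thesis
    using 1 2 by (cases "split_by S P"; cases "split_by S P'"; cases "split_by S Q"; cases "split_by S Q'"; simp)
qed

lemma partition_merge_blocks: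
  assumes fin: "finite V" and P: "partition_on V P" and Q: "partition_on V Q"
    and C: "C \<in> Q" and M: "M = {B\<in>P. B \<inter> C \<noteq> {}}"
  shows "partition_on V (insert (\<Union>M) (P - M))" "partition_on V (Q - {C} \<union> (\<lambda>B. B \<inter> C) ` M)"
    "card (insert (\<Union>M) (P - M)) + card M = card P + 1"
    "card (Q - {C} \<union> (\<lambda>B. B \<inter> C) ` M) + 1 = card Q + card M" "C \<subseteq> \<Union>M" "M \<noteq> {}"
proof -
  have finP: "finite P" and finQ: "finite Q"
    using fin P Q finite_elements by blast+
  have UP: "\<Union>P = V" and UQ: "\<Union>Q = V" and neP: "{} \<notin> P" and neQ: "{} \<notin> Q"
    using P Q by (auto simp: partition_on_def)
  have dP: "B \<inter> B' = {}" if "B \<in> P" "B' \<in> P" "B \<noteq> B'" for B B'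
    using P that by (auto simp: partition_on_def disjoint_def)
  have dQ: "B \<inter> B' = {}" if "B \<in> Q" "B' \<in> Q" "B \<noteq> B'" for B B'
    using Q that by (auto simp: partition_on_def disjoint_def)
  have MP: "M \<subseteq> P" using M by auto
  have CV: "C \<subseteq> V" using C UQ by auto
  show CM: "C \<subseteq> \<Union>M"
  proof
    fix x assume x: "x \<in> C"
    then obtain B where "B \<in> P" "x \<in> B" using CV UP by blast
    thus "x \<in> \<Union>M" using x M by auto
  qed
  have Cne: "C \<noteq> {}" using C neQ by auto
  thus Mne: "M \<noteq> {}" using CM by auto
  have UM: "\<Union>M \<noteq> {}" using Cne CM by auto
  have notin: "\<Union>M \<notin> P - M"
  proof
    assume a: "\<Union>M \<in> P - M"
    obtain B where "B \<in> M" using Mne by auto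
    hence "B \<inter> \<Union>M = {}" using dP[of B "\<Union>M"] a MP by auto
    moreover have "B \<subseteq> \<Union>M" "B \<noteq> {}" using \<open>B \<in> M\<close> MP neP by auto
    ultimately show False by auto
  qed
  show "partition_on V (insert (\<Union>M) (P - M))"
  proof (rule partition_onI)
    show "\<Union>(insert (\<Union>M) (P - M)) = V" using UP MP by auto
    show "{} \<notin> insert (\<Union>M) (P - M)" using UM neP by auto
  next
    fix B B' assume b: "B \<in> insert (\<Union>M) (P - M)" "B' \<in> insert (\<Union>M) (P - M)" "B \<noteq> B'"
    have *: "disjnt (\<Union>M) B''" if "B'' \<in> P - M" for B''
      using that dP[of _ B''] MP unfolding disjnt_def by blast
    show "disjnt B B'"
      using b *[of B] *[of B'] dP[of B B'] by (auto simp: disjnt_def)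
  qed
  have "card (insert (\<Union>M) (P - M)) = card P - card M + 1"
    using notin finP MP by (simp add: card_Diff_subset finite_subset[OF MP])
  moreover have "card M \<le> card P" using MP finP by (rule card_mono[rotated])
  ultimately show "card (insert (\<Union>M) (P - M)) + card M = card P + 1" by simp
  let ?Q = "Q - {C} \<union> (\<lambda>B. B \<inter> C) ` M"
  show "partition_on V ?Q"
  proof (rule partition_onI)
    have "\<Union>((\<lambda>B. B \<inter> C) ` M) = C" using CM by auto
    thus "\<Union>?Q = V" using UQ C by auto
    show "{} \<notin> ?Q" using neQ M by auto
  next
    fix B B' assume b: "B \<in> ?Q" "B' \<in> ?Q" "B \<noteq> B'"
    consider "B \<in> Q" "B \<noteq> C" "B' \<in> Q" "B' \<noteq> C" | "B \<in> Q" "B \<noteq> C" "B' \<subseteq> C"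
      | "B \<subseteq> C" "B' \<in> Q" "B' \<noteq> C" | K K' where "K \<in> M" "K' \<in> M" "B = K \<inter> C" "B' = K' \<inter> C"
      using b by blast
    thus "disjnt B B'"
    proof cases
      case 4
      thus ?thesis using dP[of K K'] MP b(3) unfolding disjnt_def by blast
    qed (use dQ[of B B'] dQ[of B C] dQ[of C B'] C b(3) in \<open>auto simp: disjnt_def\<close>)
  qed
  have "inj_on (\<lambda>B. B \<inter> C) M"
  proof (rule inj_onI)
    fix B B' assume b: "B \<in> M" "B' \<in> M" "B \<inter> C = B' \<inter> C"
    have "B \<inter> C \<noteq> {}" using b M by auto
    hence "B \<inter> B' \<noteq> {}" using b(3) by auto
    thus "B = B'" using dP b MP by blast
  qed
  hence ci: "card ((\<lambda>B. B \<inter> C) ` M) = card M" by (rule card_image)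
  have "(Q - {C}) \<inter> (\<lambda>B. B \<inter> C) ` M = {}"
  proof (rule ccontr)
    assume "(Q - {C}) \<inter> (\<lambda>B. B \<inter> C) ` M \<noteq> {}"
    then obtain B where B: "B \<in> M" "B \<inter> C \<in> Q" "B \<inter> C \<noteq> C" by auto
    hence "B \<inter> C \<inter> C = {}" using dQ[of "B \<inter> C" C] C by simp
    thus False using B(1) M by auto
  qed
  hence "card ?Q = card (Q - {C}) + card M"
    using ci finQ finite_subset[OF MP finP] by (subst card_Un_disjoint) auto
  moreover have "card (Q - {C}) + 1 = card Q"
    using card.remove[OF finQ C] by simp
  ultimately show "card ?Q + 1 = card Q + card M" by simp
qed

text \<open>A hyperedge \<open>h\<close> may be replaced by two of its vertices without spoiling the bound
\<open>4 * (card P - 1)\<close> on the number of hyperedges split by a partition. Only partitions that are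
deficient without \<open>h\<close> matter. Among these choose \<open>P\<close> with the fewest blocks. By uncrossing, every
deficient partition refines \<open>P\<close>: a block of it that met several blocks of \<open>P\<close> would yield a
deficient partition with fewer blocks. So any two vertices of \<open>h\<close> in different blocks of \<open>P\<close>
will do.\<close>

lemma trim_hyperedge:
  fixes S :: "'i \<Rightarrow> 'v set" and I :: "'i set"
  defines "c P \<equiv> (\<Sum>i\<in>I. of_bool (split_by (S i) P) :: int)"
  assumes finV: "finite V" and finI: "finite I" and h: "h \<subseteq> V" "h \<noteq> {}"
    and dense: "\<And>P. partition_on V P \<Longrightarrow> 4 * int (card P) \<le> c P + of_bool (split_by h P) + 4"
  obtains y z where "y \<in> h" "z \<in> h" "h = {y} \<or> y \<noteq> z"
    "\<And>P. partition_on V P \<Longrightarrow> 4 * int (card P) \<le> c P + of_bool (split_by {y, z} P) + 4"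
proof (cases "\<exists>P. partition_on V P \<and> c P + 4 < 4 * int (card P)")
  case False
  obtain y where y: "y \<in> h" using h by auto
  obtain z where z: "z \<in> h" "h = {y} \<or> y \<noteq> z" using y by (cases "h = {y}") auto
  show ?thesis using that[OF y z] False by force
next
  case True
  then obtain P where P: "partition_on V P" "c P + 4 < 4 * int (card P)"
    and least: "\<And>Q. partition_on V Q \<Longrightarrow> c Q + 4 < 4 * int (card Q) \<Longrightarrow> card P \<le> card Q"
    using ex_has_least_nat[of "\<lambda>P. partition_on V P \<and> c P + 4 < 4 * int (card P)" _ card] by blast
  have sp: "split_by h P" using dense[OF P(1)] P(2) by (cases "split_by h P") auto
  obtain y where y: "y \<in> h" using h by auto
  have "y \<in> \<Union>P" using y h P(1) by (auto simp: partition_on_def)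
  then obtain B where B: "B \<in> P" "y \<in> B" by auto
  obtain z where z: "z \<in> h" "z \<notin> B" using sp B by (auto simp: split_by_def)
  have "z \<in> \<Union>P" using z h P(1) by (auto simp: partition_on_def)
  then obtain B' where B': "B' \<in> P" "z \<in> B'" by auto
  have "split_by {y, z} Q" if Q: "partition_on V Q" "c Q + 4 < 4 * int (card Q)" for Q
  proof (rule ccontr)
    assume "\<not> split_by {y, z} Q"
    then obtain C where C: "C \<in> Q" "y \<in> C" "z \<in> C" by (auto simp: split_by_def)
    define M where "M = {B\<in>P. B \<inter> C \<noteq> {}}"
    let ?P = "insert (\<Union>M) (P - M)" and ?Q = "Q - {C} \<union> (\<lambda>B. B \<inter> C) ` M"
    note m = partition_merge_blocks[OF finV P(1) Q(1) C(1) M_def]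
    have "c ?P + c ?Q \<le> c P + c Q"
      unfolding c_def sum.distrib[symmetric]
      by (rule sum_mono) (rule split_by_merge_blocks[OF refl M_def m(6) refl m(5)])
    moreover have "4 * int (card ?Q) \<le> c ?Q + of_bool (split_by h ?Q) + 4" by (rule dense[OF m(2)])
    moreover have "of_bool (split_by h ?Q) \<le> (1::int)" by simp
    ultimately have "c ?P + 4 < 4 * int (card ?P)" using P(2) Q(2) m(3,4) by linarith
    hence "card P \<le> card ?P" by (rule least[OF m(1)])
    moreover have "finite M" using finite_elements[OF finV P(1)] by (simp add: M_def)
    hence "card {B, B'} \<le> card M"
      by (rule card_mono) (use B B' C in \<open>auto simp: M_def\<close>)
    hence "2 \<le> card M" using B B' z by (simp add: card_insert_if split: if_splits)
    ultimately show False using m(3) by linarith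
  qed
  hence "4 * int (card Q) \<le> c Q + of_bool (split_by {y, z} Q) + 4" if "partition_on V Q" for Q
    using that dense[OF that] by (cases "c Q + 4 < 4 * int (card Q)"; cases "split_by h Q") auto
  thus ?thesis using that[OF y z(1)] z B by blast
qed

section \<open>Partition-dense graphs\<close>

definition nbrs :: "'e set \<Rightarrow> ('e \<Rightarrow> 'v \<times> 'v) \<Rightarrow> 'v \<Rightarrow> 'v set" where
  "nbrs E g u = {w. w \<noteq> u \<and> (\<exists>e\<in>E. links g e u w)}"

text \<open>The vertices in \<open>S\<close> act as hyperedges on \<open>X\<close>: each stands for the set of its neighbours.\<close>

definition crossing_number ::
    "'v set \<Rightarrow> 'v set \<Rightarrow> 'e set \<Rightarrow> ('e \<Rightarrow> 'v \<times> 'v) \<Rightarrow> 'v set set \<Rightarrow> int" where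
  "crossing_number X S E g P =
    (\<Sum>e\<in>inside E g X. of_bool (split_by {fst (g e), snd (g e)} P)) + (\<Sum>u\<in>S. of_bool (split_by (nbrs E g u) P))"

text \<open>For \<open>S = {}\<close> this is the condition of Nash-Williams and Tutte for four edge-disjoint spanning
trees. It is the condition on partitions that is used, never the trees.\<close>

definition dense :: "'v set \<Rightarrow> 'v set \<Rightarrow> 'e set \<Rightarrow> ('e \<Rightarrow> 'v \<times> 'v) \<Rightarrow> bool" where
  "dense X S E g \<longleftrightarrow> (\<forall>P. partition_on X P \<longrightarrow> 4 * int (card P) \<le> crossing_number X S E g P + 4)"

definition freely_orientable :: "'v set \<Rightarrow> 'e set \<Rightarrow> ('e \<Rightarrow> 'v \<times> 'v) \<Rightarrow> bool" where
  "freely_orientable V E g \<longleftrightarrow> (\<forall>\<gamma>. 3 dvd sum \<gamma> V \<longrightarrow> orientable V E g \<gamma>)"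

lemma denseD: "dense X S E g \<Longrightarrow> partition_on X P \<Longrightarrow> 4 * int (card P) \<le> crossing_number X S E g P + 4"
  by (simp add: dense_def)

lemma deg_ge_distinct_edges:
  assumes "finite E" "int k \<le> deg E g {v}"
  shows "k \<le> card {e\<in>E. crosses g e {v}}"
  using assms deg_card[OF assms(1), of g "{v}"] by simp

text \<open>Two edges at \<open>u\<close> are lifted. The others, at least two, can be oriented to meet any demand at
\<open>u\<close>, after which \<open>u\<close> may be deleted.\<close>

lemma freely_orientable_unlift:
  assumes finV: "finite V" and finE: "finite E" and ends: "ends_in V E g" and u: "u \<in> V"
    and deg: "4 \<le> deg E g {u}"
    and e: "e1 \<in> E" "e2 \<in> E" "e1 \<noteq> e2" "links g e1 u y" "links g e2 u z" "y \<noteq> u" "z \<noteq> u"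
    and free: "freely_orientable (V - {u}) (insert e1 (inside E g (V - {u}))) (g(e1 := (y, z)))"
  shows "freely_orientable V E g"
  unfolding freely_orientable_def
proof (intro allI impI)
  fix \<gamma> :: "_ \<Rightarrow> int" assume sum0: "3 dvd sum \<gamma> V"
  let ?h = "g(e1 := (y, z))" and ?F = "E - {e2}" and ?A = "V - {u}"
  let ?U = "{e\<in>E. crosses g e {u}}"
  have V: "y \<in> V" "z \<in> V" using links_ends[OF e(4,1) ends] links_ends[OF e(5,2) ends] by auto
  have ends': "ends_in V ?F ?h" using ends V by (auto simp: ends_in_def)
  have U: "finite ?U" using finE by simp
  have "4 \<le> card ?U" using deg_ge_distinct_edges[OF finE, of 4 g u] deg by simp
  moreover have "{e1, e2} \<subseteq> ?U"
    using e crosses_links[OF e(4), of "{u}"] crosses_links[OF e(5), of "{u}"] by auto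
  hence "card (?U - {e1, e2}) = card ?U - 2"
    using e(3) by (simp add: card_Diff_subset)
  ultimately have "2 \<le> card (?U - {e1, e2})" by linarith
  then obtain T where "T \<subseteq> ?U - {e1, e2}" "card T = 2" by (meson obtain_subset_with_card_n)
  then obtain f1 f2 where f: "f1 \<in> ?U - {e1, e2}" "f2 \<in> ?U - {e1, e2}" "f1 \<noteq> f2"
    by (auto simp: card_2_iff)
  obtain x where x: "signs x" "3 dvd net ?F ?h x u - \<gamma> u"
  proof (rule orient_at_vertex[of ?F f1 f2 ?h u "\<gamma> u"])
    show "crosses ?h f1 {u}" "crosses ?h f2 {u}" using f by (auto simp: crosses_def)
  qed (use finE f in auto)
  have A: "?A \<subseteq> V" by auto
  have out: "3 dvd net ?F ?h x v - \<gamma> v" if "v \<in> V - ?A" for v using that x(2) by auto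
  have in_eq: "inside ?F ?h ?A = insert e1 (inside E g ?A)"
    using e V by (auto simp: inside_def links_def)
  let ?\<gamma> = "\<lambda>v. \<gamma> v - net (?F - inside ?F ?h ?A) ?h x v"
  have "3 dvd sum ?\<gamma> ?A"
    by (rule glue_sum[OF finV _ ends' A out sum0]) (use finE in simp)
  hence "orientable ?A (inside ?F ?h ?A) ?h ?\<gamma>"
    using free unfolding freely_orientable_def in_eq by blast
  hence "orientable V ?F ?h \<gamma>"
    by (intro orientable_glue[OF _ x(1) out]) (use finE in auto)
  thus "orientable V E g \<gamma>" by (rule orientable_unlift_links[OF finE e(1-5)])
qed

text \<open>The two edges to lift are chosen by trimming the hyperedge that \<open>u\<close> stands for. When all
edges at \<open>u\<close> lead to one vertex, the lifted edge is a loop, and any two of them will do.\<close>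

lemma dense_lift:
  assumes finX: "finite X" and finE: "finite E" and finS: "finite S" and ends: "ends_in (X \<union> S) E g"
    and XS: "X \<inter> S = {}" and X: "X \<noteq> {}"
    and indep: "\<And>e s t. e \<in> E \<Longrightarrow> links g e s t \<Longrightarrow> s \<in> S \<Longrightarrow> t \<in> S \<Longrightarrow> s = t"
    and u: "u \<in> S" and deg: "4 \<le> deg E g {u}" and dense: "dense X S E g"
  obtains e1 e2 y z where "e1 \<in> E" "e2 \<in> E" "e1 \<noteq> e2" "links g e1 u y" "links g e2 u z" "y \<in> X" "z \<in> X"
    "dense X (S - {u}) (insert e1 (inside E g (X \<union> S - {u}))) (g(e1 := (y, z)))"
proof -
  let ?I = "Inl ` inside E g X \<union> Inr ` (S - {u})"
  let ?S = "case_sum (\<lambda>e. {fst (g e), snd (g e)}) (nbrs E g)"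
  have finI: "finite (inside E g X)" using finE by (simp add: inside_def)
  have nb: "w \<in> X" if "w \<in> nbrs E g t" "t \<in> S" for w t
  proof -
    obtain e where e: "e \<in> E" "links g e t w" "w \<noteq> t" using \<open>w \<in> nbrs E g t\<close> by (auto simp: nbrs_def)
    thus ?thesis using links_ends[OF e(2,1) ends] indep[OF e(1,2) \<open>t \<in> S\<close>] by auto
  qed
  have sum_eq: "(\<Sum>i\<in>?I. of_bool (split_by (?S i) P)) =
      (\<Sum>e\<in>inside E g X. of_bool (split_by {fst (g e), snd (g e)} P))
      + (\<Sum>t\<in>S - {u}. of_bool (split_by (nbrs E g t) P) :: int)" for P
    using finI finS by (subst sum.union_disjoint) (auto simp: sum.reindex inj_on_def simp del: sum_of_bool_eq)
  let ?U = "{e\<in>E. crosses g e {u}}"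
  have U4: "4 \<le> card ?U" using deg_ge_distinct_edges[OF finE, of 4 g u] deg by simp
  have ne: "nbrs E g u \<noteq> {}"
  proof -
    have "?U \<noteq> {}" using U4 by (metis card.empty not_numeral_le_zero)
    then obtain e where e: "e \<in> E" "crosses g e {u}" by blast
    then obtain w where "links g e u w" "w \<noteq> u" by (metis crosses_singleton_links)
    thus ?thesis using e by (auto simp: nbrs_def)
  qed
  have sub: "nbrs E g u \<subseteq> X" using nb u by blast
  have "finite ?I" using finI finS by simp
  then obtain y z where yz: "y \<in> nbrs E g u" "z \<in> nbrs E g u" "nbrs E g u = {y} \<or> y \<noteq> z"
    and dense': "\<And>P. partition_on X P \<Longrightarrow> 4 * int (card P) \<le>
      (\<Sum>i\<in>?I. of_bool (split_by (?S i) P)) + of_bool (split_by {y, z} P) + 4"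
  proof (rule trim_hyperedge[OF finX _ sub ne, of ?I ?S])
    fix P assume P: "partition_on X P"
    have "crossing_number X S E g P =
      (\<Sum>i\<in>?I. of_bool (split_by (?S i) P)) + of_bool (split_by (nbrs E g u) P)"
      unfolding sum_eq crossing_number_def
      using sum.remove[OF finS u, of "\<lambda>t. of_bool (split_by (nbrs E g t) P) :: int"]
      by (simp del: sum_of_bool_eq)
    thus "4 * int (card P) \<le> (\<Sum>i\<in>?I. of_bool (split_by (?S i) P)) + of_bool (split_by (nbrs E g u) P) + 4"
      using denseD[OF dense P] by simp
  qed blast
  obtain e1 where e1: "e1 \<in> E" "links g e1 u y" using yz(1) by (auto simp: nbrs_def)
  have yzu: "y \<noteq> u" "z \<noteq> u" using yz by (auto simp: nbrs_def)
  obtain e2 where e2: "e2 \<in> E" "links g e2 u z" "e1 \<noteq> e2"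
  proof (cases "y = z")
    case False
    obtain e2 where "e2 \<in> E" "links g e2 u z" using yz(2) by (auto simp: nbrs_def)
    moreover from this have "e1 \<noteq> e2" using False e1 yzu by (auto simp: links_def)
    ultimately show ?thesis using that by blast
  next
    case True
    have "card (?U - {e1}) \<ge> 3" using U4 finE by (auto simp: card_Diff_singleton_if)
    hence "?U - {e1} \<noteq> {}" by (metis card.empty not_numeral_le_zero)
    then obtain e2 where e2: "e2 \<in> E" "crosses g e2 {u}" "e1 \<noteq> e2" by auto
    then obtain w where w: "links g e2 u w" "w \<noteq> u" by (metis crosses_singleton_links)
    hence "w \<in> nbrs E g u" using e2 by (auto simp: nbrs_def)
    hence "w = z" using True yz(3) by auto
    thus ?thesis using that e2 w by blast
  qed
  let ?E = "insert e1 (inside E g (X \<union> S - {u}))" and ?h = "g(e1 := (y, z))"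
  have Xyz: "y \<in> X" "z \<in> X" using yz sub by auto
  have uX: "u \<notin> X" using u XS by auto
  have e1_not: "e1 \<notin> inside E g (X \<union> S - {u})" using e1(2) by (auto simp: inside_def links_def)
  have inX: "inside ?E ?h X = insert e1 (inside E g X)"
    using Xyz uX e1_not by (auto simp: inside_def)
  have nbE: "nbrs ?E ?h t = nbrs E g t" if t: "t \<in> S - {u}" for t
  proof -
    have tX: "t \<notin> X" using t XS by auto
    have not_u: "\<not> links g e t w" if "e \<in> E" "e \<notin> inside E g (X \<union> S - {u})" for e w
    proof
      assume l: "links g e t w"
      have "t = u \<or> w = u"
        using links_ends[OF l that(1) ends] that l by (auto simp: inside_def links_def)
      hence "w = u" using t by auto
      thus False using indep[OF that(1) l] t u by auto
    qed
    have "\<not> links ?h e1 t w" for w using tX Xyz by (auto simp: links_def)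
    moreover have "links ?h e t w = links g e t w" if "e \<noteq> e1" for e w
      using that by (simp add: links_def)
    moreover have "\<not> links g e1 t w" for w using not_u[OF e1(1) e1_not] .
    ultimately show ?thesis
      using not_u unfolding nbrs_def by (auto simp: inside_def) metis+
  qed
  have "dense X (S - {u}) ?E ?h"
    unfolding dense_def
  proof (intro allI impI)
    fix P assume P: "partition_on X P"
    have "crossing_number X (S - {u}) ?E ?h P
        = (\<Sum>i\<in>?I. of_bool (split_by (?S i) P)) + of_bool (split_by {y, z} P)"
    proof -
      have "e1 \<notin> inside E g X" using e1_not uX by (auto simp: inside_def)
      moreover from this have "(\<Sum>e\<in>inside E g X. of_bool (split_by {fst (?h e), snd (?h e)} P))
          = (\<Sum>e\<in>inside E g X. of_bool (split_by {fst (g e), snd (g e)} P) :: int)"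
        by (intro sum.cong) auto
      moreover have "(\<Sum>t\<in>S - {u}. of_bool (split_by (nbrs ?E ?h t) P))
          = (\<Sum>t\<in>S - {u}. of_bool (split_by (nbrs E g t) P) :: int)"
        by (intro sum.cong) (simp_all add: nbE)
      moreover from calculation(1)
      have "(\<Sum>e\<in>insert e1 (inside E g X). of_bool (split_by {fst (?h e), snd (?h e)} P))
          = of_bool (split_by {fst (?h e1), snd (?h e1)} P)
            + (\<Sum>e\<in>inside E g X. of_bool (split_by {fst (?h e), snd (?h e)} P) :: int)"
        by (rule sum.insert[OF finI])
      moreover have "fst (?h e1) = y" "snd (?h e1) = z" by simp_all
      ultimately show ?thesis
        unfolding crossing_number_def inX sum_eq by presburger
    qed
    thus "4 * int (card P) \<le> crossing_number X (S - {u}) ?E ?h P + 4" using dense'[OF P] by simp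
  qed
  thus ?thesis using that e1 e2 Xyz by blast
qed

lemma inside_all: "ends_in V E g \<Longrightarrow> inside E g V = E"
  by (auto simp: ends_in_def inside_def)

lemma split_pair_union:
  assumes P: "partition_on A P" and Q: "partition_on B Q" and AB: "A \<inter> B = {}"
    and ab: "a \<in> A \<union> B" "b \<in> A \<union> B"
  shows "of_bool (split_by {a, b} (P \<union> Q)) =
    (of_bool (a \<in> A \<and> b \<in> A \<and> split_by {a, b} P) + of_bool (a \<in> B \<and> b \<in> B \<and> split_by {a, b} Q)
      + of_bool ((a \<in> A) \<noteq> (b \<in> A)) :: int)"
proof -
  have U: "\<Union>P = A" "\<Union>Q = B" using P Q by (auto simp: partition_on_def)
  have "a \<in> A \<and> a \<notin> B \<or> a \<in> B \<and> a \<notin> A" "b \<in> A \<and> b \<notin> B \<or> b \<in> B \<and> b \<notin> A" using AB ab by auto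
  moreover have "split_by {a, b} (P \<union> Q) \<longleftrightarrow> split_by {a, b} P \<and> split_by {a, b} Q"
    by (auto simp: split_by_def)
  moreover have "split_by {a, b} P" if "a \<notin> A \<or> b \<notin> A" using that U by (auto simp: split_by_def)
  moreover have "split_by {a, b} Q" if "a \<notin> B \<or> b \<notin> B" using that U by (auto simp: split_by_def)
  ultimately show ?thesis by auto
qed

lemma sum_inside:
  assumes "finite E"
  shows "(\<Sum>e\<in>inside E g B. of_bool (Q e))
    = (\<Sum>e\<in>E. of_bool (fst (g e) \<in> B \<and> snd (g e) \<in> B \<and> Q e) :: int)"
proof -
  have "(\<Sum>e\<in>inside E g B. of_bool (Q e)) =
      (\<Sum>e\<in>E. if fst (g e) \<in> B \<and> snd (g e) \<in> B then of_bool (Q e) else (0::int))"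
    unfolding inside_def by (rule sum.inter_filter[OF assms])
  also have "\<dots> = (\<Sum>e\<in>E. of_bool (fst (g e) \<in> B \<and> snd (g e) \<in> B \<and> Q e))"
    by (rule sum.cong) auto
  finally show ?thesis .
qed

lemma crossing_number_union:
  assumes finE: "finite E" and ends: "ends_in V E g" and A: "A \<subseteq> V"
    and P: "partition_on A P" and Q: "partition_on (V - A) Q"
  shows "crossing_number V {} E g (P \<union> Q)
    = crossing_number A {} (inside E g A) g P + crossing_number (V - A) {} (inside E g (V - A)) g Q + deg E g A"
proof -
  let ?f = "\<lambda>e. {fst (g e), snd (g e)}"
  have in_in: "inside (inside E g B) g B = inside E g B" for B by (auto simp: inside_def)
  have "(\<Sum>e\<in>E. of_bool (split_by (?f e) (P \<union> Q))) =
    (\<Sum>e\<in>E. of_bool (fst (g e) \<in> A \<and> snd (g e) \<in> A \<and> split_by (?f e) P)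
      + of_bool (fst (g e) \<in> V - A \<and> snd (g e) \<in> V - A \<and> split_by (?f e) Q)
      + of_bool (crosses g e A) :: int)"
    unfolding crosses_def
    by (intro sum.cong refl split_pair_union[OF P Q]) (use ends A in \<open>auto simp: ends_in_def\<close>)
  thus ?thesis
    unfolding crossing_number_def in_in sum_inside[OF finE] inside_all[OF ends] deg_def sum.distrib
    by simp
qed

lemma partition_on_Un:
  assumes "partition_on A P" "partition_on B Q" "A \<inter> B = {}"
  shows "partition_on (A \<union> B) (P \<union> Q)" "P \<inter> Q = {}"
proof -
  have d: "disjnt p q" if "p \<in> P" "q \<in> Q" for p q
    using that assms by (auto simp: partition_on_def disjnt_def)
  show "partition_on (A \<union> B) (P \<union> Q)"
    using assms d by (auto simp: partition_on_def pairwise_def disjnt_sym)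
  show "P \<inter> Q = {}"
    using assms by (auto simp: partition_on_def) (metis IntI Union_iff all_not_in_conv)
qed

lemma dense_merge:
  assumes finV: "finite V" and finE: "finite E" and ends: "ends_in V E g" and A: "A \<subseteq> V" "a \<in> A"
    and dense: "dense V {} E g"
  shows "dense (insert a (V - A)) {} (E - inside E g A) (merge A a g)"
  unfolding dense_def
proof (intro allI impI)
  let ?V = "insert a (V - A)" and ?E = "E - inside E g A" and ?h = "merge A a g"
  let ?u = "unmerge A a"
  fix P assume P: "partition_on ?V P"
  have UP: "\<Union>P = ?V" and dP: "\<And>B B'. B \<in> P \<Longrightarrow> B' \<in> P \<Longrightarrow> B \<noteq> B' \<Longrightarrow> disjnt B B'" and neP: "{} \<notin> P"
    using P by (auto simp: partition_on_def pairwise_def)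
  have sub: "B \<subseteq> ?V" if "B \<in> P" for B using that UP by auto
  have mem: "v \<in> ?u B \<longleftrightarrow> proj A a v \<in> B" if "B \<in> P" for v B
    using sub[OF that] A by (auto simp: unmerge_def proj_def)
  have "\<Union>(?u ` P) = V"
  proof
    show "\<Union>(?u ` P) \<subseteq> V" using unmerge_proper(1)[OF A sub] by blast
    show "V \<subseteq> \<Union>(?u ` P)"
    proof
      fix v assume "v \<in> V"
      hence "proj A a v \<in> ?V" by (auto simp: proj_def)
      then obtain B where "B \<in> P" "proj A a v \<in> B" using UP by blast
      thus "v \<in> \<Union>(?u ` P)" using mem by blast
    qed
  qed
  moreover have dju: "disjnt (?u B) (?u B')" if "B \<in> P" "B' \<in> P" "B \<noteq> B'" for B B'
    using dP[OF that] mem that by (auto simp: disjnt_def)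
  moreover have "{} \<notin> ?u ` P" using unmerge_proper(2)[OF A sub] neP by auto
  ultimately have Q: "partition_on V (?u ` P)"
    by (intro partition_onI) auto
  have "inj_on ?u P"
  proof (rule inj_onI)
    fix B B' assume b: "B \<in> P" "B' \<in> P" "?u B = ?u B'"
    show "B = B'"
    proof (rule ccontr)
      assume "B \<noteq> B'"
      hence "disjnt (?u B) (?u B')" using dju b by blast
      moreover have "?u B \<noteq> {}" using unmerge_proper(2)[OF A sub[OF b(1)]] neP b by auto
      ultimately show False using b(3) by (auto simp: disjnt_def)
    qed
  qed
  hence "card (?u ` P) = card P" by (rule card_image)
  moreover have "crossing_number ?V {} ?E ?h P = crossing_number V {} E g (?u ` P)"
  proof -
    have sp: "split_by {fst (?h e), snd (?h e)} P \<longleftrightarrow> split_by {fst (g e), snd (g e)} (?u ` P)" for e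
      using mem by (auto simp: split_by_def merge_def)
    have "\<not> split_by {fst (g e), snd (g e)} (?u ` P)" if "e \<in> inside E g A" for e
    proof -
      obtain B where B: "B \<in> P" "a \<in> B" using UP by auto
      hence "A \<subseteq> ?u B" by (auto simp: unmerge_def)
      thus ?thesis using that B by (auto simp: split_by_def inside_def)
    qed
    hence "(\<Sum>e\<in>?E. of_bool (split_by {fst (g e), snd (g e)} (?u ` P)))
        = (\<Sum>e\<in>E. of_bool (split_by {fst (g e), snd (g e)} (?u ` P)) :: int)"
      by (intro sum.mono_neutral_left) (use finE in auto)
    thus ?thesis
      unfolding crossing_number_def inside_all[OF ends] inside_all[OF ends_in_merge[OF ends]] sp by simp
  qed
  ultimately show "4 * int (card P) \<le> crossing_number ?V {} ?E ?h P + 4"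
    using denseD[OF dense Q] by simp
qed

text \<open>Of the two sides of a cut with at most five edges, one is dense: violating partitions \<open>P\<close> and \<open>Q\<close>
of the two sides are split by at most \<open>4 * card P - 5\<close> and \<open>4 * card Q - 5\<close> edges, so together
they would form a violating partition of the whole graph.\<close>

lemma dense_side:
  assumes finV: "finite V" and finE: "finite E" and ends: "ends_in V E g" and A: "A \<subseteq> V"
    and dense: "dense V {} E g" and deg: "deg E g A \<le> 5"
  shows "dense A {} (inside E g A) g \<or> dense (V - A) {} (inside E g (V - A)) g"
proof (rule ccontr)
  assume "\<not> ?thesis"
  then obtain P Q where P: "partition_on A P" "crossing_number A {} (inside E g A) g P + 5 \<le> 4 * int (card P)"
    and Q: "partition_on (V - A) Q" "crossing_number (V - A) {} (inside E g (V - A)) g Q + 5 \<le> 4 * int (card Q)"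
    unfolding dense_def by force
  have fin: "finite P" "finite Q"
    using finite_elements[OF finite_subset[OF A finV] P(1)] finite_elements[OF _ Q(1)] finV by auto
  have "A \<union> (V - A) = V" using A by auto
  hence "partition_on V (P \<union> Q)" "card (P \<union> Q) = card P + card Q"
    using partition_on_Un[OF P(1) Q(1)] fin by (auto simp: card_Un_disjoint)
  moreover note crossing_number_union[OF finE ends A P(1) Q(1)]
  ultimately show False using denseD[OF dense, of "P \<union> Q"] P(2) Q(2) deg by simp
qed

text \<open>A vertex of degree at most five may be regarded as a hyperedge. If a partition of the
other vertices splits its neighbourhood, \<open>v\<close> can be added to it as a block of its own at the cost
of five edges, four of which are paid for by the new block and one by the hyperedge. Otherwise
\<open>v\<close> joins the block that contains its neighbours.\<close>

lemma dense_vertex: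
  assumes finV: "finite V" and finE: "finite E" and ends: "ends_in V E g" and v: "v \<in> V" "V \<noteq> {v}"
    and dense: "dense V {} E g" and deg: "deg E g {v} \<le> 5"
  shows "dense (V - {v}) {v} E g" "4 \<le> deg E g {v}"
proof -
  have v1: "{v} \<subseteq> V" using v by auto
  have pv: "partition_on {v} {{v}}" by (rule partition_on_space) simp
  have cv: "crossing_number {v} {} (inside E g {v}) g {{v}} = 0"
    unfolding crossing_number_def by (auto simp: inside_def split_by_def intro!: sum.neutral)
  have Vv: "{v} \<union> (V - {v}) = V" using v by auto
  have bound: "4 * int (card P) \<le> crossing_number (V - {v}) {} (inside E g (V - {v})) g P + deg E g {v}"
    if P: "partition_on (V - {v}) P" for P
  proof -
    have "finite P" using finite_elements[OF _ P] finV by simp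
    moreover have "partition_on V ({{v}} \<union> P)" "{{v}} \<inter> P = {}" using partition_on_Un[OF pv P] Vv by auto
    ultimately show ?thesis
      using denseD[OF dense, of "{{v}} \<union> P"] crossing_number_union[OF finE ends v1 pv P] cv by simp
  qed
  have in_in: "inside (inside E g B) g B = inside E g B" for B by (auto simp: inside_def)
  have "V - {v} \<noteq> {}" using v by auto
  from bound[OF partition_on_space[OF this]] show "4 \<le> deg E g {v}"
    unfolding crossing_number_def in_in
    by (auto simp: inside_def split_by_def sum.neutral)
  show "dense (V - {v}) {v} E g"
    unfolding dense_def
  proof (intro allI impI)
    fix P assume P: "partition_on (V - {v}) P"
    let ?c = "crossing_number (V - {v}) {} (inside E g (V - {v})) g P"
    have eq: "crossing_number (V - {v}) {v} E g P = ?c + of_bool (split_by (nbrs E g v) P)"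
      unfolding crossing_number_def in_in by simp
    show "4 * int (card P) \<le> crossing_number (V - {v}) {v} E g P + 4"
    proof (cases "split_by (nbrs E g v) P")
      case True
      thus ?thesis using bound[OF P] deg eq by simp
    next
      case False
      then obtain B where B: "B \<in> P" "nbrs E g v \<subseteq> B" by (auto simp: split_by_def)
      have UP: "\<Union>P = V - {v}" and neP: "{} \<notin> P" and dP: "\<And>C. C \<in> P \<Longrightarrow> C \<noteq> B \<Longrightarrow> disjnt C B"
        using P B by (auto simp: partition_on_def pairwise_def)
      have BV: "B \<subseteq> V - {v}" using B UP by auto
      have "C \<inter> B = {}" if "C \<in> P - {B}" for C using dP[of C] that by (simp add: disjnt_def)
      hence "\<Union>(P - {B}) \<inter> B = {}" by blast
      moreover have "\<Union>(P - {B}) \<union> B = V - {v}" using UP B(1) by blast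
      ultimately have "\<Union>(P - {B}) = V - {v} - B" by blast
      hence PB: "partition_on (V - {v} - B) (P - {B})"
        using P by (auto simp: partition_on_def pairwise_def)
      have pI: "partition_on (insert v B) {insert v B}" by (rule partition_on_space) simp
      have i: "insert v B \<inter> (V - {v} - B) = {}" and UV: "insert v B \<union> (V - {v} - B) = V"
        using BV v by auto
      have Q: "partition_on V ({insert v B} \<union> (P - {B}))" "insert v B \<notin> P - {B}"
        using partition_on_Un[OF pI PB i] unfolding UV by (simp, blast)
      have finP: "finite P" using finite_elements[OF _ P] finV by simp
      have "card (insert (insert v B) (P - {B})) = Suc (card (P - {B}))"
        by (rule card_insert_disjoint) (use Q finP in auto)
      also have "\<dots> = card P" by (rule card_Suc_Diff1[OF finP B(1)])
      finally have card: "card ({insert v B} \<union> (P - {B})) = card P" by simp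
      have "crossing_number V {} E g ({insert v B} \<union> (P - {B})) = ?c"
      proof -
        let ?Q = "{insert v B} \<union> (P - {B})"
        have 1: "of_bool (split_by {fst (g e), snd (g e)} ?Q)
            = (of_bool (fst (g e) \<in> V - {v} \<and> snd (g e) \<in> V - {v} \<and> split_by {fst (g e), snd (g e)} P) :: int)"
          if e: "e \<in> E" for e
        proof (cases "fst (g e) = v \<or> snd (g e) = v")
          case True
          have "{fst (g e), snd (g e)} \<subseteq> insert v B"
            using True e B(2) unfolding nbrs_def links_def by (cases "g e") auto
          thus ?thesis using True by (auto simp: split_by_def)
        next
          case False
          hence "split_by {fst (g e), snd (g e)} ?Q = split_by {fst (g e), snd (g e)} P"
            using B(1) by (auto simp: split_by_def)
          thus ?thesis using False e ends by (auto simp: ends_in_def)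
        qed
        have "(\<Sum>e\<in>E. of_bool (split_by {fst (g e), snd (g e)} ?Q)) =
          (\<Sum>e\<in>E. of_bool (fst (g e) \<in> V - {v} \<and> snd (g e) \<in> V - {v}
            \<and> split_by {fst (g e), snd (g e)} P) :: int)"
          by (rule sum.cong[OF refl 1])
        thus ?thesis
          unfolding crossing_number_def in_in inside_all[OF ends] sum_inside[OF finE] by simp
      qed
      thus ?thesis using denseD[OF dense Q(1)] card eq False by simp
    qed
  qed
qed

text \<open>Without cuts of at most five edges this is the case of six-edge-connected graphs. Otherwise
such a cut has a dense side. If that side has several vertices, contract it and treat it
separately. If it is a single vertex, lift two of its edges and delete it.\<close>

theorem dense_freely_orientable:
  assumes "finite V" "finite E" "ends_in V E g" "dense V {} E g"
  shows "freely_orientable V E g"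
  using assms
proof (induction "card V" arbitrary: V E g rule: less_induct)
  case less
  note finV = less.prems(1) and finE = less.prems(2) and ends = less.prems(3) and dense = less.prems(4)
  show ?case
  proof (cases "\<forall>A. A \<subseteq> V \<longrightarrow> A \<noteq> {} \<longrightarrow> A \<noteq> V \<longrightarrow> 6 \<le> deg E g A")
    case True
    thus ?thesis
      unfolding freely_orientable_def
      using six_edge_connected_orientable[OF finV finE ends] by blast
  next
    case False
    then obtain A where A: "A \<subseteq> V" "A \<noteq> {}" "A \<noteq> V" "\<not> 6 \<le> deg E g A" by blast
    hence A: "A \<subseteq> V" "A \<noteq> {}" "A \<noteq> V" "deg E g A \<le> 5" by simp_all
    obtain B where B: "B \<subseteq> V" "B \<noteq> {}" "B \<noteq> V" "deg E g B \<le> 5" "dense B {} (inside E g B) g"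
    proof (cases "dense A {} (inside E g A) g")
      case True
      thus ?thesis using that A by blast
    next
      case F: False
      hence "dense (V - A) {} (inside E g (V - A)) g" using dense_side[OF finV finE ends A(1) dense A(4)] by blast
      moreover have "deg E g (V - A) \<le> 5" using A(4) deg_compl[OF ends, of A] by simp
      ultimately show ?thesis using that[of "V - A"] A by blast
    qed
    have finB: "finite B" using B(1) finV by (rule finite_subset)
    have cB: "card B < card V" using B finV by (intro psubset_card_mono) auto
    obtain b where b: "b \<in> B" using B by auto
    show ?thesis
    proof (cases "B = {b}")
      case False
      have "{b} \<subset> B" using False b by auto
      hence "1 < card B" using psubset_card_mono[OF finB, of "{b}"] by simp
      let ?V = "insert b (V - B)" and ?E = "E - inside E g B" and ?h = "merge B b g"
      have "card ?V = card V - card B + 1"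
        using B(1) b finV finB by (simp add: card_Diff_subset)
      hence "card ?V < card V" using \<open>1 < card B\<close> cB by linarith
      hence free: "freely_orientable ?V ?E ?h"
        by (rule less.hyps[OF _ _ _ ends_in_merge[OF ends] dense_merge[OF finV finE ends B(1) b dense]])
          (use finV finE in auto)
      show ?thesis
        unfolding freely_orientable_def
      proof (intro allI impI)
        fix \<gamma> :: "_ \<Rightarrow> int" assume sum0: "3 dvd sum \<gamma> V"
        have "sum (total_at B b \<gamma>) ?V = sum \<gamma> V"
          using sum_total_at[OF finV B(1) b, of ?V \<gamma>] unmerge_proper(3)[OF B(1) b, of ?V] by simp
        hence "orientable ?V ?E ?h (total_at B b \<gamma>)" using free sum0 by (simp add: freely_orientable_def)
        then obtain x where x: "signs x" "\<And>v. v \<in> V - B \<Longrightarrow> 3 dvd net E g x v - \<gamma> v"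
          using contract_orient[OF finE b] by blast
        have "freely_orientable B (inside E g B) g"
          by (rule less.hyps[OF cB finB _ ends_in_inside B(5)]) (use finE in \<open>simp add: inside_def\<close>)
        hence "orientable B (inside E g B) g (\<lambda>v. \<gamma> v - net (E - inside E g B) g x v)"
          using glue_sum[OF finV finE ends B(1) x(2) sum0] by (simp add: freely_orientable_def)
        thus "orientable V E g \<gamma>" using orientable_glue[OF finE x(1), of V B g \<gamma>] x(2) by blast
      qed
    next
      case True
      let ?X = "V - {b}"
      have bV: "b \<in> V" "V \<noteq> {b}" using B True by auto
      have "deg E g {b} \<le> 5" using B(4) True by simp
      note dv = dense_vertex[OF finV finE ends bV dense this]
      have VX: "?X \<union> {b} = V" "?X \<union> {b} - {b} = V - {b}" using bV by auto
      obtain e1 e2 y z where e: "e1 \<in> E" "e2 \<in> E" "e1 \<noteq> e2" "links g e1 b y" "links g e2 b z"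
        "y \<in> ?X" "z \<in> ?X" "dense ?X ({b} - {b}) (insert e1 (inside E g (?X \<union> {b} - {b}))) (g(e1 := (y, z)))"
      proof (rule dense_lift[of ?X E "{b}" g b])
        show "ends_in (?X \<union> {b}) E g" using ends VX by simp
        show "?X \<noteq> {}" using bV by auto
        show "dense ?X {b} E g" "4 \<le> deg E g {b}" by (rule dv)+
      qed (use finV finE in auto)
      have "freely_orientable ?X (insert e1 (inside E g ?X)) (g(e1 := (y, z)))"
      proof (rule less.hyps)
        show "card ?X < card V" using finV bV(1) by (rule card_Diff1_less)
        show "ends_in ?X (insert e1 (inside E g ?X)) (g(e1 := (y, z)))"
          using e(6,7) by (auto simp: ends_in_def inside_def)
        show "dense ?X {} (insert e1 (inside E g ?X)) (g(e1 := (y, z)))" using e(8) VX by simp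
      qed (use finV finE in \<open>auto simp: inside_def\<close>)
      thus ?thesis
        by (intro freely_orientable_unlift[OF finV finE ends bV(1) dv(2) e(1-5)]) (use e(6,7) in auto)
    qed
  qed
qed

theorem dense_star_freely_orientable:
  assumes "finite X" "finite S" "finite E" "ends_in (X \<union> S) E g" "X \<inter> S = {}" "X \<noteq> {}"
    and "\<And>e s t. e \<in> E \<Longrightarrow> links g e s t \<Longrightarrow> s \<in> S \<Longrightarrow> t \<in> S \<Longrightarrow> s = t"
    and "\<And>u. u \<in> S \<Longrightarrow> 4 \<le> deg E g {u}" and "dense X S E g"
  shows "freely_orientable (X \<union> S) E g"
  using assms(2-)
proof (induction S arbitrary: E g rule: finite_psubset_induct)
  case (psubset S)
  show ?case
  proof (cases "S = {}")
    case True
    thus ?thesis using dense_freely_orientable[OF assms(1)] psubset.prems by simp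
  next
    case False
    then obtain u where u: "u \<in> S" by auto
    let ?V = "X \<union> S - {u}"
    have uX: "u \<notin> X" using u psubset.prems by auto
    hence V: "?V = X \<union> (S - {u})" by auto
    obtain e1 e2 y z where e: "e1 \<in> E" "e2 \<in> E" "e1 \<noteq> e2" "links g e1 u y" "links g e2 u z" "y \<in> X" "z \<in> X"
      "dense X (S - {u}) (insert e1 (inside E g ?V)) (g(e1 := (y, z)))"
      by (rule dense_lift[OF assms(1) psubset.prems(1) psubset.hyps(1) psubset.prems(2-5) u
            psubset.prems(6)[OF u] psubset.prems(7)])
    let ?E = "insert e1 (inside E g ?V)" and ?h = "g(e1 := (y, z))"
    have e1_not: "e1 \<notin> inside E g ?V" using e(4) by (auto simp: inside_def links_def)
    have "freely_orientable (X \<union> (S - {u})) ?E ?h"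
    proof (rule psubset.IH)
      show "S - {u} \<subset> S" using u by auto
      show "finite ?E" using psubset.prems(1) by (simp add: inside_def)
      show "ends_in (X \<union> (S - {u})) ?E ?h" using e(6,7) uX by (auto simp: ends_in_def inside_def)
      show "X \<inter> (S - {u}) = {}" using psubset.prems by auto
      show "X \<noteq> {}" by (rule psubset.prems)
      show "dense X (S - {u}) ?E ?h" by (rule e(8))
    next
      fix e s t assume a: "e \<in> ?E" "links ?h e s t" "s \<in> S - {u}" "t \<in> S - {u}"
      have "e \<noteq> e1" using a e(6,7) psubset.prems(3) by (auto simp: links_def)
      hence "links g e s t" "e \<in> E" using a by (auto simp: links_def inside_def)
      thus "s = t" using psubset.prems(5) a by blast
    next
      fix t assume t: "t \<in> S - {u}"
      have "deg ?E ?h {t} = deg (inside E g ?V) g {t}"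
      proof -
        have "t \<notin> X" using t psubset.prems by auto
        hence "\<not> crosses ?h e1 {t}" using e(6,7) by (auto simp: crosses_def)
        moreover have "deg ?E ?h {t} = of_bool (crosses ?h e1 {t}) + deg (inside E g ?V) ?h {t}"
          using deg_remove[of ?E e1 ?h "{t}"] e1_not psubset.prems(1) by (simp add: inside_def)
        moreover have "deg (inside E g ?V) ?h {t} = deg (inside E g ?V) g {t}"
          by (rule deg_cong) (use e1_not in \<open>auto simp: crosses_def\<close>)
        ultimately show ?thesis by simp
      qed
      also have "\<dots> = deg E g {t}"
      proof (rule deg_subset[OF psubset.prems(1)])
        show "inside E g ?V \<subseteq> E" by (auto simp: inside_def)
        fix e assume f: "e \<in> E - inside E g ?V"
        show "\<not> crosses g e {t}"
        proof
          assume "crosses g e {t}"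
          then obtain w where w: "links g e t w" "w \<noteq> t" by (rule crosses_singleton_links)
          have "t = u \<or> w = u"
            using links_ends[OF w(1) _ psubset.prems(2)] f w(1) by (auto simp: inside_def links_def)
          hence "w = u" using t by auto
          thus False using psubset.prems(5)[OF _ w(1)] f t u w(2) by auto
        qed
      qed
      finally show "4 \<le> deg ?E ?h {t}" using psubset.prems(6) t by simp
    qed
    hence "freely_orientable ?V ?E ?h" using V by simp
    thus ?thesis
      by (intro freely_orientable_unlift[OF _ psubset.prems(1,2) _ psubset.prems(6)[OF u] e(1-5)])
        (use assms(1) psubset.hyps(1) u e(6,7) uX in auto)
  qed
qed

section \<open>Graphs with a gap in their cut sizes\<close>

text \<open>Two vertices separated by a cut are also separated by a bond inside it, so the absence of bonds
with \<open>6\<close> to \<open>40\<close> edges yields the last assumption. In this form the hypothesis speaks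
of vertex sets only and survives the contraction of sets with small cuts. A cut is called small
if it has at most five edges, a vertex is small if its star is, and other vertices are big.\<close>

locale gapped =
  fixes V :: "'v set" and E :: "'e set" and g :: "'e \<Rightarrow> 'v \<times> 'v"
  assumes finV: "finite V" and finE: "finite E" and ends: "ends_in V E g"
    and loopless: "e \<in> E \<Longrightarrow> fst (g e) \<noteq> snd (g e)"
    and four: "A \<subseteq> V \<Longrightarrow> A \<noteq> {} \<Longrightarrow> A \<noteq> V \<Longrightarrow> 4 \<le> deg E g A"
    and gap: "A \<subseteq> V \<Longrightarrow> s \<in> A \<Longrightarrow> t \<in> V - A \<Longrightarrow>
      \<exists>L\<subseteq>V. s \<in> L \<and> t \<notin> L \<and> (\<forall>e\<in>E. crosses g e L \<longrightarrow> crosses g e A) \<and> (deg E g L \<le> 5 \<or> 41 \<le> deg E g L)"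

lemma deg_mono:
  assumes "\<And>e. e \<in> E \<Longrightarrow> crosses g e L \<Longrightarrow> crosses g e A"
  shows "deg E g L \<le> deg E g A"
  unfolding deg_def by (rule sum_mono) (use assms in auto)

lemma deg_pair:
  assumes "finite E" "u \<noteq> v"
  shows "deg E g {u} + deg E g {v} = deg E g {u, v} + 2 * deg (inside E g {u, v}) g {u}"
proof -
  have "deg (inside E g {u, v}) g {u}
      = (\<Sum>e\<in>E. of_bool (fst (g e) \<in> {u, v} \<and> snd (g e) \<in> {u, v} \<and> crosses g e {u}))"
    unfolding deg_def by (rule sum_inside[OF assms(1)])
  moreover have "deg E g {u} + deg E g {v} = (\<Sum>e\<in>E. of_bool (crosses g e {u, v})
      + 2 * of_bool (fst (g e) \<in> {u, v} \<and> snd (g e) \<in> {u, v} \<and> crosses g e {u}))"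
    unfolding deg_def sum.distrib[symmetric]
    by (rule sum.cong) (use assms(2) in \<open>auto simp: crosses_def\<close>)
  ultimately show ?thesis by (simp add: deg_def sum.distrib sum_distrib_left)
qed

context gapped
begin

text \<open>A set \<open>L\<close> whose cut lies inside a cut not passing through \<open>A\<close> does not divide \<open>A\<close> either,
because then the cut around \<open>A\<close> would consist of two cuts with at least four edges each. So \<open>L\<close>
is still visible after the contraction of \<open>A\<close>.\<close>

lemma gapped_merge:
  assumes A: "A \<subseteq> V" "A \<noteq> V" "a \<in> A" and small: "deg E g A \<le> 5"
  shows "gapped (insert a (V - A)) (E - inside E g A) (merge A a g)"
proof
  let ?V = "insert a (V - A)" and ?E = "E - inside E g A" and ?h = "merge A a g"
  show "finite ?V" "finite ?E" "ends_in ?V ?E ?h" using finV finE ends_in_merge[OF ends] by auto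
  show "fst (?h e) \<noteq> snd (?h e)" if "e \<in> ?E" for e
    using that loopless[of e] A(3) by (auto simp: merge_def proj_def inside_def)
  show "4 \<le> deg ?E ?h B" if "B \<subseteq> ?V" "B \<noteq> {}" "B \<noteq> ?V" for B
    using unmerge_proper[OF A(1,3) that(1)] that four deg_merge[OF finE A(3)] by simp
  fix B s t assume B: "B \<subseteq> ?V" "s \<in> B" "t \<in> ?V - B"
  note u = unmerge_proper[OF A(1,3) B(1)]
  have "s \<in> unmerge A a B" "t \<in> V - unmerge A a B"
    using B A by (auto simp: unmerge_def)
  from gap[OF u(1) this] obtain L where L: "L \<subseteq> V" "s \<in> L" "t \<notin> L"
    "\<forall>e\<in>E. crosses g e L \<longrightarrow> crosses g e (unmerge A a B)" "deg E g L \<le> 5 \<or> 41 \<le> deg E g L"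
    by blast
  have "A \<inter> L = {} \<or> A \<subseteq> L"
  proof (rule ccontr)
    assume "\<not> (A \<inter> L = {} \<or> A \<subseteq> L)"
    hence "4 \<le> deg E g (A \<inter> L)" "4 \<le> deg E g (A - L)" using A by (auto intro!: four)
    moreover have "deg E g (A \<inter> L) + deg E g (A - L) \<le> deg E g A"
      unfolding deg_def sum.distrib[symmetric]
    proof (rule sum_mono)
      fix e assume e: "e \<in> E"
      have "\<not> crosses g e L" if "fst (g e) \<in> A" "snd (g e) \<in> A"
      proof -
        have "\<not> crosses g e (unmerge A a B)" using that u(4) by (auto simp: crosses_def unmerge_def)
        thus ?thesis using L(4) e by blast
      qed
      thus "of_bool (crosses g e (A \<inter> L)) + of_bool (crosses g e (A - L)) \<le> (of_bool (crosses g e A) :: int)"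
        by (auto simp: crosses_def)
    qed
    ultimately show False using small by simp
  qed
  hence un: "unmerge A a (L \<inter> ?V) = L" and inter: "L \<inter> ?V \<inter> A \<subseteq> {a}"
    using A L(1) by (auto simp: unmerge_def)
  have "L \<inter> ?V \<subseteq> ?V" "s \<in> L \<inter> ?V" "t \<notin> L \<inter> ?V" using L B by auto
  moreover have "\<forall>e\<in>?E. crosses ?h e (L \<inter> ?V) \<longrightarrow> crosses ?h e B"
    unfolding crosses_merge[OF A(3) inter] crosses_merge[OF A(3) u(4)] un using L(4) by auto
  moreover have "deg ?E ?h (L \<inter> ?V) = deg E g L"
    unfolding deg_merge[OF finE A(3) inter] un by (rule refl)
  ultimately show "\<exists>L\<subseteq>?V. s \<in> L \<and> t \<notin> L \<and> (\<forall>e\<in>?E. crosses ?h e L \<longrightarrow> crosses ?h e B)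
      \<and> (deg ?E ?h L \<le> 5 \<or> 41 \<le> deg ?E ?h L)"
    using L(5) by (intro exI[of _ "L \<inter> ?V"]) simp
qed

lemma deg_pair_adjacent:
  assumes e: "e \<in> E" "links g e u v"
  shows "u \<noteq> v" "deg E g {u, v} + 2 \<le> deg E g {u} + deg E g {v}"
proof -
  show uv: "u \<noteq> v" using loopless[OF e(1)] e(2) by (auto simp: links_def)
  have "finite (inside E g {u, v})" "e \<in> inside E g {u, v}" "crosses g e {u}"
    using finE e uv crosses_links[OF e(2), of "{u}"] by (auto simp: inside_def links_def)
  hence "1 \<le> deg (inside E g {u, v}) g {u}"
    using deg_remove[of "inside E g {u, v}" e g "{u}"] deg_nonneg[of "inside E g {u, v} - {e}" g "{u}"] by simp
  thus "deg E g {u, v} + 2 \<le> deg E g {u} + deg E g {v}"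
    using deg_pair[OF finE uv, of g] by simp
qed

end

locale trivially_gapped = gapped +
  assumes trivial: "A \<subseteq> V \<Longrightarrow> A \<noteq> {} \<Longrightarrow> A \<noteq> V \<Longrightarrow> deg E g A \<le> 5 \<Longrightarrow> card A = 1 \<or> card (V - A) = 1"
begin

text \<open>The cut around two adjacent small vertices has at most eight edges. Inside it there is a small
cut that separates them from \<open>w\<close>, and this can only be the star of \<open>w\<close>. So the star of every
further vertex lies in this cut; as these stars are disjoint, each of the bounds is tight.\<close>

lemma adjacent_small:
  assumes e: "e \<in> E" "links g e u v" and small: "deg E g {u} \<le> 5" "deg E g {v} \<le> 5"
    and w: "w1 \<in> V - {u, v}" "w2 \<in> V - {u, v}" "w1 \<noteq> w2"
  shows "deg E g {u} = 5 \<and> deg E g {v} = 5 \<and> deg E g {w1} = 4 \<and>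
    (\<forall>f\<in>E. crosses g f {w1} \<longrightarrow> crosses g f {u, v})"
proof -
  note uv = deg_pair_adjacent[OF e]
  have V: "u \<in> V" "v \<in> V" using links_ends[OF e(2,1) ends] by auto
  have *: "4 \<le> deg E g {w} \<and> (\<forall>f\<in>E. crosses g f {w} \<longrightarrow> crosses g f {u, v})" if w: "w \<in> V - {u, v}" for w
  proof -
    obtain L where L: "L \<subseteq> V" "u \<in> L" "w \<notin> L"
      "\<forall>f\<in>E. crosses g f L \<longrightarrow> crosses g f {u, v}" "deg E g L \<le> 5 \<or> 41 \<le> deg E g L"
      using gap[of "{u, v}" u w] V w by auto
    have "deg E g L \<le> deg E g {u, v}" by (rule deg_mono) (use L(4) in blast)
    hence L5: "deg E g L \<le> 5" using uv(2) small L(5) by linarith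
    have "\<not> crosses g e {u, v}" using crosses_links[OF e(2), of "{u, v}"] by simp
    hence "\<not> crosses g e L" using L(4) e(1) by blast
    hence vL: "v \<in> L" using crosses_links[OF e(2), of L] L(2) by simp
    have "card {u, v} \<le> card L"
      by (rule card_mono) (use L(1,2) vL finV finite_subset in auto)
    hence "2 \<le> card L" using uv(1) by simp
    hence "card (V - L) = 1" using trivial[OF L(1) _ _ L5] L(2,3) w by auto
    then obtain q where q: "V - L = {q}" by (rule card_1_singletonE)
    have "w \<in> V - L" using w L(3) by auto
    hence "V - L = {w}" using q by auto
    hence wL: "{w} = V - L" by simp
    have cr: "crosses g f {w} \<longleftrightarrow> crosses g f L" if "f \<in> E" for f
      unfolding wL using that ends by (auto simp: crosses_def ends_in_def)
    have "{w} \<noteq> V" using V w by auto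
    hence "4 \<le> deg E g {w}" using four[of "{w}"] w by auto
    thus ?thesis using cr L(4) by blast
  qed
  have "deg E g {w1} + deg E g {w2} \<le> deg E g {u, v}"
    unfolding deg_def sum.distrib[symmetric]
  proof (rule sum_mono)
    fix f assume f: "f \<in> E"
    have "\<not> (crosses g f {w1} \<and> crosses g f {w2})"
    proof
      assume c: "crosses g f {w1} \<and> crosses g f {w2}"
      hence "g f = (w1, w2) \<or> g f = (w2, w1)" using w(3) by (cases "g f") (auto simp: crosses_def)
      hence "\<not> crosses g f {u, v}" using w by (auto simp: crosses_def)
      thus False using *[OF w(1)] f c by blast
    qed
    thus "of_bool (crosses g f {w1}) + of_bool (crosses g f {w2}) \<le> (of_bool (crosses g f {u, v}) :: int)"
      using *[OF w(1)] *[OF w(2)] f by auto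
  qed
  thus ?thesis using *[OF w(1)] *[OF w(2)] uv(2) small by auto
qed

text \<open>If \<open>u\<close> and \<open>v\<close> were adjacent, a further vertex \<open>w\<close> would have degree four and a neighbour among
\<open>u\<close> and \<open>v\<close>; but then \<open>w\<close>, as one of two adjacent small vertices, would have degree five.\<close>

lemma small_independent:
  assumes V4: "4 \<le> card V" and e: "e \<in> E" "links g e u v"
    and small: "deg E g {u} \<le> 5" "deg E g {v} \<le> 5"
  shows False
proof -
  have V: "u \<in> V" "v \<in> V" using links_ends[OF e(2,1) ends] by auto
  have pick: "\<exists>w1 w2. w1 \<in> V - {a, b} \<and> w2 \<in> V - {a, b} \<and> w1 \<noteq> w2" for a b
  proof -
    have "card V - card {a, b} \<le> card (V - {a, b})" by (rule diff_card_le_card_Diff) simp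
    moreover have "card {a, b} \<le> 2" by (simp add: card_insert_if)
    ultimately have "2 \<le> card (V - {a, b})" using V4 by linarith
    then obtain T where "T \<subseteq> V - {a, b}" "card T = 2" by (meson obtain_subset_with_card_n)
    thus ?thesis by (auto simp: card_2_iff)
  qed
  obtain w w' where w: "w \<in> V - {u, v}" "w' \<in> V - {u, v}" "w \<noteq> w'" using pick by blast
  note a = adjacent_small[OF e small w]
  have "\<exists>f\<in>E. crosses g f {w}"
  proof (rule ccontr)
    assume "\<not> ?thesis"
    hence "deg E g {w} = 0" unfolding deg_def by (intro sum.neutral) auto
    thus False using a by simp
  qed
  then obtain f where f: "f \<in> E" "crosses g f {w}" by blast
  hence "crosses g f {u, v}" using a by blast
  then obtain t where t: "links g f w t" "t = u \<or> t = v"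
    using f(2) w by (cases "g f") (auto simp: crosses_def links_def)
  obtain w1 w2 where "w1 \<in> V - {w, t}" "w2 \<in> V - {w, t}" "w1 \<noteq> w2" using pick by blast
  from adjacent_small[OF f(1) t(1) _ _ this] a t(2) have "deg E g {w} = 5" by auto
  thus False using a by simp
qed

end

text \<open>Different blocks that meet \<open>S\<close> contain different elements of \<open>S\<close>.\<close>

lemma blocks_met:
  assumes P: "partition_on X P" and finX: "finite X" and S: "S \<subseteq> X" "card S \<le> 5"
  shows "(\<Sum>B\<in>P. of_bool (S \<inter> B \<noteq> {} \<and> \<not> S \<subseteq> B)) \<le> 5 * (of_bool (split_by S P) :: int)"
proof (cases "split_by S P")
  case True
  have finP: "finite P" by (rule finite_elements[OF finX P])
  have finS: "finite S" using S(1) finX by (rule finite_subset)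
  have UP: "\<Union>P = X" and dP: "\<And>B C. B \<in> P \<Longrightarrow> C \<in> P \<Longrightarrow> B \<noteq> C \<Longrightarrow> B \<inter> C = {}"
    using P by (auto simp: partition_on_def disjoint_def)
  define blk where "blk x = (SOME B. B \<in> P \<and> x \<in> B)" for x
  have blk: "blk x = B" if "B \<in> P" "x \<in> B" for x B
  proof -
    have "blk x \<in> P \<and> x \<in> blk x" unfolding blk_def by (rule someI[of _ B]) (use that in simp)
    thus ?thesis using dP[of "blk x" B] that by auto
  qed
  have "{B\<in>P. S \<inter> B \<noteq> {} \<and> \<not> S \<subseteq> B} \<subseteq> blk ` S"
  proof
    fix B assume "B \<in> {B\<in>P. S \<inter> B \<noteq> {} \<and> \<not> S \<subseteq> B}"
    then obtain x where "B \<in> P" "x \<in> S" "x \<in> B" by auto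
    thus "B \<in> blk ` S" using blk[of B x] by auto
  qed
  hence "card {B\<in>P. S \<inter> B \<noteq> {} \<and> \<not> S \<subseteq> B} \<le> card (blk ` S)" using finS by (intro card_mono) auto
  also have "\<dots> \<le> card S" using finS by (rule card_image_le)
  finally have "card {B\<in>P. S \<inter> B \<noteq> {} \<and> \<not> S \<subseteq> B} \<le> 5" using S(2) by linarith
  moreover have "(\<Sum>B\<in>P. of_bool (S \<inter> B \<noteq> {} \<and> \<not> S \<subseteq> B)) = int (card {B\<in>P. S \<inter> B \<noteq> {} \<and> \<not> S \<subseteq> B})"
    using finP by (simp add: sum_of_bool_eq Int_def)
  ultimately show ?thesis using True by simp
next
  case False
  then obtain B0 where B0: "B0 \<in> P" "S \<subseteq> B0" by (auto simp: split_by_def)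
  have "\<not> (S \<inter> B \<noteq> {} \<and> \<not> S \<subseteq> B)" if "B \<in> P" for B
  proof (cases "B = B0")
    case False
    hence "B \<inter> B0 = {}" using P that B0(1) by (auto simp: partition_on_def disjoint_def)
    thus ?thesis using B0(2) by auto
  qed (use B0 in simp)
  thus ?thesis using False by (simp add: sum.neutral)
qed

context trivially_gapped
begin

text \<open>Let \<open>B\<close> be a nonempty set of big vertices that omits a big vertex. Assign every small vertex to the side
that contains the majority of its neighbours, counted with multiplicity. The resulting cut
separates two big vertices, so it has at least \<open>41\<close> edges. A small vertex contributes at most
two of them, and none unless \<open>B\<close> splits its neighbourhood. Discounting \<open>z\<close>, at least
\<open>(41 - 2) / 2\<close>, hence \<open>20\<close>, hyperedges are split.\<close>

lemma big_block_cut: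
  assumes V4: "4 \<le> card V" and B: "B \<subseteq> {v\<in>V. 6 \<le> deg E g {v}}"
    and b: "b \<in> B" and b': "b' \<in> V" "6 \<le> deg E g {b'}" "b' \<notin> B"
    and z: "z \<in> V" "deg E g {z} \<le> 5"
  defines "X \<equiv> {v\<in>V. 6 \<le> deg E g {v}}" and "S \<equiv> {v\<in>V. deg E g {v} \<le> 5} - {z}"
  shows "20 \<le> (\<Sum>e\<in>inside E g X. of_bool (crosses g e B))
    + (\<Sum>u\<in>S. of_bool (nbrs E g u \<inter> B \<noteq> {} \<and> \<not> nbrs E g u \<subseteq> B) :: int)"
proof -
  define T where "T = {v\<in>V. deg E g {v} \<le> 5}"
  define U where "U t = {e\<in>E. crosses g e {t}}" for t
  define k where "k t = card {e\<in>U t. crosses g e B}" for t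
  define B' where "B' = B \<union> {t\<in>T. card (U t) < 2 * k t}"
  have finU: "finite (U t)" for t using finE by (simp add: U_def)
  have XT: "X \<inter> T = {}" "X \<union> T = V" by (auto simp: X_def T_def)
  have BX: "B \<subseteq> X" using B by (simp add: X_def)
  have cardU: "int (card (U t)) = deg E g {t}" for t using deg_card[OF finE, of g "{t}"] by (simp add: U_def)
  have z': "z \<in> T" and ST: "S = T - {z}" using z by (auto simp: T_def S_def)
  have finT: "finite T" using finV by (simp add: T_def)
  have b'X: "b' \<in> X" using b' by (simp add: X_def)
  have Vne: "{t} \<noteq> V" if "t \<in> V" for t using V4 by (metis One_nat_def card.empty card.insert card.infinite
        empty_iff finite.emptyI numeral_le_one_iff semiring_norm(69))
  have U4: "4 \<le> card (U t)" "card (U t) \<le> 5" if "t \<in> T" for t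
    using four[of "{t}"] Vne[of t] that cardU[of t] by (auto simp: T_def)
  have other: "\<exists>w\<in>X. links g e t w" if t: "t \<in> T" "e \<in> U t" for e t
  proof -
    have e: "e \<in> E" "crosses g e {t}" using t(2) by (simp_all add: U_def)
    obtain w where w: "links g e t w" "w \<noteq> t" by (rule crosses_singleton_links[OF e(2)])
    have "w \<in> V" using links_ends[OF w(1) e(1) ends] by simp
    moreover have "w \<notin> T" using small_independent[OF V4 e(1) w(1)] t(1) by (auto simp: T_def)
    ultimately show ?thesis using w(1) XT by blast
  qed
  have crB: "crosses g e B' \<longleftrightarrow> (if t \<in> B' then \<not> crosses g e B else crosses g e B)"
    if t: "t \<in> T" "e \<in> U t" for e t
  proof -
    obtain w where w: "w \<in> X" "links g e t w" using other[OF t] by blast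
    have "w \<in> B' \<longleftrightarrow> w \<in> B" using w(1) XT by (auto simp: B'_def)
    moreover have "t \<notin> B" using t(1) BX XT by auto
    ultimately show ?thesis unfolding crosses_links[OF w(2)] by auto
  qed
  have contr: "(\<Sum>e\<in>U t. of_bool (crosses g e B'))
      \<le> 2 * (of_bool (nbrs E g t \<inter> B \<noteq> {} \<and> \<not> nbrs E g t \<subseteq> B) :: int)" if t: "t \<in> T" for t
  proof -
    have kU: "k t \<le> card (U t)" unfolding k_def using finU by (intro card_mono) auto
    have tB': "t \<in> B' \<longleftrightarrow> card (U t) < 2 * k t" using t BX XT by (auto simp: B'_def)
    have val: "(\<Sum>e\<in>U t. of_bool (crosses g e B')) = (if t \<in> B' then int (card (U t)) - int (k t) else int (k t))"
    proof -
      have k: "(\<Sum>e\<in>U t. of_bool (crosses g e B)) = int (k t)"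
        using finU[of t] by (simp add: k_def sum_of_bool_eq Int_def)
      show ?thesis
      proof (cases "t \<in> B'")
        case True
        have "(\<Sum>e\<in>U t. of_bool (crosses g e B')) = (\<Sum>e\<in>U t. 1 - of_bool (crosses g e B) :: int)"
          by (rule sum.cong) (use crB[OF t] True in auto)
        thus ?thesis using True k by (simp add: sum_subtractf)
      next
        case False
        have "(\<Sum>e\<in>U t. of_bool (crosses g e B')) = (\<Sum>e\<in>U t. of_bool (crosses g e B) :: int)"
          by (rule sum.cong) (use crB[OF t] False in auto)
        thus ?thesis using False k by simp
      qed
    qed
    show ?thesis
    proof (cases "nbrs E g t \<inter> B \<noteq> {} \<and> \<not> nbrs E g t \<subseteq> B")
      case True
      have "(if t \<in> B' then int (card (U t)) - int (k t) else int (k t)) \<le> 2"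
        using U4[OF t] tB' by auto
      thus ?thesis unfolding val using True by simp
    next
      case False
      have tB: "t \<notin> B" using t BX XT by auto
      have nb: "w \<in> nbrs E g t" if "e \<in> U t" "links g e t w" for e w
        using that loopless[of e] by (auto simp: nbrs_def U_def links_def)
      have "k t = 0 \<or> k t = card (U t)"
      proof (cases "nbrs E g t \<subseteq> B")
        case True
        have "{e\<in>U t. crosses g e B} = U t"
          using other[OF t] nb True crosses_links tB by fastforce
        thus ?thesis by (simp add: k_def)
      next
        case F: False
        hence "nbrs E g t \<inter> B = {}" using False by blast
        hence "{e\<in>U t. crosses g e B} = {}"
          using other[OF t] nb crosses_links tB by fastforce
        hence "k t = 0" unfolding k_def by (simp only: card.empty)
        thus ?thesis by simp
      qed
      hence "(if t \<in> B' then int (card (U t)) - int (k t) else int (k t)) = 0"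
        using tB' U4[OF t] by auto
      thus ?thesis unfolding val by simp
    qed
  qed
  have dis: "U s \<inter> U t = {}" if st: "s \<in> T" "t \<in> T" "s \<noteq> t" for s t
  proof (rule ccontr)
    assume "U s \<inter> U t \<noteq> {}"
    then obtain e where e: "e \<in> U s" "e \<in> U t" by auto
    obtain w where w: "w \<in> X" "links g e s w" using other[OF st(1) e(1)] by blast
    have "w \<noteq> t" using w(1) st(2) XT by auto
    hence "\<not> crosses g e {t}" using crosses_links[OF w(2), of "{t}"] st(3) by auto
    thus False using e(2) by (simp add: U_def)
  qed
  have cover: "E = inside E g X \<union> (\<Union>t\<in>T. U t)"
  proof
    show "inside E g X \<union> (\<Union>t\<in>T. U t) \<subseteq> E" by (auto simp: inside_def U_def)
    show "E \<subseteq> inside E g X \<union> (\<Union>t\<in>T. U t)"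
    proof
      fix e assume e: "e \<in> E"
      have ne: "fst (g e) \<noteq> snd (g e)" by (rule loopless[OF e])
      hence "e \<in> U (fst (g e))" "e \<in> U (snd (g e))" using e by (auto simp: U_def crosses_def)
      moreover have "fst (g e) \<in> X \<union> T" "snd (g e) \<in> X \<union> T" using ends e XT by (auto simp: ends_in_def)
      ultimately show "e \<in> inside E g X \<union> (\<Union>t\<in>T. U t)" using e by (auto simp: inside_def)
    qed
  qed
  have dis': "inside E g X \<inter> (\<Union>t\<in>T. U t) = {}"
    using XT by (auto simp: inside_def U_def crosses_def)
  have "deg E g B' = (\<Sum>e\<in>inside E g X. of_bool (crosses g e B')) + (\<Sum>e\<in>(\<Union>t\<in>T. U t). of_bool (crosses g e B'))"
    unfolding deg_def
    by (subst cover, rule sum.union_disjoint[OF _ _ dis'])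
      (use finE finT finU in \<open>auto simp: inside_def\<close>)
  also have "(\<Sum>e\<in>(\<Union>t\<in>T. U t). of_bool (crosses g e B')) = (\<Sum>t\<in>T. \<Sum>e\<in>U t. of_bool (crosses g e B') :: int)"
    by (rule sum.UNION_disjoint) (use finT finU dis in auto)
  also have "(\<Sum>e\<in>inside E g X. of_bool (crosses g e B')) = (\<Sum>e\<in>inside E g X. of_bool (crosses g e B) :: int)"
    by (rule sum.cong) (use XT in \<open>auto simp: inside_def crosses_def B'_def\<close>)
  finally have degB': "deg E g B' = (\<Sum>e\<in>inside E g X. of_bool (crosses g e B))
      + (\<Sum>t\<in>T. \<Sum>e\<in>U t. of_bool (crosses g e B'))" .
  let ?n = "\<lambda>t. of_bool (nbrs E g t \<inter> B \<noteq> {} \<and> \<not> nbrs E g t \<subseteq> B) :: int"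
  have "(\<Sum>t\<in>T. \<Sum>e\<in>U t. of_bool (crosses g e B')) \<le> (\<Sum>t\<in>T. 2 * ?n t)"
    by (rule sum_mono) (rule contr)
  also have "\<dots> = 2 * ?n z + 2 * (\<Sum>t\<in>S. ?n t)"
    unfolding ST sum.remove[OF finT z'] by (simp only: sum_distrib_left)
  also have "?n z \<le> 1" by simp
  finally have up: "(\<Sum>t\<in>T. \<Sum>e\<in>U t. of_bool (crosses g e B')) \<le> 2 + 2 * (\<Sum>t\<in>S. ?n t)" by simp
  have "B' \<subseteq> V" using BX XT by (auto simp: B'_def)
  moreover have "b \<in> B'" "b' \<in> V - B'" using b b' b'X XT by (auto simp: B'_def)
  ultimately obtain L where L: "L \<subseteq> V" "b \<in> L" "b' \<notin> L" "\<forall>e\<in>E. crosses g e L \<longrightarrow> crosses g e B'"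
    "deg E g L \<le> 5 \<or> 41 \<le> deg E g L" using gap[of B' b b'] by blast
  have "\<not> deg E g L \<le> 5"
  proof
    assume L5: "deg E g L \<le> 5"
    have "card L = 1 \<or> card (V - L) = 1" by (rule trivial[OF L(1) _ _ L5]) (use L(2,3) b' in auto)
    thus False
    proof
      assume "card L = 1"
      hence "L = {b}" using L(2) by (auto simp: card_1_singleton_iff)
      thus False using L5 b B by auto
    next
      assume "card (V - L) = 1"
      then obtain q where "V - L = {q}" by (rule card_1_singletonE)
      moreover have "b' \<in> V - L" using L(3) b' by auto
      ultimately have "V - L = {b'}" by auto
      hence "deg E g {b'} = deg E g L" using deg_compl[OF ends, of L] by simp
      thus False using L5 b' by simp
    qed
  qed
  hence "41 \<le> deg E g L" using L(5) by blast
  moreover have "deg E g L \<le> deg E g B'" by (rule deg_mono) (use L(4) in blast)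
  moreover have "0 \<le> (\<Sum>e\<in>inside E g X. of_bool (crosses g e B) :: int)" by (rule sum_nonneg) simp
  ultimately show ?thesis using degB' up by linarith
qed

text \<open>If there are at least two blocks, each of them splits at least \<open>20\<close> hyperedges, and each
hyperedge is split by at most five blocks, so at least \<open>4 * card P\<close> hyperedges are split.\<close>

lemma dense_big:
  assumes V4: "4 \<le> card V" and z: "z \<in> V" "deg E g {z} \<le> 5"
  defines "X \<equiv> {v\<in>V. 6 \<le> deg E g {v}}" and "S \<equiv> {v\<in>V. deg E g {v} \<le> 5} - {z}"
  shows "dense X S (inside E g (V - {z})) g"
  unfolding dense_def
proof (intro allI impI)
  fix P assume P: "partition_on X P"
  let ?E = "inside E g (V - {z})"
  have finX: "finite X" using finV by (simp add: X_def)
  have finP: "finite P" by (rule finite_elements[OF finX P])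
  have UP: "\<Union>P = X" and neP: "{} \<notin> P" and dP: "\<And>B C. B \<in> P \<Longrightarrow> C \<in> P \<Longrightarrow> B \<noteq> C \<Longrightarrow> B \<inter> C = {}"
    using P by (auto simp: partition_on_def disjoint_def)
  have XS: "X \<inter> S = {}" "z \<notin> X" "z \<notin> S" "X \<subseteq> V" "S \<subseteq> V" using z by (auto simp: X_def S_def)
  have inX: "inside ?E g X = inside E g X" using XS by (auto simp: inside_def)
  have nb: "nbrs ?E g u = nbrs E g u" if u: "u \<in> S" for u
  proof -
    have "e \<in> ?E" if "e \<in> E" "links g e u w" for e w
    proof -
      have "w \<noteq> z" using small_independent[OF V4 that] z(2) u by (auto simp: S_def)
      thus ?thesis using that links_ends[OF that(2,1) ends] u XS by (auto simp: inside_def links_def)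
    qed
    thus ?thesis by (auto simp: nbrs_def inside_def)
  qed
  have nbX: "nbrs E g u \<subseteq> X" if u: "u \<in> S" for u
  proof
    fix w assume "w \<in> nbrs E g u"
    then obtain e where e: "e \<in> E" "links g e u w" by (auto simp: nbrs_def)
    have "w \<in> V" using links_ends[OF e(2,1) ends] by simp
    moreover have "\<not> deg E g {w} \<le> 5" using small_independent[OF V4 e] u by (auto simp: S_def)
    ultimately show "w \<in> X" by (simp add: X_def)
  qed
  have nb5: "card (nbrs E g u) \<le> 5" if u: "u \<in> S" for u
  proof -
    let ?U = "{e\<in>E. crosses g e {u}}" and ?o = "\<lambda>e. if fst (g e) = u then snd (g e) else fst (g e)"
    have "nbrs E g u \<subseteq> ?o ` ?U"
    proof
      fix w assume "w \<in> nbrs E g u"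
      then obtain e where e: "e \<in> E" "links g e u w" "w \<noteq> u" by (auto simp: nbrs_def)
      hence "e \<in> ?U" using crosses_links[OF e(2), of "{u}"] by simp
      moreover have "w = ?o e" using e(2,3) by (cases "g e") (auto simp: links_def)
      ultimately show "w \<in> ?o ` ?U" by blast
    qed
    hence "card (nbrs E g u) \<le> card (?o ` ?U)" using finE by (intro card_mono) auto
    also have "\<dots> \<le> card ?U" using finE by (intro card_image_le) auto
    also have "\<dots> \<le> 5" using deg_card[OF finE, of g "{u}"] u by (simp add: S_def)
    finally show ?thesis .
  qed
  let ?c = "crossing_number X S ?E g P"
  have c: "?c = (\<Sum>e\<in>inside E g X. of_bool (split_by {fst (g e), snd (g e)} P)) + (\<Sum>u\<in>S. of_bool (split_by (nbrs E g u) P))"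
    unfolding crossing_number_def inX using nb by simp
  show "4 * int (card P) \<le> ?c + 4"
  proof (cases "card P \<le> 1")
    case True
    have "0 \<le> ?c" unfolding c by (intro add_nonneg_nonneg sum_nonneg) auto
    thus ?thesis using True by simp
  next
    case False
    let ?f = "\<lambda>B. (\<Sum>e\<in>inside E g X. of_bool (crosses g e B))
      + (\<Sum>u\<in>S. of_bool (nbrs E g u \<inter> B \<noteq> {} \<and> \<not> nbrs E g u \<subseteq> B)) :: int"
    have "20 \<le> ?f B" if B: "B \<in> P" for B
    proof -
      have "P \<noteq> {B}" using False by auto
      then obtain C where C: "C \<in> P" "C \<noteq> B" using B by blast
      have "B \<noteq> {}" "C \<noteq> {}" using B C neP by auto
      then obtain b b' where b: "b \<in> B" "b' \<in> C" by blast
      have "b' \<notin> B" using b(2) dP[OF B C(1)] C(2) by auto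
      moreover have "B \<subseteq> X" "b' \<in> X" using UP B C(1) b(2) by auto
      ultimately show ?thesis
        using big_block_cut[OF V4 _ b(1) _ _ _ z, of b'] unfolding X_def S_def by auto
    qed
    hence "(\<Sum>B\<in>P. 20) \<le> (\<Sum>B\<in>P. ?f B)" by (rule sum_mono)
    also have "\<dots> = (\<Sum>e\<in>inside E g X. \<Sum>B\<in>P. of_bool (crosses g e B))
        + (\<Sum>u\<in>S. \<Sum>B\<in>P. of_bool (nbrs E g u \<inter> B \<noteq> {} \<and> \<not> nbrs E g u \<subseteq> B))"
      unfolding sum.distrib by (intro arg_cong2[where f = "(+)"] sum.swap)
    also have "\<dots> \<le> (\<Sum>e\<in>inside E g X. 5 * of_bool (split_by {fst (g e), snd (g e)} P))
        + (\<Sum>u\<in>S. 5 * of_bool (split_by (nbrs E g u) P))"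
    proof (intro add_mono sum_mono)
      fix e assume e: "e \<in> inside E g X"
      have "(\<Sum>B\<in>P. of_bool (crosses g e B) :: int) = (\<Sum>B\<in>P. of_bool
          ({fst (g e), snd (g e)} \<inter> B \<noteq> {} \<and> \<not> {fst (g e), snd (g e)} \<subseteq> B))"
        by (rule sum.cong) (auto simp: crosses_def)
      also have "\<dots> \<le> 5 * of_bool (split_by {fst (g e), snd (g e)} P)"
        by (rule blocks_met[OF P finX]) (use e in \<open>auto simp: inside_def card_insert_if\<close>)
      finally show "(\<Sum>B\<in>P. of_bool (crosses g e B) :: int) \<le> 5 * of_bool (split_by {fst (g e), snd (g e)} P)" .
    next
      fix u assume u: "u \<in> S"
      show "(\<Sum>B\<in>P. of_bool (nbrs E g u \<inter> B \<noteq> {} \<and> \<not> nbrs E g u \<subseteq> B) :: int) \<le> 5 * of_bool (split_by (nbrs E g u) P)"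
        by (rule blocks_met[OF P finX nbX[OF u] nb5[OF u]])
    qed
    also have "\<dots> = 5 * ?c" unfolding c by (simp only: sum_distrib_left distrib_left)
    finally show ?thesis by simp
  qed
qed

text \<open>With at least four vertices the small vertices other than \<open>z\<close> are hyperedges on the big ones. The
case of two vertices besides \<open>z\<close> is settled by the parallel edges that must join them.\<close>

lemma freely_orientable_minus_small:
  assumes z: "z \<in> V" "deg E g {z} \<le> 5"
  shows "freely_orientable (V - {z}) (inside E g (V - {z})) g"
proof -
  let ?V = "V - {z}" and ?E = "inside E g (V - {z})"
  have finE': "finite ?E" using finE by (simp add: inside_def)
  have finV': "finite ?V" using finV by simp
  have cV: "card V = Suc (card ?V)" using z(1) finV by (metis card_Suc_Diff1)
  consider "card ?V = 0" | "card ?V = 1" | "card ?V = 2" | "4 \<le> card V" using cV by linarith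
  thus ?thesis
  proof cases
    case 1
    hence "?V = {}" using finV' by simp
    show ?thesis
      unfolding freely_orientable_def orientable_def signs_def \<open>?V = {}\<close>
      by (auto intro: exI[of _ "\<lambda>_. 1"])
  next
    case 2
    then obtain u where u: "?V = {u}" by (rule card_1_singletonE)
    have "?E = {}" unfolding u inside_def using loopless by fastforce
    thus ?thesis
      unfolding freely_orientable_def orientable_def u
      by (auto simp: net_def signs_def intro: exI[of _ "\<lambda>_. 1"])
  next
    case 3
    then obtain u v where uv: "?V = {u, v}" "u \<noteq> v" by (auto simp: card_2_iff)
    have V: "u \<in> V" "v \<in> V" "z \<noteq> u" "z \<noteq> v" using uv by auto
    have "V \<noteq> {u}" "V \<noteq> {v}" using V z uv by auto
    hence "4 \<le> deg E g {u}" "4 \<le> deg E g {v}" using four[of "{u}"] four[of "{v}"] V by auto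
    moreover have "deg E g {u, v} = deg E g {z}"
      using deg_compl[OF ends, of "{z}"] z uv by simp
    ultimately have "2 \<le> deg ?E g {u}"
      using deg_pair[OF finE uv(2), of g] z(2) uv(1) by simp
    hence "2 \<le> card {e\<in>?E. crosses g e {u}}" using deg_card[OF finE', of g "{u}"] by simp
    then obtain T where "T \<subseteq> {e\<in>?E. crosses g e {u}}" "card T = 2" by (meson obtain_subset_with_card_n)
    then obtain e1 e2 where e: "e1 \<in> ?E" "e2 \<in> ?E" "e1 \<noteq> e2" "crosses g e1 {u}" "crosses g e2 {u}"
      by (auto simp: card_2_iff)
    show ?thesis
      unfolding freely_orientable_def
      using orientable_two_parallel[OF finE' uv(2) _ e] ends_in_inside[of "{u, v}" E g] uv(1) by auto
  next
    case 4
    let ?X = "{v\<in>V. 6 \<le> deg E g {v}}" and ?S = "{v\<in>V. deg E g {v} \<le> 5} - {z}"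
    have XS: "?X \<union> ?S = ?V" "?X \<inter> ?S = {}" using z by auto
    have Vne: "{t} \<noteq> V" for t using 4 by auto
    have not_z: "\<not> links g e u z" if "e \<in> E" "u \<in> ?S" for e u
      using small_independent[OF 4 that(1)] that(2) z(2) by blast
    have "4 \<le> deg E g {z}" using four[of "{z}"] z Vne[of z] by auto
    have "\<exists>e\<in>E. crosses g e {z}"
    proof (rule ccontr)
      assume "\<not> ?thesis"
      hence "deg E g {z} = 0" unfolding deg_def by (intro sum.neutral) auto
      thus False using \<open>4 \<le> deg E g {z}\<close> by simp
    qed
    then obtain e where e: "e \<in> E" "crosses g e {z}" by blast
    obtain w where w: "links g e z w" by (rule crosses_singleton_links[OF e(2)])
    have "\<not> deg E g {w} \<le> 5" using small_independent[OF 4 e(1) w z(2)] by blast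
    hence "w \<in> ?X" using links_ends[OF w e(1) ends] by simp
    hence X: "?X \<noteq> {}" by blast
    have "freely_orientable (?X \<union> ?S) ?E g"
    proof (rule dense_star_freely_orientable)
      show "finite ?X" "finite ?S" "finite ?E" using finV finE' by auto
      show "ends_in (?X \<union> ?S) ?E g" unfolding XS by (rule ends_in_inside)
      show "?X \<inter> ?S = {}" "?X \<noteq> {}" by (rule XS, rule X)
      show "dense ?X ?S ?E g" by (rule dense_big[OF 4 z])
      show "s = t" if "e \<in> ?E" "links g e s t" "s \<in> ?S" "t \<in> ?S" for e s t
        using small_independent[OF 4, of e s t] that by (auto simp: inside_def)
      show "4 \<le> deg ?E g {u}" if u: "u \<in> ?S" for u
      proof -
        have "deg ?E g {u} = deg E g {u}"
        proof (rule deg_subset[OF finE])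
          fix e assume e: "e \<in> E - ?E"
          show "\<not> crosses g e {u}"
          proof
            assume "crosses g e {u}"
            then obtain w where w: "links g e u w" by (rule crosses_singleton_links)
            have "w = z" using e w u links_ends[OF w _ ends] by (auto simp: inside_def links_def)
            thus False using not_z[of e u] w e u by blast
          qed
        qed (auto simp: inside_def)
        thus ?thesis using four[of "{u}"] u Vne[of u] by auto
      qed
    qed
    thus ?thesis unfolding XS .
  qed
qed

end

text \<open>Take a set \<open>A\<close> of least size such that \<open>A\<close> has a small cut and neither \<open>A\<close> nor its
complement is a single vertex. Contracting \<open>A\<close> gives a smaller graph. When its orientation is
carried over, the edges that leave \<open>A\<close> are fixed, and the inside of \<open>A\<close> has to be oriented
accordingly. In the graph in which the complement of \<open>A\<close> is contracted to \<open>z\<close> all small cuts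
are stars, by minimality, so its part without \<open>z\<close> is freely orientable.\<close>

theorem gapped_orientable:
  assumes "gapped V E g"
  shows "orientable V E g (\<lambda>_. 0)"
  using assms
proof (induction "card V" arbitrary: V E g rule: less_induct)
  case less
  interpret gapped V E g by (rule less.prems)
  define nontriv where "nontriv A \<longleftrightarrow> A \<subseteq> V \<and> 2 \<le> card A \<and> 2 \<le> card (V - A) \<and> deg E g A \<le> 5" for A
  have sum0: "3 dvd (\<Sum>v\<in>V. 0 :: int)" by simp
  show ?case
  proof (cases "\<exists>A. nontriv A")
    case True
    then obtain A where A: "nontriv A" and least: "\<And>B. nontriv B \<Longrightarrow> card A \<le> card B"
      using ex_has_least_nat[of nontriv _ card] by blast
    have "A \<noteq> {}" using A by (auto simp: nontriv_def)
    hence AV: "A \<subseteq> V" "A \<noteq> V" "V - A \<noteq> V" "deg E g A \<le> 5" "2 \<le> card A" "2 \<le> card (V - A)"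
      using A by (auto simp: nontriv_def)
    have VA: "V - (V - A) = A" using AV by auto
    have finA: "finite A" using AV(1) finV by (rule finite_subset)
    obtain a where a: "a \<in> A" using AV(5) by (metis card.empty ex_in_conv not_numeral_le_zero)
    obtain z where z: "z \<in> V - A" using AV(6) by (metis card.empty ex_in_conv not_numeral_le_zero)
    let ?V1 = "insert a (V - A)"
    have "card ?V1 = card (V - A) + 1" using a finV by simp
    moreover have "card V = card (V - A) + card A"
      using AV(1) finA finV by (simp add: card_Diff_subset card_mono)
    ultimately have "card ?V1 < card V" using AV(5) by linarith
    hence "orientable ?V1 (E - inside E g A) (merge A a g) (\<lambda>_. 0)"
      by (rule less.hyps) (rule gapped_merge[OF AV(1,2) a AV(4)])
    moreover have "total_at A a (\<lambda>_. 0) = (\<lambda>_. 0 :: int)" by (auto simp: total_at_def)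
    ultimately obtain x where x: "signs x" "\<And>v. v \<in> V - A \<Longrightarrow> 3 dvd net E g x v - (\<lambda>_. 0) v"
      using contract_orient[OF finE a, of V g "\<lambda>_. 0"] by auto
    let ?C = "V - A"
    let ?V2 = "insert z A" and ?E2 = "E - inside E g ?C" and ?h = "merge ?C z g"
    have "deg E g ?C \<le> 5" using deg_compl[OF ends] AV(4) by simp
    hence gap2: "gapped ?V2 ?E2 ?h"
      using gapped_merge[of ?C z] AV(3) z VA by auto
    note dm = deg_merge[OF finE z, of _ g]
    have tr: "card B = 1" if B: "B \<subseteq> A" "B \<noteq> {}" "B \<noteq> A" "deg E g B \<le> 5" for B
    proof (rule ccontr)
      assume "card B \<noteq> 1"
      moreover have "card B \<noteq> 0" using B finA finite_subset by (metis card_eq_0_iff)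
      moreover have "card (V - A) \<le> card (V - B)" using finV B(1) by (intro card_mono) auto
      ultimately have "nontriv B" using B AV by (auto simp: nontriv_def)
      moreover have "card B < card A" using B finA by (intro psubset_card_mono) auto
      ultimately show False using least by fastforce
    qed
    have zA: "z \<notin> A" using z by simp
    have dA: "deg ?E2 ?h B = deg E g B" if "B \<subseteq> A" for B
    proof -
      have "B \<inter> ?C \<subseteq> {z}" "unmerge ?C z B = B" using that zA by (auto simp: unmerge_def)
      thus ?thesis using dm[of B] by simp
    qed
    interpret G2: trivially_gapped ?V2 ?E2 ?h
    proof (rule trivially_gapped.intro[OF gap2], unfold_locales)
      fix B assume B: "B \<subseteq> ?V2" "B \<noteq> {}" "B \<noteq> ?V2" "deg ?E2 ?h B \<le> 5"
      have *: "card C = 1 \<or> card (?V2 - C) = 1" if C: "C \<subseteq> A" "C \<noteq> {}" "deg ?E2 ?h C \<le> 5" for C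
      proof (cases "C = A")
        case True
        hence "?V2 - C = {z}" using zA by auto
        thus ?thesis by simp
      next
        case False
        thus ?thesis using tr[OF C(1,2) False] dA[OF C(1)] C(3) by simp
      qed
      show "card B = 1 \<or> card (?V2 - B) = 1"
      proof (cases "z \<in> B")
        case False
        thus ?thesis using * B by auto
      next
        case True
        have "deg ?E2 ?h (?V2 - B) \<le> 5"
          using deg_compl[OF gapped.ends[OF gap2]] B(4) by simp
        moreover have "?V2 - B \<subseteq> A" "?V2 - B \<noteq> {}" "?V2 - (?V2 - B) = B" using True B by auto
        ultimately show ?thesis using *[of "?V2 - B"] by auto
      qed
    qed
    have "deg ?E2 ?h {z} \<le> 5"
    proof -
      have "deg ?E2 ?h (?V2 - {z}) = deg ?E2 ?h {z}" by (rule deg_compl[OF G2.ends])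
      moreover have "?V2 - {z} = A" using zA by auto
      ultimately show ?thesis using dA[of A] AV(4) by simp
    qed
    hence "freely_orientable (?V2 - {z}) (inside ?E2 ?h (?V2 - {z})) ?h"
      by (intro G2.freely_orientable_minus_small) auto
    moreover have "?V2 - {z} = A" using zA by auto
    moreover have "inside ?E2 ?h A = inside E g A"
      using zA AV(1) ends by (auto simp: inside_def merge_def proj_def ends_in_def split: if_splits)
    ultimately have free: "freely_orientable A (inside E g A) ?h" by simp
    have "3 dvd (\<Sum>v\<in>A. (\<lambda>_. 0) v - net (E - inside E g A) g x v)"
      by (rule glue_sum[OF finV finE ends AV(1) x(2) sum0])
    hence "orientable A (inside E g A) ?h (\<lambda>v. (\<lambda>_. 0) v - net (E - inside E g A) g x v)"
      using free by (simp add: freely_orientable_def)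
    hence "orientable A (inside E g A) g (\<lambda>v. (\<lambda>_. 0) v - net (E - inside E g A) g x v)"
      by (rule orientable_cong) (auto simp: inside_def merge_def proj_def)
    thus ?thesis using orientable_glue[OF finE x(1), of V A g "\<lambda>_. 0"] x(2) by blast
  next
    case False
    interpret trivially_gapped V E g
    proof
      fix A assume A: "A \<subseteq> V" "A \<noteq> {}" "A \<noteq> V" "deg E g A \<le> 5"
      have "finite A" "finite (V - A)" using A(1) finV finite_subset by auto
      hence "card A \<noteq> 0" "card (V - A) \<noteq> 0" using A by auto
      moreover have "\<not> (2 \<le> card A \<and> 2 \<le> card (V - A))" using False A by (auto simp: nontriv_def)
      ultimately show "card A = 1 \<or> card (V - A) = 1" by linarith
    qed
    show ?thesis
    proof (cases "\<exists>z\<in>V. deg E g {z} \<le> 5 \<and> V \<noteq> {z}")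
      case True
      then obtain z where z: "z \<in> V" "deg E g {z} \<le> 5" "V \<noteq> {z}" by blast
      have "4 \<le> deg E g {z}" using four[of "{z}"] z by auto
      hence "2 \<le> card {e\<in>E. crosses g e {z}}" using deg_card[OF finE, of g "{z}"] by simp
      then obtain T where "T \<subseteq> {e\<in>E. crosses g e {z}}" "card T = 2" by (meson obtain_subset_with_card_n)
      then obtain e1 e2 where e: "e1 \<in> E" "e2 \<in> E" "e1 \<noteq> e2" "crosses g e1 {z}" "crosses g e2 {z}"
        by (auto simp: card_2_iff)
      obtain x where x: "signs x" "3 dvd net E g x z - 0" by (rule orient_at_vertex[OF finE e])
      have out: "3 dvd net E g x v - (\<lambda>_. 0) v" if "v \<in> V - (V - {z})" for v using that x(2) by auto
      have "3 dvd (\<Sum>v\<in>V - {z}. (\<lambda>_. 0) v - net (E - inside E g (V - {z})) g x v)"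
        by (rule glue_sum[OF finV finE ends _ out sum0]) auto
      hence "orientable (V - {z}) (inside E g (V - {z})) g (\<lambda>v. (\<lambda>_. 0) v - net (E - inside E g (V - {z})) g x v)"
        using freely_orientable_minus_small[OF z(1,2)] by (simp add: freely_orientable_def)
      thus ?thesis using orientable_glue[OF finE x(1), of V "V - {z}" g "\<lambda>_. 0"] out by blast
    next
      case False
      have "6 \<le> deg E g A" if A: "A \<subseteq> V" "A \<noteq> {}" "A \<noteq> V" for A
      proof (rule ccontr)
        assume "\<not> 6 \<le> deg E g A"
        hence d: "deg E g A \<le> 5" by simp
        from trivial[OF A d] show False
        proof
          assume "card A = 1"
          then obtain z where "A = {z}" by (rule card_1_singletonE)
          thus False using False A d by auto
        next
          assume "card (V - A) = 1"
          then obtain z where z: "V - A = {z}" by (rule card_1_singletonE)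
          hence "deg E g {z} = deg E g A" using deg_compl[OF ends, of A] by simp
          moreover have "z \<in> V" using z by auto
          moreover have "V \<noteq> {z}" using z A by blast
          ultimately show False using False d by auto
        qed
      qed
      thus ?thesis by (rule six_edge_connected_orientable[OF finV finE ends sum0])
    qed
  qed
qed

section \<open>From orientations modulo three to flows\<close>

definition flow_values :: "('e \<Rightarrow> int) \<Rightarrow> bool" where
  "flow_values \<phi> \<longleftrightarrow> (\<forall>e. \<phi> e \<in> {-2, -1, 1, 2})"

text \<open>Replacing \<open>k\<close> units along an edge by \<open>3 - k\<close> units against it changes the value by three and
keeps it among \<open>-2\<close>, \<open>-1\<close>, \<open>1\<close> and \<open>2\<close>.\<close>

lemma net_shift:
  assumes fin: "finite E" and F: "F \<subseteq> E"
  shows "net E g (\<lambda>e. \<phi> e - (if e \<in> F then 3 * sgn (\<phi> e) else 0)) v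
    = net E g \<phi> v - 3 * (\<Sum>e\<in>F. sgn (\<phi> e) * inc g e v)"
proof -
  have "net E g (\<lambda>e. \<phi> e - (if e \<in> F then 3 * sgn (\<phi> e) else 0)) v
      = net E g \<phi> v - (\<Sum>e\<in>E. if e \<in> F then 3 * (sgn (\<phi> e) * inc g e v) else 0)"
    unfolding net_def sum_subtractf[symmetric]
    by (rule sum.cong) (auto simp: algebra_simps)
  also have "(\<Sum>e\<in>E. if e \<in> F then 3 * (sgn (\<phi> e) * inc g e v) else 0)
      = (\<Sum>e\<in>E \<inter> F. 3 * (sgn (\<phi> e) * inc g e v))"
    by (rule sum.inter_restrict[OF fin, symmetric])
  also have "E \<inter> F = F" using F by auto
  finally show ?thesis by (simp add: sum_distrib_left)
qed

text \<open>Let \<open>R\<close> be a largest set of vertices that unit flows from \<open>s\<close> can reach inside \<open>R\<close> along the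
directions given by \<open>\<phi>\<close>. No edge is directed out of \<open>R\<close>, since otherwise its head could be
added; the new edge lies outside \<open>R\<close>, so it is not used by the unit flow that it extends. Hence
the net outflow of \<open>R\<close> is not positive, and the excess at \<open>s\<close> forces a deficit elsewhere in \<open>R\<close>.\<close>

lemma unit_flow_to_deficit:
  assumes finV: "finite V" and finE: "finite E" and ends: "ends_in V E g"
    and s: "s \<in> V" "0 < net E g \<phi> s" and ne: "\<And>e. \<phi> e \<noteq> 0"
  obtains t F where "t \<in> V" "net E g \<phi> t < 0" "F \<subseteq> E"
    "\<And>w. (\<Sum>e\<in>F. sgn (\<phi> e) * inc g e w) = of_bool (w = s) - of_bool (w = t)"
proof -
  let ?b = "\<lambda>F w. (\<Sum>e\<in>F. sgn (\<phi> e) * inc g e w)"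
  define good where "good R \<longleftrightarrow> R \<subseteq> V \<and> s \<in> R \<and>
    (\<forall>v\<in>R. \<exists>F\<subseteq>inside E g R. \<forall>w. ?b F w = of_bool (w = s) - of_bool (w = v))" for R
  have "good {s}" using s by (auto simp: good_def intro!: exI[of _ "{}"])
  moreover have "card R \<le> card V" if "good R" for R
    using that finV by (intro card_mono) (auto simp: good_def)
  ultimately obtain R where R: "good R" and max: "\<And>R'. good R' \<Longrightarrow> card R' \<le> card R"
    using ex_has_greatest_nat[of good "{s}" card "Suc (card V)"] by (metis le_imp_less_Suc)
  have RV: "R \<subseteq> V" "s \<in> R" using R by (auto simp: good_def)
  have finR: "finite R" using RV(1) finV by (rule finite_subset)
  show ?thesis
  proof (cases "\<exists>t\<in>R. net E g \<phi> t < 0")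
    case True
    then obtain t where t: "t \<in> R" "net E g \<phi> t < 0" by blast
    obtain F where F: "F \<subseteq> inside E g R" "\<And>w. ?b F w = of_bool (w = s) - of_bool (w = t)"
      using R t(1) unfolding good_def by blast
    have "F \<subseteq> E" using F(1) by (auto simp: inside_def)
    thus ?thesis using that[of t F] t RV F(2) by blast
  next
    case False
    have "0 < (\<Sum>v\<in>R. net E g \<phi> v)"
      by (rule sum_pos2[OF finR RV(2), of "net E g \<phi>"]) (use False s(2) in \<open>auto simp: not_less\<close>)
    also have "\<dots> = (\<Sum>e\<in>E. \<phi> e * (of_bool (fst (g e) \<in> R) - of_bool (snd (g e) \<in> R)))"
      by (rule sum_net[OF finR])
    finally have "\<exists>e\<in>E. 0 < \<phi> e * (of_bool (fst (g e) \<in> R) - of_bool (snd (g e) \<in> R))"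
      by (meson not_less sum_nonpos)
    then obtain e where e: "e \<in> E" "0 < \<phi> e * (of_bool (fst (g e) \<in> R) - of_bool (snd (g e) \<in> R))" by blast
    define v where "v = (if 0 < \<phi> e then fst (g e) else snd (g e))"
    define t where "t = (if 0 < \<phi> e then snd (g e) else fst (g e))"
    have vt: "v \<in> R" "t \<notin> R" "t \<in> V"
      using e ends by (auto simp: v_def t_def ends_in_def zero_less_mult_iff of_bool_def split: if_splits)
    have inc: "sgn (\<phi> e) * inc g e w = of_bool (w = v) - of_bool (w = t)" for w
      using ne[of e] by (auto simp: v_def t_def inc_def sgn_if)
    have einR: "e \<in> inside E g (insert t R)" using e(1) vt by (auto simp: inside_def v_def t_def split: if_splits)
    have sub: "inside E g R \<subseteq> inside E g (insert t R)" by (auto simp: inside_def)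
    have e_notin: "e \<notin> inside E g R" using vt by (auto simp: inside_def t_def split: if_splits)
    obtain F where F: "F \<subseteq> inside E g R" "\<And>w. ?b F w = of_bool (w = s) - of_bool (w = v)"
      using R vt(1) unfolding good_def by blast
    have finF: "finite F" using F(1) finE finite_subset by (fastforce simp: inside_def)
    have "e \<notin> F" using F(1) e_notin by auto
    hence "?b (insert e F) w = of_bool (w = s) - of_bool (w = t)" for w
      using finF F(2)[of w] inc[of w] by simp
    moreover have "insert e F \<subseteq> inside E g (insert t R)" using F(1) sub einR by auto
    ultimately have "\<exists>F\<subseteq>inside E g (insert t R). \<forall>w. ?b F w = of_bool (w = s) - of_bool (w = t)" by blast
    moreover have "\<exists>F\<subseteq>inside E g (insert t R). \<forall>w. ?b F w = of_bool (w = s) - of_bool (w = u)" if "u \<in> R" for u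
      using R that sub unfolding good_def by (meson order_trans)
    ultimately have "good (insert t R)" using RV vt(3) unfolding good_def by auto
    hence "card (insert t R) \<le> card R" by (rule max)
    thus ?thesis using vt(2) finR by simp
  qed
qed

text \<open>Tutte's passage from flows modulo \<open>3\<close> to integer flows: choose values congruent to the
orientation whose total imbalance is least. If it were positive, shifting by three along a unit
flow from a vertex with excess to one with a deficit would decrease it.\<close>

theorem orientable_imp_flow:
  assumes finV: "finite V" and finE: "finite E" and ends: "ends_in V E g"
    and or: "orientable V E g (\<lambda>_. 0)"
  obtains \<phi> where "flow_values \<phi>" "\<And>v. v \<in> V \<Longrightarrow> net E g \<phi> v = 0"
proof -
  define ok where "ok \<phi> \<longleftrightarrow> flow_values \<phi> \<and> (\<forall>v\<in>V. 3 dvd net E g \<phi> v)" for \<phi>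
  define M where "M \<phi> = (\<Sum>v\<in>V. nat \<bar>net E g \<phi> v\<bar>)" for \<phi>
  obtain x where "signs x" "\<forall>v\<in>V. 3 dvd net E g x v - 0" using or by (auto simp: orientable_def)
  hence "ok x" by (auto simp: ok_def flow_values_def signs_def)
  then obtain \<phi> where ok: "ok \<phi>" and least: "\<And>\<psi>. ok \<psi> \<Longrightarrow> M \<phi> \<le> M \<psi>"
    using ex_has_least_nat[of ok x M] by blast
  have val: "\<phi> e \<in> {-2, -1, 1, 2}" for e using ok by (auto simp: ok_def flow_values_def)
  have "net E g \<phi> v = 0" if v: "v \<in> V" for v
  proof (rule ccontr)
    assume nz: "net E g \<phi> v \<noteq> 0"
    have "\<exists>s\<in>V. 0 < net E g \<phi> s"
    proof (rule ccontr)
      assume "\<not> ?thesis"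
      hence le: "\<And>s. s \<in> V \<Longrightarrow> net E g \<phi> s \<le> 0" by (auto simp: not_less)
      have "(\<Sum>s\<in>V. - net E g \<phi> s) = 0" using sum_net_all[OF finV ends, of \<phi>] by (simp add: sum_negf)
      hence "- net E g \<phi> v = 0" using sum_nonneg_eq_0_iff[OF finV, of "\<lambda>s. - net E g \<phi> s"] le v by auto
      thus False using nz by simp
    qed
    then obtain s where s: "s \<in> V" "0 < net E g \<phi> s" by blast
    have ne: "\<phi> e \<noteq> 0" for e using val[of e] by auto
    obtain t F where t: "t \<in> V" "net E g \<phi> t < 0" "F \<subseteq> E"
      and b: "\<And>w. (\<Sum>e\<in>F. sgn (\<phi> e) * inc g e w) = of_bool (w = s) - of_bool (w = t)"
      by (rule unit_flow_to_deficit[OF finV finE ends s ne]) blast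
    let ?\<psi> = "\<lambda>e. \<phi> e - (if e \<in> F then 3 * sgn (\<phi> e) else 0)"
    have net: "net E g ?\<psi> w = net E g \<phi> w - 3 * (of_bool (w = s) - of_bool (w = t))" for w
      using net_shift[OF finE t(3), of g \<phi> w] b[of w] by simp
    have "y - 3 * sgn y \<in> {-2, -1, 1, 2}" if "y \<in> {-2, -1, 1, 2}" for y :: int
      using that by auto
    hence "?\<psi> e \<in> {-2, -1, 1, 2}" for e using val[of e] by (cases "e \<in> F") simp_all
    moreover have dvd: "3 dvd net E g \<phi> w" if "w \<in> V" for w using ok that by (auto simp: ok_def)
    moreover have "3 dvd net E g ?\<psi> w" if "w \<in> V" for w
      unfolding net by (intro dvd_diff dvd dvd_triv_left that)
    ultimately have "ok ?\<psi>" unfolding ok_def flow_values_def by blast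
    hence "M \<phi> \<le> M ?\<psi>" by (rule least)
    moreover have "M ?\<psi> < M \<phi>"
      unfolding M_def
    proof (rule sum_strict_mono_ex1[OF finV])
      have st: "s \<noteq> t" using s(2) t(2) by auto
      have 3: "3 \<le> y" if "3 dvd y" "0 < y" for y :: int using zdvd_imp_le[OF that] .
      have "3 \<le> net E g \<phi> s" "3 \<le> - net E g \<phi> t"
        using 3[OF dvd[OF s(1)] s(2)] 3[of "- net E g \<phi> t"] dvd[OF t(1)] t(2) by simp_all
      moreover have "net E g ?\<psi> s = net E g \<phi> s - 3" "net E g ?\<psi> t = net E g \<phi> t + 3"
        unfolding net using st by simp_all
      ultimately have s': "nat \<bar>net E g ?\<psi> s\<bar> < nat \<bar>net E g \<phi> s\<bar>"
        and t': "nat \<bar>net E g ?\<psi> t\<bar> < nat \<bar>net E g \<phi> t\<bar>"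
        by linarith+
      show "\<exists>w\<in>V. nat \<bar>net E g ?\<psi> w\<bar> < nat \<bar>net E g \<phi> w\<bar>" using s' s(1) by blast
      show "\<forall>w\<in>V. nat \<bar>net E g ?\<psi> w\<bar> \<le> nat \<bar>net E g \<phi> w\<bar>"
      proof
        fix w assume "w \<in> V"
        consider "w = s" | "w = t" | "w \<noteq> s" "w \<noteq> t" by blast
        thus "nat \<bar>net E g ?\<psi> w\<bar> \<le> nat \<bar>net E g \<phi> w\<bar>"
        proof cases
          case 1
          show ?thesis unfolding 1 using s' by (rule less_imp_le)
        next
          case 2
          show ?thesis unfolding 2 using t' by (rule less_imp_le)
        next
          case 3
          hence "net E g ?\<psi> w = net E g \<phi> w" unfolding net by simp
          thus ?thesis by (simp only: order_refl)
        qed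
      qed
    qed
    ultimately show False by simp
  qed
  thus ?thesis using that ok by (auto simp: ok_def)
qed

lemma connected_graph_iff:
  assumes G: "fin_loopless_multigraph G"
    and g: "\<And>e. e \<in> edges G \<Longrightarrow> ends G e = {fst (g e), snd (g e)}"
  shows "connected_graph G \<longleftrightarrow> vertices G \<noteq> {} \<and>
    (\<forall>A. A \<subseteq> vertices G \<longrightarrow> A \<noteq> {} \<longrightarrow> A \<noteq> vertices G \<longrightarrow> (\<exists>e\<in>edges G. crosses g e A))"
    (is "_ \<longleftrightarrow> ?V \<noteq> {} \<and> ?cut")
proof -
  interpret fin_loopless_multigraph G by (rule G)
  let ?r = "{(u, v). u \<in> ?V \<and> v \<in> ?V \<and> (u, v) \<in> (adj G)\<^sup>*}"
  have sub: "fst (g e) \<in> ?V" "snd (g e) \<in> ?V" if "e \<in> edges G" for e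
    using ends_subset[OF that] g[OF that] by auto
  have adj: "(u, v) \<in> adj G \<longleftrightarrow> (\<exists>e\<in>edges G. links g e u v)" for u v
    using g by (auto simp: adj_def links_def doubleton_eq_iff prod_eq_iff)
  have symadj: "sym (adj G)" unfolding sym_def adj by (auto simp: links_sym)
  have equiv: "equiv ?V ?r"
  proof (rule equivI)
    show "?r \<subseteq> ?V \<times> ?V" by auto
    show "refl_on ?V ?r" by (auto simp: refl_on_def)
    show "sym ?r" using sym_rtrancl[OF symadj] by (auto simp: sym_def)
    show "trans ?r" by (auto simp: trans_def intro: rtrancl_trans)
  qed
  show ?thesis
  proof
    assume "connected_graph G"
    then obtain C where C: "?V // ?r = {C}"
      unfolding connected_graph_def components_def by (rule card_1_singletonE)
    have V: "?V \<noteq> {}" using C by (auto simp: quotient_def)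
    have reach: "(u, v) \<in> (adj G)\<^sup>*" if "u \<in> ?V" "v \<in> ?V" for u v
    proof -
      have "?r `` {u} \<in> ?V // ?r" "?r `` {v} \<in> ?V // ?r" by (rule quotientI[OF that(1)], rule quotientI[OF that(2)])
      hence "?r `` {u} = ?r `` {v}" using C by auto
      hence "(u, v) \<in> ?r" using eq_equiv_class[OF _ equiv that(2)] by auto
      thus ?thesis by auto
    qed
    have ?cut
    proof (intro allI impI)
      fix A assume A: "A \<subseteq> ?V" "A \<noteq> {}" "A \<noteq> ?V"
      then obtain a b where ab: "a \<in> A" "b \<in> ?V" "b \<notin> A" by blast
      show "\<exists>e\<in>edges G. crosses g e A"
      proof (rule ccontr)
        assume no: "\<not> ?thesis"
        have "(a, b) \<in> (adj G)\<^sup>*" using reach ab A by blast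
        hence "b \<in> A"
        proof (induction rule: rtrancl_induct)
          case base
          show ?case by (rule ab)
        next
          case (step y z)
          then obtain e where "e \<in> edges G" "links g e y z" using adj by blast
          thus ?case using no step.IH crosses_links by metis
        qed
        thus False using ab by simp
      qed
    qed
    with V show "?V \<noteq> {} \<and> ?cut" by blast
  next
    assume a: "?V \<noteq> {} \<and> ?cut"
    have all: "?r `` {u} = ?V" if u: "u \<in> ?V" for u
    proof (rule ccontr)
      assume ne: "?r `` {u} \<noteq> ?V"
      have "?r `` {u} \<subseteq> ?V" "u \<in> ?r `` {u}" using u by auto
      then obtain e where e: "e \<in> edges G" "crosses g e (?r `` {u})" using a ne by blast
      obtain y z where yz: "links g e y z" "y \<in> ?r `` {u}" "z \<notin> ?r `` {u}"
        using e(2) by (cases "g e") (auto simp: crosses_def links_def)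
      have "(y, z) \<in> adj G" using adj e(1) yz(1) by blast
      hence "(u, z) \<in> (adj G)\<^sup>*" using yz(2) by (auto intro: rtrancl_into_rtrancl)
      moreover have "z \<in> ?V" using sub[OF e(1)] yz(1) by (auto simp: links_def)
      ultimately show False using yz(3) u by auto
    qed
    obtain u where u: "u \<in> ?V" using a by blast
    have "?V // ?r = {?V}"
      using all u unfolding quotient_def by auto
    thus "connected_graph G" unfolding connected_graph_def components_def by simp
  qed
qed

lemma delete_edges_multigraph:
  assumes "fin_loopless_multigraph G"
  shows "fin_loopless_multigraph (delete_edges G F)"
  using assms unfolding fin_loopless_multigraph_def delete_edges_def by auto

text \<open>Among the sets that separate \<open>s\<close> from \<open>t\<close> and whose cut lies in that of \<open>A\<close>, let \<open>L\<close> have the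
fewest cut edges. Its cut is a bond: a cut \<open>M\<close> properly inside it would either separate \<open>s\<close> from
\<open>t\<close> itself, or the symmetric difference with \<open>L\<close> would do so with fewer edges.\<close>

lemma four_edge_connected_gapped:
  assumes G: "fin_loopless_multigraph G" and four: "k_edge_connected 4 G"
    and gap: "\<And>C. edge_cut G C \<Longrightarrow> card C \<notin> {6..40}"
    and g: "\<And>e. e \<in> edges G \<Longrightarrow> ends G e = {fst (g e), snd (g e)}"
  shows "gapped (vertices G) (edges G) g"
proof -
  interpret fin_loopless_multigraph G by (rule G)
  let ?V = "vertices G" and ?E = "edges G"
  define \<delta> where "\<delta> A = {e\<in>?E. crosses g e A}" for A
  have fin\<delta>: "finite (\<delta> A)" for A using finite_edges by (simp add: \<delta>_def)
  have deg\<delta>: "deg ?E g A = int (card (\<delta> A))" for A using deg_card[OF finite_edges] by (simp add: \<delta>_def)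
  have ends: "ends_in ?V ?E g" using ends_subset g by (auto simp: ends_in_def)
  have conn: "connected_graph (delete_edges G F) \<longleftrightarrow> ?V \<noteq> {} \<and>
      (\<forall>A. A \<subseteq> ?V \<longrightarrow> A \<noteq> {} \<longrightarrow> A \<noteq> ?V \<longrightarrow> (\<exists>e\<in>?E - F. crosses g e A))" for F
    using connected_graph_iff[OF delete_edges_multigraph[OF G], of F g] g by (simp add: delete_edges_def)
  have G0: "delete_edges G {} = G" by (simp add: delete_edges_def)
  have cG: "connected_graph G" using four[unfolded k_edge_connected_def, rule_format, of "{}"] by (simp add: G0)
  have ne: "?V \<noteq> {}" using cG conn[of "{}"] G0 by simp
  have four': "4 \<le> deg ?E g A" if A: "A \<subseteq> ?V" "A \<noteq> {}" "A \<noteq> ?V" for A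
  proof (rule ccontr)
    assume "\<not> 4 \<le> deg ?E g A"
    hence "card (\<delta> A) < 4" unfolding deg\<delta> by simp
    moreover have "\<delta> A \<subseteq> ?E" by (auto simp: \<delta>_def)
    ultimately have "connected_graph (delete_edges G (\<delta> A))" using four by (simp add: k_edge_connected_def)
    then obtain e where "e \<in> ?E - \<delta> A" "crosses g e A" using conn[of "\<delta> A"] A by blast
    thus False by (simp add: \<delta>_def)
  qed
  have separating: "separating G C \<longleftrightarrow> C \<subseteq> ?E \<and> \<not> connected_graph (delete_edges G C)" for C
  proof -
    have "card (components (delete_edges G C)) \<noteq> 0"
      using ne finite_vertices unfolding components_def delete_edges_def
      by (auto simp: quotient_def)
    moreover have "card (components G) = 1" using cG by (simp add: connected_graph_def)
    ultimately show ?thesis by (auto simp: separating_def connected_graph_def)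
  qed
  show ?thesis
  proof
    show "finite ?V" "finite ?E" by (rule finite_vertices, rule finite_edges)
    show "ends_in ?V ?E g" by (rule ends)
    show "fst (g e) \<noteq> snd (g e)" if "e \<in> ?E" for e
      using card_ends[OF that] g[OF that] by auto
    show "4 \<le> deg ?E g A" if "A \<subseteq> ?V" "A \<noteq> {}" "A \<noteq> ?V" for A by (rule four'[OF that])
    fix A s t assume A: "A \<subseteq> ?V" "s \<in> A" "t \<in> ?V - A"
    define cand where "cand L \<longleftrightarrow> L \<subseteq> ?V \<and> s \<in> L \<and> t \<notin> L \<and> \<delta> L \<subseteq> \<delta> A" for L
    have "cand A" using A by (auto simp: cand_def)
    then obtain L where L: "cand L" and least: "\<And>L'. cand L' \<Longrightarrow> card (\<delta> L) \<le> card (\<delta> L')"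
      using ex_has_least_nat[of cand A "\<lambda>L. card (\<delta> L)"] by blast
    have L': "L \<subseteq> ?V" "s \<in> L" "t \<notin> L" "\<delta> L \<subseteq> \<delta> A" using L by (auto simp: cand_def)
    have minimal: "\<not> \<delta> M \<subset> \<delta> L" if M: "M \<subseteq> ?V" "M \<noteq> {}" "M \<noteq> ?V" for M
    proof
      assume sub: "\<delta> M \<subset> \<delta> L"
      have less: "card (\<delta> M) < card (\<delta> L)" using fin\<delta> sub by (rule psubset_card_mono)
      have compl: "\<delta> (?V - M) = \<delta> M" using ends by (auto simp: \<delta>_def crosses_def ends_in_def)
      have "4 \<le> card (\<delta> M)" using four'[OF M] unfolding deg\<delta> by simp
      have st: "s \<in> ?V" "t \<in> ?V" using A by auto
      have not_sep: "\<not> (s \<in> N \<and> t \<notin> N)" if "N \<subseteq> ?V" "\<delta> N = \<delta> M" for N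
      proof
        assume "s \<in> N \<and> t \<notin> N"
        hence "cand N" using that sub L'(4) by (auto simp: cand_def)
        hence "card (\<delta> L) \<le> card (\<delta> M)" using least[of N] that by simp
        thus False using less by simp
      qed
      have "s \<in> M \<longleftrightarrow> t \<in> M" using not_sep[OF M(1) refl] not_sep[OF _ compl] st by auto
      obtain N where N: "s \<notin> N" "t \<notin> N" "N \<subseteq> ?V" "\<delta> N = \<delta> M"
      proof (cases "s \<in> M")
        case True
        thus ?thesis using that[of "?V - M"] compl \<open>s \<in> M \<longleftrightarrow> t \<in> M\<close> by auto
      next
        case False
        thus ?thesis using that[of M] M(1) \<open>s \<in> M \<longleftrightarrow> t \<in> M\<close> by auto
      qed
      let ?K = "(L - N) \<union> (N - L)"
      have "crosses g e ?K \<longleftrightarrow> (crosses g e L \<noteq> crosses g e N)" for e by (auto simp: crosses_def)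
      hence K: "\<delta> ?K = \<delta> L - \<delta> M" using N(4) sub by (auto simp: \<delta>_def)
      hence "cand ?K" using L' N by (auto simp: cand_def)
      hence "card (\<delta> L) \<le> card (\<delta> L - \<delta> M)" using least[of ?K] K by simp
      also have "\<dots> = card (\<delta> L) - card (\<delta> M)" using sub fin\<delta> by (intro card_Diff_subset) auto
      finally show False using less \<open>4 \<le> card (\<delta> M)\<close> by linarith
    qed
    have "edge_cut G (\<delta> L)"
      unfolding edge_cut_def
    proof (intro conjI allI impI)
      have "L \<noteq> {}" "L \<noteq> ?V" using L' A by auto
      hence "\<not> connected_graph (delete_edges G (\<delta> L))" using conn[of "\<delta> L"] L'(1) by (auto simp: \<delta>_def)
      thus "separating G (\<delta> L)" unfolding separating by (auto simp: \<delta>_def)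
      fix C assume C: "C \<subset> \<delta> L"
      show "\<not> separating G C"
      proof
        assume "separating G C"
        then obtain M where M: "M \<subseteq> ?V" "M \<noteq> {}" "M \<noteq> ?V" "\<not> (\<exists>e\<in>?E - C. crosses g e M)"
          using conn[of C] ne unfolding separating by blast
        hence "\<delta> M \<subseteq> C" by (auto simp: \<delta>_def)
        thus False using minimal[OF M(1-3)] C by blast
      qed
    qed
    hence "card (\<delta> L) \<notin> {6..40}" by (rule gap)
    hence "deg ?E g L \<le> 5 \<or> 41 \<le> deg ?E g L" unfolding deg\<delta> by auto
    moreover have "\<forall>e\<in>?E. crosses g e L \<longrightarrow> crosses g e A" using L'(4) by (auto simp: \<delta>_def)
    ultimately show "\<exists>L\<subseteq>?V. s \<in> L \<and> t \<notin> L \<and> (\<forall>e\<in>?E. crosses g e L \<longrightarrow> crosses g e A)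
        \<and> (deg ?E g L \<le> 5 \<or> 41 \<le> deg ?E g L)"
      using L' by blast
  qed
qed

theorem theorem1p3:
  fixes G :: "('v, 'e) multigraph"
  assumes "fin_loopless_multigraph G"
    and "k_edge_connected 4 G"
    and "\<And>C. edge_cut G C \<Longrightarrow> card C \<notin> {6..40}"
  shows "\<exists>D f. nowhere_zero_flow 3 G D f"
proof -
  interpret fin_loopless_multigraph G by (rule assms(1))
  let ?V = "vertices G" and ?E = "edges G"
  have "\<exists>q. ends G e = {fst q, snd q}" if "e \<in> ?E" for e
    using card_ends[OF that] by (auto simp: card_2_iff)
  then obtain g where g: "\<And>e. e \<in> ?E \<Longrightarrow> ends G e = {fst (g e), snd (g e)}" by metis
  have gapped: "gapped ?V ?E g" by (rule four_edge_connected_gapped[OF assms g])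
  interpret gapped ?V ?E g by (rule gapped)
  obtain \<phi> where \<phi>: "flow_values \<phi>" "\<And>v. v \<in> ?V \<Longrightarrow> net ?E g \<phi> v = 0"
    by (rule orientable_imp_flow[OF finV finE ends gapped_orientable[OF gapped]]) blast
  have val: "\<phi> e \<in> {-2, -1, 1, 2}" for e using \<phi>(1) by (auto simp: flow_values_def)
  define D where "D = \<lparr>verts = ?V, arcs = ?E, tail = \<lambda>e. if 0 < \<phi> e then fst (g e) else snd (g e),
    head = \<lambda>e. if 0 < \<phi> e then snd (g e) else fst (g e)\<rparr>"
  define f where "f e = nat \<bar>\<phi> e\<bar>" for e
  have arcs: "arcs D = ?E" by (simp add: D_def)
  have "orientation G D" using g by (auto simp: orientation_def D_def)
  moreover have "f e \<in> {1..3 - 1}" for e using val[of e] by (auto simp: f_def)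
  moreover have "(\<Sum>e\<in>out_arcs D v. f e) = (\<Sum>e\<in>in_arcs D v. f e)" if v: "v \<in> ?V" for v
  proof -
    have "int (\<Sum>e\<in>out_arcs D v. f e) = (\<Sum>e\<in>?E. if tail D e = v then \<bar>\<phi> e\<bar> else 0)"
      unfolding out_arcs_def arcs sum.inter_filter[OF finE, symmetric] by (simp add: f_def)
    moreover have "int (\<Sum>e\<in>in_arcs D v. f e) = (\<Sum>e\<in>?E. if head D e = v then \<bar>\<phi> e\<bar> else 0)"
      unfolding in_arcs_def arcs sum.inter_filter[OF finE, symmetric] by (simp add: f_def)
    moreover have "(\<Sum>e\<in>?E. if tail D e = v then \<bar>\<phi> e\<bar> else 0) - (\<Sum>e\<in>?E. if head D e = v then \<bar>\<phi> e\<bar> else 0)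
        = net ?E g \<phi> v"
      unfolding net_def sum_subtractf[symmetric]
      by (rule sum.cong) (use val in \<open>auto simp: D_def inc_def\<close>)
    ultimately show ?thesis using \<phi>(2)[OF v] by linarith
  qed
  ultimately have "nowhere_zero_flow 3 G D f" by (simp add: nowhere_zero_flow_def)
  thus ?thesis by blast
qed

end
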